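(* Let $n$ be an integer with $2\le n\le 4$, let $f:\mathbb{R}^n\to(0,\infty)$ be an even positive continuous function, let $\mu$ be the measure with density $f$ (with measures of hyperplane sections defined by integrating $f$ over the section), let $K$ and $L$ be origin-symmetric convex bodies in $\mathbb{R}^n$, and let $\varepsilon>0$. Suppose that for every $\xi\in S^{n-1}$, $$\mu(K\cap\xi^\perp)\le\mu(L\cap\xi^\perp)+\varepsilon.$$ Then $$\mu(K)\le\mu(L)+\frac{n\varepsilon}{n-1}\,\mathrm{Vol}_n(K)^{1/n}.$$
   Context: $S^{n-1}$ is the Euclidean unit sphere in $\mathbb{R}^n$, and for $\xi\in S^{n-1}$, $\xi^\perp=\{x\in\mathbb{R}^n: \langle x,\xi\rangle=0\}$ is the central hyperplane perpendicular to $\xi$. A convex body is a compact convex set having the origin as an interior point; it is origin-symmetric if $K=-K$. $\mathrm{Vol}_n$ is $n$-dimensional Lebesgue measure. For a closed bounded set $B\subset\mathbb{R}^n$, $\mu(B)=\int_B f(x)\,dx$ with $dx$ the Lebesgue measure on $\mathbb{R}^n$; for a closed bounded set $B\subset\xi^\perp$ (a section), $\mu(B)=\int_B f(x)\,dx$ with $dx$ the $(n-1)$-dimensional Lebesgue measure on $\xi^\perp$. *)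

theory Defs
  imports "HOL-Analysis.Analysis"
begin

definition convex_body :: "'a::euclidean_space set \<Rightarrow> bool" where
  "convex_body K \<longleftrightarrow> compact K \<and> convex K \<and> 0 \<in> interior K"

definition origin_symmetric :: "'a::euclidean_space set \<Rightarrow> bool" where
  "origin_symmetric K \<longleftrightarrow> K = uminus ` K"

definition perp :: "'a::euclidean_space \<Rightarrow> 'a set" where
  "perp \<xi> = {x. x \<bullet> \<xi> = 0}"

definition orthonormal_basis :: "'a::euclidean_space set \<Rightarrow> 'a set \<Rightarrow> bool" where
  "orthonormal_basis B S \<longleftrightarrow>
     pairwise orthogonal B \<and> (\<forall>b\<in>B. norm b = 1) \<and> span B = S"

lemma orthonormal_basis_exists:
  assumes "subspace S"
  shows "\<exists>B. orthonormal_basis B S"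
  using orthonormal_basis_subspace[OF assms] unfolding orthonormal_basis_def by metis

lemma subspace_perp: "subspace (perp \<xi>)"
  unfolding perp_def by (simp add: subspace_hyperplane2)

text \<open>
  Lebesgue measure on a linear subspace \<open>S\<close>, of dimension \<open>dim S\<close>, as a Borel measure on the
  ambient space concentrated on \<open>S\<close>. It is the image of the product Lebesgue measure
  under the coordinate map of an orthonormal basis of \<open>S\<close>, in the same way as
  \<open>lborel\<close> is built from the standard basis. Since Lebesgue measure is invariant
  under orthogonal maps, the result does not depend on which orthonormal basis is chosen.
\<close>

definition subspace_lborel :: "'a::euclidean_space set \<Rightarrow> 'a measure" where
  "subspace_lborel S =
     (let B = (SOME B. orthonormal_basis B S)
      in distr (\<Pi>\<^sub>M b\<in>B. (lborel :: real measure)) borel (\<lambda>c. \<Sum>b\<in>B. c b *\<^sub>R b))"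

definition body_measure :: "('a::euclidean_space \<Rightarrow> real) \<Rightarrow> 'a set \<Rightarrow> real" where
  "body_measure f B = (LINT x:B|lborel. f x)"

definition section_measure ::
    "('a::euclidean_space \<Rightarrow> real) \<Rightarrow> 'a \<Rightarrow> 'a set \<Rightarrow> real" where
  "section_measure f \<xi> B = (LINT x:B|subspace_lborel (perp \<xi>). f x)"

end

theory Submission
  imports Defs "HOL-Probability.Characteristic_Functions"
begin

text \<open>
For a symmetric convex body \<open>K\<close> let \<open>q x\<close> be half the length of \<open>{s. s *\<^sub>R x \<in> K}\<close>, the reciprocal
of the gauge of \<open>K\<close>. Then \<open>q \<ge> 1\<close> on \<open>K\<close> and \<open>q \<le> 1\<close> off \<open>K\<close>, so \<open>u = f * (1\<^sub>K - 1\<^sub>L)\<close> satisfies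
\<open>u \<le> u * q\<close> pointwise and \<open>\<mu> K - \<mu> L = \<integral> u \<le> \<integral> u * q\<close>. Let \<open>D\<close> be the centred ball with the
volume of \<open>K\<close>, and choose \<open>b\<close> so that every central hyperplane section of \<open>D\<close> has \<open>b\<close>-weighted
measure \<open>\<epsilon>\<close>. The assumption on sections says that all integrals of \<open>v = u - b * 1\<^sub>D\<close> over central
hyperplanes are nonpositive. The heart of the matter is that this forces \<open>\<integral> v * q \<le> 0\<close> when
\<open>n \<le> 4\<close> (lemma \<open>chord_integral_nonpos\<close>; in other words, \<open>q\<close> is a limit of positive
mixtures of central hyperplane measures, and \<open>K\<close> is an intersection body). Given this,
\<open>\<integral> u * q \<le> b * \<integral>\<^sub>D q \<le> b * \<integral>\<^sub>K q\<close>, the second step because \<open>q\<close> is larger on \<open>K\<close> than off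
\<open>K\<close> while \<open>K\<close> and \<open>D\<close> have equal volume. Finally \<open>\<integral>\<^sub>K q \<le> n / (n - 1) * Vol K\<close> by slicing
over \<open>s\<close>, and the constant is completed by the inequality \<open>\<kappa>\<^sub>n ^ (n - 1) \<le> \<kappa>\<^sub>m ^ n\<close>, \<open>m = n - 1\<close>,
between volumes of unit balls.

The intersection body property is proved by a Fourier argument.
Let \<open>A \<xi> = \<integral>\<^sub>K cos (y \<bullet> \<xi>) dy\<close> and let \<open>V \<xi>\<close> be the integral of \<open>v\<close> over the hyperplane \<open>\<xi>\<^sup>\<bottom>\<close>. The integral of \<open>exp (- \<bar>\<xi>\<bar>\<^sup>2 / 2) * A \<xi> * V \<xi> / \<bar>\<xi>\<bar>\<close>
is an integral over pairs of orthogonal vectors \<open>x\<close>, \<open>\<xi>\<close>, and it is read in two ways.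

\<^item> Integrating over \<open>\<xi>\<close> first, the Gaussian on \<open>x\<^sup>\<bottom>\<close> is its own Fourier transform. The result is
  the integral of \<open>v x / \<bar>x\<bar>\<close> times the mass of \<open>K\<close> under a Gaussian tube around the line
  through \<open>x\<close> (\<open>tube_limit\<close>). Replacing \<open>K\<close> by \<open>k K\<close> with \<open>k \<rightarrow> \<infinity>\<close> turns the tube into the line,
  and its mass divided by \<open>k * \<bar>x\<bar>\<close> tends to a multiple of \<open>q x\<close> (\<open>tube_to_chord\<close>).

\<^item> In polar coordinates for \<open>\<xi>\<close>, the sign is that of \<open>V\<close> times
  \<open>\<integral> \<bar>s\<bar> ^ (n - 2) * exp (- (\<kappa> s)\<^sup>2 / 2) * A (s \<zeta>) ds\<close>, and the latter is nonnegative for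
  \<open>n \<le> 4\<close> (\<open>radial_fourier_nonneg\<close>). For \<open>n = 4\<close> it is the integral over \<open>K\<close> of a
  Mexican hat in the variable \<open>y \<bullet> \<zeta>\<close>. The hat has nonnegative primitive, and the volumes of
  the parallel sections of \<open>K\<close> decrease away from the origin by Brunn's theorem, obtained
  here from the one-dimensional inequality of Prekopa by integrating out one coordinate at a time.
  For \<open>n = 3\<close> the weight is a mixture of weights of the case \<open>n = 4\<close>, and for \<open>n = 2\<close> the kernel
  itself is a positive Gaussian.

The passage between the two readings is made by thickening the hyperplane to a Gaussian slab of
width \<open>\<delta>\<close>, exchanging integrals, and letting \<open>\<delta> \<rightarrow> 0\<close>.
\<close>

section \<open>Lebesgue measure in orthonormal coordinates\<close>

abbreviation coords :: "'i set \<Rightarrow> ('i \<Rightarrow> real) measure" where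
  "coords B \<equiv> PiM B (\<lambda>_. lborel)"

abbreviation gauss :: "real \<Rightarrow> real" where
  "gauss t \<equiv> exp (- (t\<^sup>2 / 2))"

lemma product_sigma_finite_lborel: "product_sigma_finite (\<lambda>_. lborel :: real measure)"
  by (rule product_sigma_finite.intro) (rule sigma_finite_lborel)

lemma PiM_lborel_coordwise:
  fixes T :: "'i \<Rightarrow> real \<Rightarrow> real"
  assumes "finite B" and T: "\<And>b. T b \<in> borel_measurable borel" and inv: "\<And>b. distr lborel borel (T b) = lborel"
  shows "distr (coords B) (coords B) (\<lambda>c. \<lambda>b\<in>B. T b (c b)) = coords B"
proof -
  interpret product_sigma_finite "\<lambda>_::'i. lborel :: real measure"
    by (rule product_sigma_finite_lborel)
  note T[measurable]
  show ?thesis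
  proof (rule PiM_eqI[OF assms(1)])
    fix A :: "'i \<Rightarrow> real set"
    assume A: "\<And>i. i \<in> B \<Longrightarrow> A i \<in> sets lborel"
    let ?T = "\<lambda>c. \<lambda>b\<in>B. T b (c b)"
    have T': "?T \<in> coords B \<rightarrow>\<^sub>M coords B"
      by measurable
    have pre: "?T -` Pi\<^sub>E B A \<inter> space (coords B) = Pi\<^sub>E B (\<lambda>b. T b -` A b)"
      by (auto simp: space_PiM PiE_def Pi_def extensional_def)
    have tr: "emeasure lborel (T b -` A b) = emeasure lborel (A b)" if "b \<in> B" for b
    proof -
      have "emeasure lborel (T b -` A b) = emeasure (distr lborel borel (T b)) (A b)"
        using A[OF that] T by (subst emeasure_distr) auto
      then show ?thesis by (simp add: inv)
    qed
    have m: "T b -` A b \<in> sets lborel" if "b \<in> B" for b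
      using measurable_sets[of "T b" borel borel "A b"] T A[OF that] by simp
    show "emeasure (distr (coords B) (coords B) ?T) (Pi\<^sub>E B A) = (\<Prod>i\<in>B. emeasure lborel (A i))"
      using A assms(1) m
      by (subst emeasure_distr[OF T']) (auto simp: pre emeasure_PiM tr intro!: sets_PiM_I_finite)
  qed simp
qed

lemma PiM_lborel_translation:
  fixes a :: "'i \<Rightarrow> real"
  assumes "finite B"
  shows "distr (coords B) (coords B) (\<lambda>c. \<lambda>b\<in>B. a b + c b) = coords B"
  by (rule PiM_lborel_coordwise[OF assms, of "\<lambda>b s. a b + s"]) (simp_all add: lborel_distr_plus)

lemma PiM_lborel_uminus:
  assumes "finite B"
  shows "distr (coords B) (coords B) (\<lambda>c. \<lambda>b\<in>B. - c b) = coords B"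
  by (rule PiM_lborel_coordwise[OF assms, of "\<lambda>b s. - s"]) (simp_all add: lborel_distr_uminus)

text \<open>
Uniqueness of Haar measure, by the usual Fubini computation of \<open>\<integral>\<integral> 1\<^sub>A (x + y) * 1\<^sub>B y\<close> in both
orders, with \<open>B\<close> the unit ball. It identifies product measures in rotated coordinates with
Lebesgue measure.
\<close>
lemma translation_invariant_eq_lborel:
  fixes M :: "'a::euclidean_space measure"
  assumes sets: "sets M = sets borel" and sf: "sigma_finite_measure M"
    and tr: "\<And>a. distr M borel (\<lambda>x. a + x) = M"
    and ball: "emeasure M (cball 0 1) = emeasure lborel (cball (0::'a) 1)"
  shows "M = lborel"
proof (rule measure_eqI)
  show "sets M = sets lborel" using sets by simp
next
  fix A assume "A \<in> sets M"
  then have A[measurable]: "A \<in> sets borel" using sets by simp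
  have [measurable_cong]: "sets M = sets borel" by fact
  interpret M: sigma_finite_measure M by fact
  interpret pair_sigma_finite M "lborel :: 'a measure" ..
  let ?B = "cball (0::'a) 1"
  have [measurable]: "?B \<in> sets borel" by simp
  have inv: "(\<integral>\<^sup>+x. h (a + x) \<partial>M) = (\<integral>\<^sup>+x. h x \<partial>M)" if [measurable]: "h \<in> borel_measurable borel" for h a
  proof -
    have "(\<integral>\<^sup>+x. h x \<partial>M) = (\<integral>\<^sup>+x. h x \<partial>distr M borel (\<lambda>x. a + x))" by (simp add: tr)
    also have "\<dots> = (\<integral>\<^sup>+x. h (a + x) \<partial>M)" by (rule nn_integral_distr) auto
    finally show ?thesis by simp
  qed
  have invL: "(\<integral>\<^sup>+x. h (a + x) \<partial>lborel) = (\<integral>\<^sup>+x. h x \<partial>lborel)" if [measurable]: "h \<in> borel_measurable borel" for h and a :: 'a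
  proof -
    have "(\<integral>\<^sup>+x. h x \<partial>lborel) = (\<integral>\<^sup>+x. h x \<partial>distr lborel borel (\<lambda>x. a + x))" by (simp add: lborel_distr_plus)
    also have "\<dots> = (\<integral>\<^sup>+x. h (a + x) \<partial>lborel)" by (rule nn_integral_distr) auto
    finally show ?thesis by simp
  qed
  have "emeasure M A * emeasure lborel ?B = (\<integral>\<^sup>+x. \<integral>\<^sup>+y. indicator A x * indicator ?B y \<partial>lborel \<partial>M)"
    by (subst nn_integral_cmult_indicator) (simp_all add: nn_integral_multc)
  also have "\<dots> = (\<integral>\<^sup>+y. \<integral>\<^sup>+x. indicator A x * indicator ?B y \<partial>M \<partial>lborel)"
    by (rule Fubini'[symmetric]) measurable
  also have "\<dots> = (\<integral>\<^sup>+y. \<integral>\<^sup>+x. indicator A (y + x) * indicator ?B y \<partial>M \<partial>lborel)"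
    by (intro nn_integral_cong inv[symmetric]) measurable
  also have "\<dots> = (\<integral>\<^sup>+x. \<integral>\<^sup>+y. indicator A (y + x) * indicator ?B y \<partial>lborel \<partial>M)"
    by (rule Fubini') measurable
  also have "\<dots> = (\<integral>\<^sup>+x. \<integral>\<^sup>+y. indicator A y * indicator ?B (y - x) \<partial>lborel \<partial>M)"
  proof (rule nn_integral_cong)
    fix x
    have "(\<integral>\<^sup>+y. indicator A (y + x) * indicator ?B y \<partial>lborel)
        = (\<integral>\<^sup>+y. (\<lambda>y. indicator A y * indicator ?B (y - x)) (x + y) \<partial>lborel)"
      by (simp add: add.commute)
    also have "\<dots> = (\<integral>\<^sup>+y. indicator A y * indicator ?B (y - x) \<partial>lborel)"
      by (rule invL) measurable
    finally show "(\<integral>\<^sup>+y. indicator A (y + x) * indicator ?B y \<partial>lborel)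
        = (\<integral>\<^sup>+y. indicator A y * indicator ?B (y - x) \<partial>lborel)" .
  qed
  also have "\<dots> = (\<integral>\<^sup>+y. \<integral>\<^sup>+x. indicator A y * indicator ?B (y - x) \<partial>M \<partial>lborel)"
    by (rule Fubini'[symmetric]) measurable
  also have "\<dots> = (\<integral>\<^sup>+y. \<integral>\<^sup>+x. indicator A y * indicator ?B x \<partial>M \<partial>lborel)"
  proof (rule nn_integral_cong)
    fix y
    have "(\<integral>\<^sup>+x. indicator A y * indicator ?B (y - x) \<partial>M) = (\<integral>\<^sup>+x. indicator A y * indicator ?B (y - (y + x)) \<partial>M)"
      by (rule inv[symmetric]) measurable
    also have "\<dots> = (\<integral>\<^sup>+x. indicator A y * indicator ?B x \<partial>M)"
      by (intro nn_integral_cong) (auto simp: indicator_def)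
    finally show "(\<integral>\<^sup>+x. indicator A y * indicator ?B (y - x) \<partial>M) = (\<integral>\<^sup>+x. indicator A y * indicator ?B x \<partial>M)" .
  qed
  also have "\<dots> = emeasure lborel A * emeasure M ?B"
    by (subst nn_integral_cmult_indicator) (simp_all add: nn_integral_multc)
  finally have eq: "emeasure M A * emeasure lborel ?B = emeasure lborel A * emeasure lborel ?B"
    using ball by simp
  have "emeasure lborel ?B \<noteq> 0" "emeasure lborel ?B \<noteq> \<infinity>"
    by (simp_all add: emeasure_cball unit_ball_vol_pos less_imp_neq[symmetric])
  with eq show "emeasure M A = emeasure lborel A"
    by (metis ennreal_mult_cancel_left infinity_ennreal_def mult.commute)
qed

definition lincomb :: "'a::euclidean_space set \<Rightarrow> ('a \<Rightarrow> real) \<Rightarrow> 'a" where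
  "lincomb B c = (\<Sum>b\<in>B. c b *\<^sub>R b)"

lemma measurable_lincomb[measurable]: "lincomb B \<in> borel_measurable (coords B)"
  unfolding lincomb_def by measurable

lemma orthonormal_inner:
  assumes "orthonormal_basis B S" "b \<in> B" "b' \<in> B"
  shows "b \<bullet> b' = (if b = b' then 1 else 0)"
  using assms by (auto simp: orthonormal_basis_def pairwise_def orthogonal_def norm_eq_1)

lemma orthonormal_finite: "orthonormal_basis B S \<Longrightarrow> finite B"
  by (meson orthonormal_basis_def pairwise_orthogonal_imp_finite)

lemma orthonormal_independent: "orthonormal_basis B S \<Longrightarrow> independent B"
  unfolding orthonormal_basis_def
  by (rule pairwise_orthogonal_independent) auto

lemma lincomb_inner:
  assumes "orthonormal_basis B S" "b \<in> B"
  shows "lincomb B c \<bullet> b = c b"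
proof -
  have "lincomb B c \<bullet> b = (\<Sum>b'\<in>B. if b' = b then c b' else 0)"
    unfolding lincomb_def inner_sum_left using assms by (auto intro!: sum.cong simp: orthonormal_inner)
  also have "\<dots> = c b" using assms(2) orthonormal_finite[OF assms(1)] by simp
  finally show ?thesis .
qed

lemma norm_lincomb:
  assumes "orthonormal_basis B S"
  shows "norm (lincomb B c) = sqrt (\<Sum>b\<in>B. (c b)\<^sup>2)"
proof -
  have "lincomb B c \<bullet> lincomb B c = (\<Sum>b\<in>B. c b * (lincomb B c \<bullet> b))"
    by (subst (2) lincomb_def) (simp add: inner_sum_right)
  also have "\<dots> = (\<Sum>b\<in>B. (c b)\<^sup>2)"
    using assms by (intro sum.cong) (auto simp: lincomb_inner power2_eq_square)
  finally show ?thesis by (simp add: norm_eq_sqrt_inner)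
qed

lemma lincomb_eq:
  assumes "orthonormal_basis B S" "x \<in> S"
  shows "lincomb B (\<lambda>b. x \<bullet> b) = x"
proof -
  let ?y = "lincomb B (\<lambda>b. x \<bullet> b)"
  have S: "span B = S" using assms by (simp add: orthonormal_basis_def)
  have "?y \<in> S" unfolding lincomb_def S[symmetric] by (intro span_sum span_scale span_base)
  then have "x - ?y \<in> span B" using assms S by (metis span_diff)
  moreover have "orthogonal (x - ?y) b" if "b \<in> B" for b
    using lincomb_inner[OF assms(1) that] by (simp add: orthogonal_def inner_diff_left)
  ultimately have "orthogonal (x - ?y) (x - ?y)" by (metis orthogonal_to_span)
  then show ?thesis by (simp add: orthogonal_self)
qed

text \<open>
The image measure is translation invariant because the product measure is, and the
unit ball has the right mass because the norm is computed from orthonormal coordinates in the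
standard way.
\<close>
lemma lborel_orthonormal:
  fixes B :: "'a::euclidean_space set"
  assumes B: "orthonormal_basis B UNIV"
  shows "lborel = distr (coords B) borel (lincomb B)"
proof (rule translation_invariant_eq_lborel[symmetric])
  let ?P = "coords B" and ?M = "distr (coords B) borel (lincomb B)"
  have fin: "finite B" using B by (rule orthonormal_finite)
  have card: "card B = DIM('a)"
    using B orthonormal_independent[OF B] by (metis orthonormal_basis_def dim_UNIV dim_eq_card dim_span)
  show "sets ?M = sets borel" by simp
  have cball: "emeasure ?M (cball 0 r) = emeasure lborel (cball (0::'a) r)" if "r > 0" for r
  proof -
    have "lincomb B -` cball 0 r \<inter> space ?P = {f. sqrt (\<Sum>i\<in>B. (f i)\<^sup>2) \<le> r} \<inter> space ?P"
      by (auto simp: norm_lincomb[OF B])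
    then show ?thesis
      using that by (simp add: emeasure_distr emeasure_cball_aux[OF fin] emeasure_cball card)
  qed
  show "emeasure ?M (cball 0 1) = emeasure lborel (cball (0::'a) 1)" by (rule cball) simp
  show "sigma_finite_measure ?M"
  proof (rule sigma_finite_measure.intro, intro exI conjI)
    let ?F = "range (\<lambda>n::nat. cball (0::'a) (real (Suc n)))"
    show "countable ?F" "?F \<subseteq> sets ?M" by auto
    show "\<Union>?F = space ?M"
    proof -
      have "\<exists>n. norm x \<le> real (Suc n)" for x :: 'a
        by (meson le_SucI of_nat_le_iff order_trans real_arch_simple)
      then show ?thesis by auto
    qed
    show "\<forall>a\<in>?F. emeasure ?M a \<noteq> \<infinity>"
      by (auto simp: cball emeasure_cball)
  qed
  fix a :: 'a
  have lin: "lincomb B (\<lambda>b\<in>B. a \<bullet> b + c b) = a + lincomb B c" for c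
    using lincomb_eq[OF B UNIV_I, of a]
    by (simp add: lincomb_def scaleR_add_left sum.distrib)
  have "distr ?M borel (\<lambda>x. a + x) = distr ?P borel (\<lambda>c. a + lincomb B c)"
    by (subst distr_distr) (auto simp: comp_def)
  also have "\<dots> = distr ?P borel (lincomb B \<circ> (\<lambda>c. \<lambda>b\<in>B. a \<bullet> b + c b))"
    by (simp add: lin comp_def)
  also have "\<dots> = distr (distr ?P ?P (\<lambda>c. \<lambda>b\<in>B. a \<bullet> b + c b)) borel (lincomb B)"
    by (subst distr_distr) auto
  also have "\<dots> = ?M" by (simp add: PiM_lborel_translation[OF fin])
  finally show "distr ?M borel (\<lambda>x. a + x) = ?M" .
qed

lemma orthonormal_insert:
  fixes e :: "'a::euclidean_space"
  assumes B: "orthonormal_basis B (perp e)" and e: "norm e = 1"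
  shows "e \<notin> B" "orthonormal_basis (insert e B) UNIV"
proof -
  have *: "b \<bullet> e = 0" if "b \<in> B" for b
    using B that span_base[OF that] by (auto simp: orthonormal_basis_def perp_def)
  show "e \<notin> B" using *[of e] e by auto
  have "x \<in> span (insert e B)" for x
  proof -
    have "x - (x \<bullet> e) *\<^sub>R e \<in> span B"
      using B e by (auto simp: orthonormal_basis_def perp_def inner_diff_left norm_eq_1)
    then show ?thesis by (auto simp: span_insert)
  qed
  then show "orthonormal_basis (insert e B) UNIV"
    using B e * by (auto simp: orthonormal_basis_def pairwise_insert orthogonal_def inner_commute)
qed

text \<open>
The form in which invariance is used: a point is its component in a hyperplane together with its
height over it.
\<close>
lemma lborel_split:
  fixes e :: "'a::euclidean_space"
  assumes B: "orthonormal_basis B (perp e)" and e: "norm e = 1"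
  shows "lborel = distr (coords B \<Otimes>\<^sub>M lborel) borel (\<lambda>(c, s). lincomb B c + s *\<^sub>R e)"
proof (rule measure_eqI)
  let ?P = "coords B"
  interpret product_sigma_finite "\<lambda>_::'a. lborel :: real measure"
    by (rule product_sigma_finite_lborel)
  have fin: "finite B" using B by (rule orthonormal_finite)
  interpret P: sigma_finite_measure ?P using fin by (rule sigma_finite)
  interpret pair_sigma_finite ?P "lborel :: real measure" ..
  note ins = orthonormal_insert[OF B e]
  fix A assume "A \<in> sets (lborel :: 'a measure)"
  then have [measurable]: "A \<in> sets borel" by simp
  have lin: "lincomb (insert e B) (c(e := s)) = lincomb B c + s *\<^sub>R e" for c s
    using fin ins(1) unfolding lincomb_def
    by (subst sum.insert) (auto intro!: sum.cong)
  have "emeasure lborel A = (\<integral>\<^sup>+x. indicator A x \<partial>distr (coords (insert e B)) borel (lincomb (insert e B)))"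
    using lborel_orthonormal[OF ins(2)] by simp
  also have "\<dots> = (\<integral>\<^sup>+c. indicator A (lincomb (insert e B) c) \<partial>(coords (insert e B)))"
    by (subst nn_integral_distr) auto
  also have "\<dots> = (\<integral>\<^sup>+c. \<integral>\<^sup>+s. indicator A (lincomb B c + s *\<^sub>R e) \<partial>lborel \<partial>?P)"
    using fin ins(1) by (subst product_nn_integral_insert) (auto simp: lin)
  also have "\<dots> = (\<integral>\<^sup>+p. indicator A (lincomb B (fst p) + snd p *\<^sub>R e) \<partial>(?P \<Otimes>\<^sub>M lborel))"
    by (subst lborel.nn_integral_fst[symmetric]) auto
  also have "\<dots> = emeasure (distr (?P \<Otimes>\<^sub>M lborel) borel (\<lambda>(c, s). lincomb B c + s *\<^sub>R e)) A"
    by (subst nn_integral_indicator[symmetric], simp, subst nn_integral_distr)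
       (auto simp: case_prod_unfold)
  finally show "emeasure lborel A = emeasure (distr (?P \<Otimes>\<^sub>M lborel) borel (\<lambda>(c, s). lincomb B c + s *\<^sub>R e)) A" .
qed simp

lemma lborel_integral_split:
  fixes h :: "'a::euclidean_space \<Rightarrow> real"
  assumes B: "orthonormal_basis B (perp e)" and e: "norm e = 1" and h: "integrable lborel h"
  shows "(LINT x|lborel. h x) = (LINT c|coords B. LINT s|lborel. h (lincomb B c + s *\<^sub>R e))"
    and "(LINT x|lborel. h x) = (LINT s|lborel. LINT c|coords B. h (lincomb B c + s *\<^sub>R e))"
proof -
  let ?P = "coords B"
  interpret product_sigma_finite "\<lambda>_::'a. lborel :: real measure"
    by (rule product_sigma_finite_lborel)
  interpret P: sigma_finite_measure ?P using orthonormal_finite[OF B] by (rule sigma_finite)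
  interpret PP: pair_sigma_finite ?P "lborel :: real measure" ..
  have [measurable]: "h \<in> borel_measurable borel" using h by auto
  have int: "integrable (?P \<Otimes>\<^sub>M lborel) (\<lambda>(c, s). h (lincomb B c + s *\<^sub>R e))"
    using h unfolding lborel_split[OF B e] by (subst (asm) integrable_distr_eq) (auto simp: case_prod_unfold)
  have "(LINT x|lborel. h x) = (LINT p|(?P \<Otimes>\<^sub>M lborel). h (lincomb B (fst p) + snd p *\<^sub>R e))"
    by (subst lborel_split[OF B e], subst integral_distr) (auto simp: case_prod_unfold)
  then show "(LINT x|lborel. h x) = (LINT c|?P. LINT s|lborel. h (lincomb B c + s *\<^sub>R e))"
    and "(LINT x|lborel. h x) = (LINT s|lborel. LINT c|?P. h (lincomb B c + s *\<^sub>R e))"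
    using PP.integral_fst[OF int] PP.integral_snd[OF int] by (simp_all add: case_prod_unfold)
qed

section \<open>Gaussian and unimodal integrals on the line\<close>

lemma gauss_integrable:
  "integrable lborel (\<lambda>s::real. gauss s)"
  "integrable lborel (\<lambda>s::real. \<bar>s\<bar> * gauss s)"
  "integrable lborel (\<lambda>s::real. s\<^sup>2 * gauss s)"
proof -
  have "integrable lborel (\<lambda>x. sqrt (2 * pi) * (std_normal_density x * \<bar>x\<bar> ^ k))" for k
    by (intro integrable_mult_right integrable_std_normal_moment_abs)
  from this[of 0] this[of 1] this[of 2]
  show "integrable lborel (\<lambda>s::real. gauss s)"
    "integrable lborel (\<lambda>s::real. \<bar>s\<bar> * gauss s)"
    "integrable lborel (\<lambda>s::real. s\<^sup>2 * gauss s)"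
    by (simp_all add: std_normal_density_def mult_ac)
qed

lemma gauss_fourier:
  fixes t :: real
  shows "integrable lborel (\<lambda>s::real. complex_of_real (gauss s) * iexp (t * s))"
    and "(LINT s|lborel. complex_of_real (gauss s) * iexp (t * s))
      = complex_of_real (sqrt (2 * pi) * gauss t)"
proof -
  show "integrable lborel (\<lambda>s::real. complex_of_real (gauss s) * iexp (t * s))"
    by (rule Bochner_Integration.integrable_bound[OF gauss_integrable(1)]) (auto simp: norm_mult)
  have "complex_of_real (gauss t) = (LINT s|lborel. std_normal_density s *\<^sub>R iexp (t * s))"
    using fun_cong[OF char_std_normal_distribution, of t]
    unfolding char_def by (subst (asm) integral_density) (auto simp: normal_density_nonneg)
  also have "\<dots> = (LINT s|lborel. (1 / sqrt (2 * pi)) *\<^sub>R (complex_of_real (gauss s) * iexp (t * s)))"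
    by (intro Bochner_Integration.integral_cong) (auto simp: std_normal_density_def scaleR_conv_of_real)
  also have "\<dots> = (1 / sqrt (2 * pi)) *\<^sub>R (LINT s|lborel. complex_of_real (gauss s) * iexp (t * s))"
    by (rule integral_scaleR_right)
  finally show "(LINT s|lborel. complex_of_real (gauss s) * iexp (t * s))
      = complex_of_real (sqrt (2 * pi) * gauss t)"
    by (simp add: scaleR_conv_of_real field_simps)
qed

lemma gauss_cos:
  "(LINT s|lborel. gauss s * cos (t * s)) = sqrt (2 * pi) * gauss t"
proof -
  have "(LINT s|lborel. Re (complex_of_real (gauss s) * iexp (t * s)))
      = Re (LINT s|lborel. complex_of_real (gauss s) * iexp (t * s))"
    using gauss_fourier(1)[of t] by (rule integral_Re)
  also have "\<dots> = sqrt (2 * pi) * gauss t" by (subst gauss_fourier(2)) simp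
  finally show ?thesis by (simp add: Re_exp)
qed

lemma integral_derivative_zero:
  fixes F f :: "real \<Rightarrow> real"
  assumes F: "\<And>x. (F has_real_derivative f x) (at x)" and f: "continuous_on UNIV f"
    and int: "integrable lborel f" and A: "(F \<longlongrightarrow> 0) at_bot" and B: "(F \<longlongrightarrow> 0) at_top"
  shows "(LINT x|lborel. f x) = 0"
proof -
  have "(LBINT x=-\<infinity>..\<infinity>. f x) = 0 - 0"
  proof (rule interval_integral_FTC_integrable[where F=F])
    show "isCont f x" for x using f by (simp add: continuous_on_eq_continuous_at)
    show "set_integrable lborel (einterval (-\<infinity>) \<infinity>) f" using int by (simp add: set_integrable_def)
    show "((F \<circ> real_of_ereal) \<longlongrightarrow> 0) (at_right (-\<infinity>))" "((F \<circ> real_of_ereal) \<longlongrightarrow> 0) (at_left \<infinity>)"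
      using A B by (simp_all add: ereal_tendsto_simps)
  qed (use F in \<open>auto simp: has_real_derivative_iff_has_vector_derivative\<close>)
  then show ?thesis by (simp add: interval_lebesgue_integral_def set_lebesgue_integral_def)
qed

lemma gauss_trig_integrable:
  "integrable lborel (\<lambda>s::real. gauss s * cos (t * s))"
  "integrable lborel (\<lambda>s::real. s * gauss s * sin (t * s))"
  "integrable lborel (\<lambda>s::real. s\<^sup>2 * gauss s * cos (t * s))"
proof -
  show "integrable lborel (\<lambda>s::real. gauss s * cos (t * s))"
    by (rule Bochner_Integration.integrable_bound[OF gauss_integrable(1)]) (auto simp: abs_mult intro!: mult_left_le)
  show "integrable lborel (\<lambda>s::real. s * gauss s * sin (t * s))"
    by (rule Bochner_Integration.integrable_bound[OF gauss_integrable(2)]) (auto simp: abs_mult intro!: mult_left_le)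
  show "integrable lborel (\<lambda>s::real. s\<^sup>2 * gauss s * cos (t * s))"
    by (rule Bochner_Integration.integrable_bound[OF gauss_integrable(3)]) (auto simp: abs_mult intro!: mult_left_le)
qed

lemma gauss_decay:
  fixes F :: "real \<Rightarrow> real"
  assumes "\<And>s. \<bar>F s\<bar> \<le> (1 + \<bar>s\<bar>) * gauss s"
  shows "(F \<longlongrightarrow> 0) at_bot" "(F \<longlongrightarrow> 0) at_top"
proof -
  have ev: "\<bar>F s\<bar> \<le> \<bar>4 * inverse s\<bar>" if "1 \<le> \<bar>s\<bar>" for s
  proof -
    have e: "1 + s\<^sup>2 / 2 \<le> exp (s\<^sup>2 / 2)" by (rule exp_ge_add_one_self)
    have "\<bar>s\<bar> * 1 \<le> \<bar>s\<bar> * \<bar>s\<bar>" using that by (intro mult_left_mono) auto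
    moreover have "s * s \<ge> 0" by simp
    ultimately have "(1 + \<bar>s\<bar>) * \<bar>s\<bar> \<le> 4 * (1 + s\<^sup>2 / 2)"
      by (simp add: algebra_simps power2_eq_square)
    also have "\<dots> \<le> 4 * exp (s\<^sup>2 / 2)" by (rule mult_left_mono[OF e]) simp
    finally have "(1 + \<bar>s\<bar>) * \<bar>s\<bar> \<le> 4 * exp (s\<^sup>2 / 2)" .
    then have "(1 + \<bar>s\<bar>) * \<bar>s\<bar> * gauss s \<le> 4 * exp (s\<^sup>2 / 2) * gauss s"
      by (rule mult_right_mono) simp
    also have "\<dots> = 4" by (simp add: mult_exp_exp)
    finally have "(1 + \<bar>s\<bar>) * gauss s \<le> 4 / \<bar>s\<bar>"
      using that by (subst pos_le_divide_eq) (simp_all add: mult_ac)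
    moreover have "\<bar>4 * inverse s\<bar> = 4 / \<bar>s\<bar>" by (simp only: abs_mult abs_inverse divide_inverse abs_numeral)
    ultimately show ?thesis using order_trans[OF assms[of s]] by (simp only:)
  qed
  have lim: "((\<lambda>s::real. \<bar>4 * inverse s\<bar>) \<longlongrightarrow> 0) at_infinity"
    by (intro tendsto_rabs_zero tendsto_mult_right_zero tendsto_inverse_0)
  have "eventually (\<lambda>s::real. 1 \<le> \<bar>s\<bar>) at_infinity"
    unfolding eventually_at_infinity by (intro exI[of _ 1]) simp
  then have "(F \<longlongrightarrow> 0) at_infinity"
    by (intro Lim_null_comparison[OF _ lim]) (auto elim!: eventually_mono simp: ev)
  then show "(F \<longlongrightarrow> 0) at_bot" "(F \<longlongrightarrow> 0) at_top"
    by (auto intro: tendsto_mono at_bot_le_at_infinity at_top_le_at_infinity)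
qed

lemma gauss_sin:
  "(LINT s|lborel. s * gauss s * sin (t * s)) = t * (sqrt (2 * pi) * gauss t)"
proof -
  \<comment> \<open>integration by parts: \<open>?F\<close> vanishes at both ends\<close>
  let ?F = "\<lambda>s. gauss s * sin (t * s)"
  let ?f = "\<lambda>s. t * (gauss s * cos (t * s)) - s * gauss s * sin (t * s)"
  have "(LINT s|lborel. ?f s) = 0"
  proof (rule integral_derivative_zero[where F="?F"])
    show "(?F has_real_derivative ?f s) (at s)" for s
      by (auto intro!: derivative_eq_intros simp: algebra_simps power2_eq_square)
    show "integrable lborel ?f" by (intro Bochner_Integration.integrable_diff integrable_mult_right gauss_trig_integrable)
    have "\<bar>?F s\<bar> \<le> (1 + \<bar>s\<bar>) * gauss s" for s
      using mult_left_le[of "\<bar>sin (t * s)\<bar>" "gauss s"] by (simp add: abs_mult distrib_right add_increasing2)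
    then show "(?F \<longlongrightarrow> 0)  at_bot" "(?F \<longlongrightarrow> 0) at_top" by (rule gauss_decay)+
  qed (intro continuous_intros; simp)
  then show ?thesis
    by (subst (asm) Bochner_Integration.integral_diff) (auto intro!: integrable_mult_right gauss_trig_integrable simp: gauss_cos)
qed

text \<open>
This transform of \<open>s\<^sup>2 * exp (- s\<^sup>2 / 2)\<close> is the Mexican hat, up to a factor the negative second
derivative of a Gaussian; it follows from \<open>gauss_cos\<close> by integrating by parts twice.
\<close>
lemma gauss_sq_cos:
  "(LINT s|lborel. s\<^sup>2 * gauss s * cos (t * s)) = sqrt (2 * pi) * (1 - t\<^sup>2) * gauss t"
proof -
  let ?F = "\<lambda>s. s * gauss s * cos (t * s)"
  let ?f = "\<lambda>s. gauss s * cos (t * s) - s\<^sup>2 * gauss s * cos (t * s) - t * (s * gauss s * sin (t * s))"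
  have "(LINT s|lborel. ?f s) = 0"
  proof (rule integral_derivative_zero[where F="?F"])
    show "(?F has_real_derivative ?f s) (at s)" for s
      by (auto intro!: derivative_eq_intros simp: algebra_simps power2_eq_square)
    show "integrable lborel ?f" by (intro Bochner_Integration.integrable_diff integrable_mult_right gauss_trig_integrable)
    have "\<bar>?F s\<bar> \<le> (1 + \<bar>s\<bar>) * gauss s" for s
      using mult_left_le[of "\<bar>cos (t * s)\<bar>" "\<bar>s\<bar> * gauss s"] by (simp add: abs_mult distrib_right add_increasing)
    then show "(?F \<longlongrightarrow> 0)  at_bot" "(?F \<longlongrightarrow> 0) at_top" by (rule gauss_decay)+
  qed (intro continuous_intros; simp)
  then have "(LINT s|lborel. gauss s * cos (t * s)) - (LINT s|lborel. s\<^sup>2 * gauss s * cos (t * s))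
      - t * (LINT s|lborel. s * gauss s * sin (t * s)) = 0"
    by (simp add: gauss_trig_integrable Bochner_Integration.integral_diff del: integral_mult_right_zero)
  then show ?thesis unfolding gauss_sin gauss_cos by (simp add: algebra_simps power2_eq_square)
qed

text \<open>
By the second mean value theorem the integral of \<open>k * A\<close> over the half-line where \<open>A\<close> decreases
to 0 is \<open>A 0\<close> times a value of the primitive of \<open>k\<close>. Thus \<open>k\<close> may change sign as long as its
primitive does not.
\<close>
lemma unimodal_integral_nonneg:
  fixes A k :: "real \<Rightarrow> real"
  assumes A0: "\<And>t. 0 \<le> A t" and Aeven: "\<And>t. A (- t) = A t"
    and Adec: "\<And>s t. 0 \<le> s \<Longrightarrow> s \<le> t \<Longrightarrow> A t \<le> A s" and AR: "\<And>t. R < t \<Longrightarrow> A t = 0"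
    and kcont: "continuous_on UNIV k" and keven: "\<And>t. k (- t) = k t"
    and kpos: "\<And>T. 0 \<le> T \<Longrightarrow> 0 \<le> integral {0..T} k"
    and meas[measurable]: "A \<in> borel_measurable borel"
  shows "0 \<le> (LINT t|lborel. k t * A t)"
proof -
  define S where "S = max R 0 + 1"
  have S: "S > 0" "\<And>t. t \<ge> S \<Longrightarrow> A t = 0" using AR by (auto simp: S_def)
  have kint: "k integrable_on {0..S}"
    by (intro integrable_continuous_real continuous_on_subset[OF kcont]) auto
  have "\<And>x y. 0 \<le> x \<Longrightarrow> x \<le> y \<Longrightarrow> y \<le> S \<Longrightarrow> - A x \<le> - A y" using Adec by auto
  then obtain c where c: "c \<in> {0..S}" and hi: "((\<lambda>x. - A x * k x) has_integral (- A 0 * integral {0..c} k + - A S * integral {c..S} k)) {0..S}"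
    by (rule second_mean_value_theorem_full[OF kint less_imp_le[OF S(1)], of "\<lambda>x. - A x"])
  have hi': "((\<lambda>x. k x * A x) has_integral (A 0 * integral {0..c} k)) {0..S}"
    using has_integral_neg[OF hi] S by (simp add: mult.commute)
  have [measurable]: "k \<in> borel_measurable borel" using kcont by (rule borel_measurable_continuous_onI)
  obtain M where M: "\<And>x. x \<in> {0..S} \<Longrightarrow> norm (k x) \<le> M"
    using compact_imp_bounded[OF compact_continuous_image[OF continuous_on_subset[OF kcont], of "{0..S}"]]
    by (force simp: bounded_iff)
  have si: "set_integrable lborel {0..S} (\<lambda>x. k x * A x)"
    unfolding set_integrable_def
  proof (rule integrableI_bounded_set_indicator[where B="M * A 0"])
    show "AE x in lborel. x \<in> {0..S} \<longrightarrow> norm (k x * A x) \<le> M * A 0"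
    proof (intro AE_I2 impI)
      fix x assume x: "x \<in> {0..S}"
      have "0 \<le> M" using M[OF x] by (meson norm_ge_zero order_trans)
      then show "norm (k x * A x) \<le> M * A 0"
        using M[OF x] A0 Adec[of 0 x] x unfolding norm_mult by (intro mult_mono) auto
    qed
  qed (use S in auto)
  have "(LBINT x:{0..S}. k x * A x) = A 0 * integral {0..c} k"
    using set_borel_integral_eq_integral(2)[OF si] integral_unique[OF hi'] by simp
  then have "has_bochner_integral lborel (\<lambda>x. indicator {0..S} x *\<^sub>R (k x * A x)) (A 0 * integral {0..c} k)"
    using si unfolding set_integrable_def set_lebesgue_integral_def
    by (simp add: has_bochner_integral_iff)
  moreover have "(\<lambda>x. indicator {0..S} x *\<^sub>R (k x * A x)) = (\<lambda>x. indicator {0..} x *\<^sub>R (k x * A x))"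
    using S by (auto simp: indicator_def fun_eq_iff)
  ultimately have "has_bochner_integral lborel (\<lambda>x. indicator {0..} x *\<^sub>R (k x * A x)) (A 0 * integral {0..c} k)"
    by simp
  from has_bochner_integral_integral_eq[OF has_bochner_integral_even_function[OF this]]
  have "(LINT t|lborel. k t * A t) = 2 *\<^sub>R (A 0 * integral {0..c} k)"
    by (simp add: Aeven keven)
  then show ?thesis using A0 kpos c by simp
qed

text \<open>
The primitive of the hat is \<open>t * exp (- t\<^sup>2 / 2)\<close>, up to scaling.
\<close>
lemma mexican_hat_integral_nonneg:
  fixes \<kappa> T :: real
  assumes "0 \<le> T"
  shows "0 \<le> integral {0..T} (\<lambda>t. (1 - (\<kappa> * t)\<^sup>2) * gauss (\<kappa> * t))"
proof -
  have "((\<lambda>t. (1 - (\<kappa> * t)\<^sup>2) * gauss (\<kappa> * t)) has_integral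
      (T * gauss (\<kappa> * T) - 0 * gauss (\<kappa> * 0))) {0..T}"
    using assms
    by (intro fundamental_theorem_of_calculus)
       (auto intro!: derivative_eq_intros simp: has_real_derivative_iff_has_vector_derivative[symmetric] algebra_simps power2_eq_square)
  then show ?thesis using assms by (simp add: integral_unique)
qed

section \<open>The inequality of Prekopa\<close>

text \<open>
The one-dimensional Brunn--Minkowski inequality is trivial for intervals, since lengths of
intervals add. Intervals suffice because superlevel sets of log-concave functions are convex.
\<close>
lemma interval_Minkowski_sum:
  fixes F G H :: "real set"
  assumes \<alpha>: "0 < \<alpha>" "\<alpha> < 1"
    and F: "convex F" "F \<noteq> {}" "bounded F" "F \<in> sets borel"
    and G: "convex G" "G \<noteq> {}" "bounded G" "G \<in> sets borel"
    and H: "H \<in> sets borel" and sub: "\<And>x y. x \<in> F \<Longrightarrow> y \<in> G \<Longrightarrow> \<alpha> * x + (1 - \<alpha>) * y \<in> H"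
  shows "ennreal \<alpha> * emeasure lborel F + ennreal (1 - \<alpha>) * emeasure lborel G \<le> emeasure lborel H"
proof -
  have bd: "bdd_above F" "bdd_below F" "bdd_above G" "bdd_below G"
    using F G by (auto intro: bounded_imp_bdd_above bounded_imp_bdd_below)
  have le: "Inf F \<le> Sup F" "Inf G \<le> Sup G" using F G bd by (auto intro: cInf_le_cSup)
  have "emeasure lborel F \<le> emeasure lborel {Inf F..Sup F}"
    using bd by (intro emeasure_mono) (auto intro: cInf_lower cSup_upper)
  then have eF: "emeasure lborel F \<le> ennreal (Sup F - Inf F)" using le by simp
  have "emeasure lborel G \<le> emeasure lborel {Inf G..Sup G}"
    using bd by (intro emeasure_mono) (auto intro: cInf_lower cSup_upper)
  then have eG: "emeasure lborel G \<le> ennreal (Sup G - Inf G)" using le by simp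
  let ?l = "\<alpha> * Inf F + (1 - \<alpha>) * Inf G" and ?u = "\<alpha> * Sup F + (1 - \<alpha>) * Sup G"
  have lu: "?l \<le> ?u" using \<alpha> le by (intro add_mono mult_left_mono) auto
  have "{?l<..<?u} \<subseteq> H"
  proof
    fix z assume z: "z \<in> {?l<..<?u}"
    obtain x y where xy: "x \<in> F" "y \<in> G" "\<alpha> * x + (1 - \<alpha>) * y < z"
    proof -
      define d where "d = z - ?l"
      have "d > 0" using z by (simp add: d_def)
      obtain x where x: "x \<in> F" "x < Inf F + d" using cInf_lessD[of F "Inf F + d"] F(2) \<open>d > 0\<close> by auto
      obtain y where y: "y \<in> G" "y < Inf G + d" using cInf_lessD[of G "Inf G + d"] G(2) \<open>d > 0\<close> by auto
      have "\<alpha> * x + (1 - \<alpha>) * y < \<alpha> * (Inf F + d) + (1 - \<alpha>) * (Inf G + d)"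
        using x y \<alpha> by (intro add_strict_mono mult_strict_left_mono) auto
      also have "\<dots> = z" by (simp add: d_def algebra_simps)
      finally show ?thesis using that x y by blast
    qed
    obtain x' y' where xy': "x' \<in> F" "y' \<in> G" "z < \<alpha> * x' + (1 - \<alpha>) * y'"
    proof -
      define d where "d = ?u - z"
      have "d > 0" using z by (simp add: d_def)
      obtain x where x: "x \<in> F" "Sup F - d < x" using less_cSupD[of F "Sup F - d"] F(2) \<open>d > 0\<close> by auto
      obtain y where y: "y \<in> G" "Sup G - d < y" using less_cSupD[of G "Sup G - d"] G(2) \<open>d > 0\<close> by auto
      have "z = \<alpha> * (Sup F - d) + (1 - \<alpha>) * (Sup G - d)" by (simp add: d_def algebra_simps)
      also have "\<dots> < \<alpha> * x + (1 - \<alpha>) * y"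
        using x y \<alpha> by (intro add_strict_mono mult_strict_left_mono) auto
      finally show ?thesis using that x y by blast
    qed
    define p q where "p = \<alpha> * x + (1 - \<alpha>) * y" and "q = \<alpha> * x' + (1 - \<alpha>) * y'"
    define u where "u = (z - p) / (q - p)"
    have pq: "p < z" "z < q" using xy xy' by (simp_all add: p_def q_def)
    then have u: "0 \<le> u" "u \<le> 1" and "u * (q - p) = z - p"
      unfolding u_def by auto
    then have zu: "z = (1 - u) * p + u * q" by (simp add: algebra_simps)
    have "(1 - u) *\<^sub>R x + u *\<^sub>R x' \<in> F" using F(1) xy(1) xy'(1) u by (simp add: convex_alt)
    moreover have "(1 - u) *\<^sub>R y + u *\<^sub>R y' \<in> G" using G(1) xy(2) xy'(2) u by (simp add: convex_alt)
    ultimately have "\<alpha> * ((1 - u) *\<^sub>R x + u *\<^sub>R x') + (1 - \<alpha>) * ((1 - u) *\<^sub>R y + u *\<^sub>R y') \<in> H"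
      by (rule sub)
    moreover have "\<alpha> * ((1 - u) *\<^sub>R x + u *\<^sub>R x') + (1 - \<alpha>) * ((1 - u) *\<^sub>R y + u *\<^sub>R y') = z"
      unfolding zu p_def q_def by (simp add: algebra_simps)
    ultimately show "z \<in> H" by simp
  qed
  then have uH: "ennreal (?u - ?l) \<le> emeasure lborel H"
    using H lu emeasure_mono[of "{?l<..<?u}" H lborel] by simp
  have "ennreal \<alpha> * emeasure lborel F + ennreal (1 - \<alpha>) * emeasure lborel G
      \<le> ennreal \<alpha> * ennreal (Sup F - Inf F) + ennreal (1 - \<alpha>) * ennreal (Sup G - Inf G)"
    by (intro add_mono mult_left_mono eF eG) auto
  also have "\<dots> = ennreal (?u - ?l)"
  proof -
    have "?u - ?l = \<alpha> * (Sup F - Inf F) + (1 - \<alpha>) * (Sup G - Inf G)" by (simp add: algebra_simps)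
    then show ?thesis using \<alpha> le by (simp add: ennreal_plus ennreal_mult)
  qed
  finally show ?thesis using uH by simp
qed

text \<open>
Truncating at height \<open>m\<close> lets the same formula serve as an equality for functions with supremum
\<open>m\<close> and as a lower bound for the others.
\<close>
lemma layer_cake_unit:
  fixes f :: "real \<Rightarrow> real"
  assumes [measurable]: "f \<in> borel_measurable borel" and f: "\<And>x. 0 \<le> f x" and m: "0 < m"
  shows "(\<integral>\<^sup>+x. ennreal (min (f x / m) 1) \<partial>lborel)
       = (\<integral>\<^sup>+l. indicator {0<..<1} l * emeasure lborel {x. l * m < f x} \<partial>lborel)"
proof -
  have "(\<integral>\<^sup>+x. ennreal (min (f x / m) 1) \<partial>lborel)
      = (\<integral>\<^sup>+x. \<integral>\<^sup>+l. indicator {0<..<1} l * indicator {x. l * m < f x} x \<partial>lborel \<partial>lborel)"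
  proof (rule nn_integral_cong)
    fix x
    have "(\<integral>\<^sup>+l. indicator {0<..<1} l * indicator {x. l * m < f x} x \<partial>lborel)
        = (\<integral>\<^sup>+l. indicator {0<..<min (f x / m) 1} l \<partial>lborel)"
      using m by (intro nn_integral_cong) (auto simp: indicator_def field_simps)
    also have "\<dots> = ennreal (min (f x / m) 1)" using f m by simp
    finally show "ennreal (min (f x / m) 1)
      = (\<integral>\<^sup>+l. indicator {0<..<1} l * indicator {x. l * m < f x} x \<partial>lborel)" by simp
  qed
  also have "\<dots> = (\<integral>\<^sup>+l. \<integral>\<^sup>+x. indicator {0<..<1} l * indicator {x. l * m < f x} x \<partial>lborel \<partial>lborel)"
    by (rule lborel_pair.Fubini') measurable
  also have "\<dots> = (\<integral>\<^sup>+l. indicator {0<..<1} l * emeasure lborel {x. l * m < f x} \<partial>lborel)"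
    by (intro nn_integral_cong nn_integral_cmult_indicator) measurable
  finally show ?thesis .
qed

text \<open>
After dividing \<open>f\<close> and \<open>g\<close> by their suprema \<open>a\<close> and \<open>b\<close>, and \<open>h\<close> by \<open>a powr \<alpha> * b powr (1 - \<alpha>)\<close>,
the superlevel sets at a common height \<open>l < 1\<close> are nonempty, and that of \<open>h\<close>
contains the Minkowski combination of the other two. Integrating the interval inequality over
\<open>l\<close> gives an arithmetic mean of the normalised integrals, which dominates the geometric mean.
The normalisation is essential: without it one of the two level sets may be empty.
\<close>
lemma Prekopa_1d:
  fixes f g h :: "real \<Rightarrow> real"
  assumes \<alpha>: "0 < \<alpha>" "\<alpha> < 1"
    and [measurable]: "f \<in> borel_measurable borel" "g \<in> borel_measurable borel" "h \<in> borel_measurable borel"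
    and nonneg: "\<And>x. 0 \<le> f x" "\<And>x. 0 \<le> g x" "\<And>x. 0 \<le> h x"
    and bound: "\<And>x. f x \<le> M" "\<And>x. g x \<le> M"
    and supp: "\<And>x. f x \<noteq> 0 \<Longrightarrow> \<bar>x\<bar> \<le> R" "\<And>x. g x \<noteq> 0 \<Longrightarrow> \<bar>x\<bar> \<le> R"
    and int: "integrable lborel f" "integrable lborel g" "integrable lborel h"
    and conv: "\<And>l. convex {x. l < f x}" "\<And>l. convex {x. l < g x}"
    and le: "\<And>x y. f x powr \<alpha> * g y powr (1 - \<alpha>) \<le> h (\<alpha> * x + (1 - \<alpha>) * y)"
  shows "(LINT x|lborel. f x) powr \<alpha> * (LINT x|lborel. g x) powr (1 - \<alpha>) \<le> (LINT x|lborel. h x)"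
proof (cases "(LINT x|lborel. f x) = 0 \<or> (LINT x|lborel. g x) = 0")
  case True
  moreover have "0 \<le> (LINT x|lborel. h x)" using nonneg by simp
  ultimately show ?thesis by auto
next
  case False
  have bdd: "bdd_above (range f)" "bdd_above (range g)" using bound by (auto simp: bdd_above_def)
  define a b where "a = (SUP x. f x)" and "b = (SUP x. g x)"
  have fa: "f x \<le> a" and gb: "g x \<le> b" for x
    unfolding a_def b_def using bdd by (auto intro: cSUP_upper)
  have "f \<noteq> (\<lambda>_. 0)" "g \<noteq> (\<lambda>_. 0)" using False by auto
  then obtain x1 x2 where "f x1 \<noteq> 0" "g x2 \<noteq> 0" by (auto simp: fun_eq_iff)
  then have a: "a > 0" and b: "b > 0"
    using nonneg(1)[of x1] nonneg(2)[of x2] fa[of x1] gb[of x2] by linarith+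
  define m where "m = a powr \<alpha> * b powr (1 - \<alpha>)"
  have m: "m > 0" using a b by (simp add: m_def)
  define I J where "I = (LINT x|lborel. f x)" and "J = (LINT x|lborel. g x)"
  have IJ: "I > 0" "J > 0" using False nonneg by (auto simp: I_def J_def order_less_le)
  have lev: "ennreal \<alpha> * emeasure lborel {x. l * a < f x} + ennreal (1 - \<alpha>) * emeasure lborel {x. l * b < g x}
      \<le> emeasure lborel {x. l * m < h x}" if l: "0 < l" "l < 1" for l
  proof (rule interval_Minkowski_sum[OF \<alpha>])
    show "convex {x. l * a < f x}" "convex {x. l * b < g x}" by (fact conv)+
    have "l * a < a" "l * b < b" using a b l by auto
    then show "{x. l * a < f x} \<noteq> {}" "{x. l * b < g x} \<noteq> {}"
      using less_cSUP_iff[OF _ bdd(1), of "l * a"] less_cSUP_iff[OF _ bdd(2), of "l * b"]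
      by (auto simp: a_def[symmetric] b_def[symmetric])
    have "l * a > 0" "l * b > 0" using a b l by auto
    then have "{x. l * a < f x} \<subseteq> cball 0 R" "{x. l * b < g x} \<subseteq> cball 0 R"
      using supp by (force simp: dist_real_def)+
    then show "bounded {x. l * a < f x}" "bounded {x. l * b < g x}"
      by (auto intro: bounded_subset[OF bounded_cball])
    fix x y assume x: "x \<in> {x. l * a < f x}" and y: "y \<in> {x. l * b < g x}"
    have "l * m = l powr \<alpha> * l powr (1 - \<alpha>) * m" using l by (simp add: powr_add[symmetric])
    also have "\<dots> = (l * a) powr \<alpha> * (l * b) powr (1 - \<alpha>)"
      using a b l by (simp add: m_def powr_mult mult_ac)
    also have "\<dots> < f x powr \<alpha> * g y powr (1 - \<alpha>)"
      using x y \<alpha> \<open>l * a > 0\<close> \<open>l * b > 0\<close>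
      by (intro mult_strict_mono powr_less_mono2) auto
    also have "\<dots> \<le> h (\<alpha> * x + (1 - \<alpha>) * y)" by (rule le)
    finally show "\<alpha> * x + (1 - \<alpha>) * y \<in> {x. l * m < h x}" by simp
  qed measurable
  have "min (f x / a) 1 = f x / a" "min (g x / b) 1 = g x / b" for x
    using fa[of x] gb[of x] a b by (simp_all add: min_def)
  then have nnf: "(\<integral>\<^sup>+x. ennreal (min (f x / a) 1) \<partial>lborel) = ennreal (I / a)"
    and nng: "(\<integral>\<^sup>+x. ennreal (min (g x / b) 1) \<partial>lborel) = ennreal (J / b)"
    using a b nonneg int unfolding I_def J_def by (simp_all add: nn_integral_eq_integral)
  have [measurable]: "(\<lambda>l. emeasure lborel {x. l * a < f x}) \<in> borel_measurable borel"
    "(\<lambda>l. emeasure lborel {x. l * b < g x}) \<in> borel_measurable borel" by measurable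
  have "ennreal (\<alpha> * (I / a) + (1 - \<alpha>) * (J / b)) = ennreal \<alpha> * ennreal (I / a) + ennreal (1 - \<alpha>) * ennreal (J / b)"
    using \<alpha> IJ a b by (simp add: ennreal_mult[symmetric] ennreal_plus[symmetric] del: ennreal_plus)
  also have "\<dots> = (\<integral>\<^sup>+l. indicator {0<..<1} l * (ennreal \<alpha> * emeasure lborel {x. l * a < f x}
        + ennreal (1 - \<alpha>) * emeasure lborel {x. l * b < g x}) \<partial>lborel)"
    unfolding nnf[symmetric] nng[symmetric] using a b nonneg
    by (simp add: layer_cake_unit nn_integral_cmult[symmetric] nn_integral_add[symmetric] distrib_left mult_ac)
  also have "\<dots> \<le> (\<integral>\<^sup>+l. indicator {0<..<1} l * emeasure lborel {x. l * m < h x} \<partial>lborel)"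
    using lev by (intro nn_integral_mono) (auto simp: indicator_def)
  also have "\<dots> = (\<integral>\<^sup>+x. ennreal (min (h x / m) 1) \<partial>lborel)"
    using m nonneg by (simp add: layer_cake_unit)
  also have "\<dots> \<le> (\<integral>\<^sup>+x. ennreal (h x / m) \<partial>lborel)" by (intro nn_integral_mono ennreal_leI) auto
  also have "\<dots> = ennreal ((LINT x|lborel. h x) / m)"
    using nonneg m int by (subst nn_integral_eq_integral) auto
  finally have "\<alpha> * (I / a) + (1 - \<alpha>) * (J / b) \<le> (LINT x|lborel. h x) / m"
    using nonneg m by (subst (asm) ennreal_le_iff) (auto intro!: divide_nonneg_nonneg)
  moreover have "(I / a) powr \<alpha> * (J / b) powr (1 - \<alpha>) \<le> \<alpha> * (I / a) + (1 - \<alpha>) * (J / b)"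
    using \<alpha> IJ a b by (intro Youngs_inequality_0) auto
  ultimately have "(I / a) powr \<alpha> * (J / b) powr (1 - \<alpha>) \<le> (LINT x|lborel. h x) / m" by linarith
  then have "m * ((I / a) powr \<alpha> * (J / b) powr (1 - \<alpha>)) \<le> (LINT x|lborel. h x)"
    using m by (subst (asm) pos_le_divide_eq) (simp_all only: mult.commute)
  moreover have "m * ((I / a) powr \<alpha> * (J / b) powr (1 - \<alpha>)) = I powr \<alpha> * J powr (1 - \<alpha>)"
    using IJ a b by (simp add: m_def powr_divide)
  ultimately show ?thesis by (simp add: I_def J_def)
qed


text \<open>
Joint log-concavity in the coordinates \<open>c\<close> and the parameter \<open>t\<close>. The coordinate functions range
over the carrier of the product measure; they are undefined off \<open>B\<close>, and this value is
preserved by convex combinations.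
\<close>
definition log_concave_on :: "'i set \<Rightarrow> (('i \<Rightarrow> real) \<Rightarrow> real \<Rightarrow> real) \<Rightarrow> bool" where
  "log_concave_on B \<phi> \<longleftrightarrow> (\<forall>\<alpha> c c' t t'. 0 < \<alpha> \<longrightarrow> \<alpha> < 1 \<longrightarrow> c \<in> extensional B \<longrightarrow> c' \<in> extensional B \<longrightarrow>
     \<phi> c t powr \<alpha> * \<phi> c' t' powr (1 - \<alpha>) \<le> \<phi> (\<lambda>i. \<alpha> * c i + (1 - \<alpha>) * c' i) (\<alpha> * t + (1 - \<alpha>) * t'))"

lemma log_concave_onD:
  "log_concave_on B \<phi> \<Longrightarrow> 0 < \<alpha> \<Longrightarrow> \<alpha> < 1 \<Longrightarrow> c \<in> extensional B \<Longrightarrow> c' \<in> extensional B \<Longrightarrow>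
    \<phi> c t powr \<alpha> * \<phi> c' t' powr (1 - \<alpha>) \<le> \<phi> (\<lambda>i. \<alpha> * c i + (1 - \<alpha>) * c' i) (\<alpha> * t + (1 - \<alpha>) * t')"
  unfolding log_concave_on_def by blast

text \<open>
A point between two points of the superlevel set has a value at least the smaller of the two values.
\<close>
lemma convex_superlevel:
  fixes f :: "real \<Rightarrow> real"
  assumes nonneg: "\<And>x. 0 \<le> f x"
    and le: "\<And>\<alpha> x y. 0 < \<alpha> \<Longrightarrow> \<alpha> < 1 \<Longrightarrow> f x powr \<alpha> * f y powr (1 - \<alpha>) \<le> f (\<alpha> * x + (1 - \<alpha>) * y)"
  shows "convex {x. l < f x}"
proof (cases "l < 0")
  case True
  then have "{x. l < f x} = UNIV" using nonneg by (auto intro: less_le_trans)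
  then show ?thesis by simp
next
  case False
  show ?thesis unfolding convex_alt
  proof (intro ballI allI impI)
    fix x y u :: real assume xy: "x \<in> {x. l < f x}" "y \<in> {x. l < f x}" and u: "0 \<le> u \<and> u \<le> 1"
    consider "u = 0" | "u = 1" | "0 < u" "u < 1" using u by linarith
    then show "(1 - u) *\<^sub>R x + u *\<^sub>R y \<in> {x. l < f x}"
    proof cases
      case 3
      define m where "m = min (f x) (f y)"
      have m: "l < m" "0 < m" "m \<le> f x" "m \<le> f y" using xy False by (auto simp: m_def)
      have "m = m powr (1 - u) * m powr u" using m by (simp add: powr_add[symmetric])
      also have "\<dots> \<le> f x powr (1 - u) * f y powr u"
        using m 3 by (intro mult_mono powr_mono2) auto
      also have "\<dots> \<le> f ((1 - u) * x + u * y)" using le[of "1 - u" x y] 3 by simp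
      finally show ?thesis using m by simp
    qed (use xy in auto)
  qed
qed

text \<open>
Integrating out one coordinate of a log-concave function leaves a function that is log-concave
in the remaining coordinates and in \<open>t\<close>, by \<open>Prekopa_1d\<close> on each line; so the coordinates can
be removed one after another.
\<close>
lemma marginal_log_concave:
  assumes "finite B"
    and "\<And>t. (\<lambda>c. \<phi> c t) \<in> borel_measurable (coords B)"
    and "\<And>c t. c \<in> extensional B \<Longrightarrow> 0 \<le> \<phi> c t"
    and "\<And>c t. c \<in> extensional B \<Longrightarrow> \<phi> c t \<le> M"
    and "\<And>c t i. c \<in> extensional B \<Longrightarrow> \<phi> c t \<noteq> 0 \<Longrightarrow> i \<in> B \<Longrightarrow> \<bar>c i\<bar> \<le> R"
    and "log_concave_on B \<phi>" and "0 < \<alpha>" "\<alpha> < 1"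
  shows "(LINT c|coords B. \<phi> c t) powr \<alpha> * (LINT c|coords B. \<phi> c t') powr (1 - \<alpha>)
       \<le> (LINT c|coords B. \<phi> c (\<alpha> * t + (1 - \<alpha>) * t'))"
  using assms
proof (induction B arbitrary: \<phi> M rule: finite_induct)
  case empty
  interpret product_sigma_finite "\<lambda>_::'a. lborel :: real measure"
    by (rule product_sigma_finite_lborel)
  have "(LINT c|coords {}. \<phi> c t) = \<phi> (\<lambda>_. undefined) t" for t
    by (simp add: PiM_empty lebesgue_integral_count_space_finite)
  moreover have "(\<lambda>i::'a. \<alpha> * undefined + (1 - \<alpha>) * undefined) = (\<lambda>_. undefined)"
    by (simp add: algebra_simps)
  ultimately show ?case
    using log_concave_onD[OF empty(5-7), of "\<lambda>_. undefined" "\<lambda>_. undefined" t t']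
    by (simp add: extensional_def)
next
  case (insert j B)
  interpret product_sigma_finite "\<lambda>_::'a. lborel :: real measure"
    by (rule product_sigma_finite_lborel)
  interpret P: sigma_finite_measure "coords B" using insert(1) by (rule sigma_finite)
  note [measurable] = insert.prems(1)
  have ext: "c(j := x) \<in> extensional (insert j B)" if "c \<in> extensional B" for c x
    using that by (auto simp: extensional_def)
  have nn: "0 \<le> \<phi> (c(j := x)) t" and bd: "\<phi> (c(j := x)) t \<le> M" if "c \<in> extensional B" for c x t
    by (rule insert.prems(2,3)[OF ext[OF that]])+
  have sp: "\<bar>x\<bar> \<le> R" "\<And>i. i \<in> B \<Longrightarrow> \<bar>c i\<bar> \<le> R" if "c \<in> extensional B" "\<phi> (c(j := x)) t \<noteq> 0" for c x t
  proof -
    show "\<bar>x\<bar> \<le> R" using insert.prems(4)[OF ext[OF that(1)] that(2), of j] by simp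
    show "\<bar>c i\<bar> \<le> R" if "i \<in> B" for i
      using insert.prems(4)[OF ext[OF \<open>c \<in> extensional B\<close>] \<open>\<phi> (c(j := x)) t \<noteq> 0\<close>, of i] that insert(2)
      by (auto split: if_splits)
  qed
  have upd: "(\<lambda>p. (fst p)(j := snd p)) \<in> coords B \<Otimes>\<^sub>M lborel \<rightarrow>\<^sub>M coords (insert j B)"
    by measurable
  have m2: "(\<lambda>p. \<phi> ((fst p)(j := snd p)) t) \<in> borel_measurable (coords B \<Otimes>\<^sub>M lborel)" for t
    using measurable_compose[OF upd insert.prems(1)] .
  define \<psi> where "\<psi> c t = (LINT x|lborel. \<phi> (c(j := x)) t)" for c t
  have m1: "(\<lambda>x. \<phi> (c(j := x)) t) \<in> borel_measurable borel" if "c \<in> extensional B" for c t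
    using measurable_compose[OF measurable_Pair1' m2[of t], of c] that by (simp add: space_PiM PiE_def)
  have i1: "integrable lborel (\<lambda>x. \<phi> (c(j := x)) t)" if c: "c \<in> extensional B" for c t
  proof (rule integrableI_bounded_set[where A="{-R..R}" and B=M])
    show "AE x\<in>{- R..R} in lborel. norm (\<phi> (c(j := x)) t) \<le> M"
      using nn[OF c] bd[OF c] by (intro AE_I2) (simp add: abs_of_nonneg)
    show "AE x in lborel. x \<notin> {- R..R} \<longrightarrow> \<phi> (c(j := x)) t = 0"
      using sp(1)[OF c] by (intro AE_I2) (auto simp: abs_le_iff minus_le_iff)
  qed (use m1[OF c] in \<open>auto simp: emeasure_lborel_Icc_eq\<close>)
  have box: "emeasure (coords (insert j B)) (\<Pi>\<^sub>E i\<in>insert j B. {-R..R}) < \<infinity>"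
  proof -
    have "emeasure lborel {-R..R} = ennreal (2 * max R 0)" by (cases "0 \<le> R") auto
    then have "emeasure (coords (insert j B)) (\<Pi>\<^sub>E i\<in>insert j B. {-R..R}) = ennreal ((2 * max R 0) ^ card (insert j B))"
      using insert(1) by (subst emeasure_PiM) (auto simp: ennreal_power simp del: power_Suc)
    then show ?thesis by simp
  qed
  have i2: "integrable (coords (insert j B)) (\<lambda>c. \<phi> c t)" for t
  proof (rule integrableI_bounded_set[where A="\<Pi>\<^sub>E i\<in>insert j B. {-R..R}" and B=M])
    show "(\<Pi>\<^sub>E i\<in>insert j B. {-R..R}) \<in> sets (coords (insert j B))"
      using insert(1) by (intro sets_PiM_I_finite) auto
    show "AE c\<in>(\<Pi>\<^sub>E i\<in>insert j B. {-R..R}) in coords (insert j B). norm (\<phi> c t) \<le> M"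
      using insert.prems(2,3) by (auto simp: PiE_def)
    show "AE c in coords (insert j B). c \<notin> (\<Pi>\<^sub>E i\<in>insert j B. {-R..R}) \<longrightarrow> \<phi> c t = 0"
    proof (rule AE_I2, rule impI, rule ccontr)
      fix c assume c: "c \<in> space (coords (insert j B))"
        "c \<notin> (\<Pi>\<^sub>E i\<in>insert j B. {-R..R})" "\<phi> c t \<noteq> 0"
      then have e: "c \<in> extensional (insert j B)" by (auto simp: space_PiM PiE_def)
      have "\<And>i. i \<in> insert j B \<Longrightarrow> \<bar>c i\<bar> \<le> R" using insert.prems(4)[OF e c(3)] .
      then have "c \<in> (\<Pi>\<^sub>E i\<in>insert j B. {-R..R})" using e by (auto simp: PiE_def abs_le_iff minus_le_iff)
      with c(2) show False ..
    qed
  qed (use box insert.prems(1) in auto)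
  have int: "(LINT c|coords (insert j B). \<phi> c t) = (LINT c|coords B. \<psi> c t)" for t
    unfolding \<psi>_def using insert(1,2) i2 by (rule product_integral_insert)
  have lc: "\<psi> c t powr \<beta> * \<psi> c' t' powr (1 - \<beta>) \<le> \<psi> (\<lambda>i. \<beta> * c i + (1 - \<beta>) * c' i) (\<beta> * t + (1 - \<beta>) * t')"
    if \<beta>: "0 < \<beta>" "\<beta> < 1" and c: "c \<in> extensional B" "c' \<in> extensional B" for \<beta> c c' t t'
  proof -
    have und: "\<beta> * undefined + (1 - \<beta>) * undefined = (undefined :: real)" by (simp add: algebra_simps)
    have c'': "(\<lambda>i. \<beta> * c i + (1 - \<beta>) * c' i) \<in> extensional B"
      using c und by (auto simp: extensional_def)
    have cv: "convex {x. l < \<phi> (d(j := x)) t}" if d: "d \<in> extensional B" for d l t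
    proof (rule convex_superlevel)
      show "0 \<le> \<phi> (d(j := x)) t" for x by (rule nn[OF d])
      fix \<alpha> x y :: real assume \<alpha>: "0 < \<alpha>" "\<alpha> < 1"
      have "(\<lambda>i. \<alpha> * (d(j := x)) i + (1 - \<alpha>) * (d(j := y)) i) = d(j := \<alpha> * x + (1 - \<alpha>) * y)"
        by (auto simp: fun_eq_iff algebra_simps)
      moreover have "\<alpha> * t + (1 - \<alpha>) * t = t" by (simp add: algebra_simps)
      ultimately show "\<phi> (d(j := x)) t powr \<alpha> * \<phi> (d(j := y)) t powr (1 - \<alpha>) \<le> \<phi> (d(j := \<alpha> * x + (1 - \<alpha>) * y)) t"
        using log_concave_onD[OF insert.prems(5) \<alpha> ext[OF d, of x] ext[OF d, of y], of t t] by (simp only:)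
    qed
    show ?thesis unfolding \<psi>_def
    proof (rule Prekopa_1d[OF \<beta>, where M=M and R=R])
      fix x y
      have "(\<lambda>i. \<beta> * (c(j := x)) i + (1 - \<beta>) * (c'(j := y)) i)
          = (\<lambda>i. \<beta> * c i + (1 - \<beta>) * c' i)(j := \<beta> * x + (1 - \<beta>) * y)" by auto
      then show "\<phi> (c(j := x)) t powr \<beta> * \<phi> (c'(j := y)) t' powr (1 - \<beta>)
        \<le> \<phi> ((\<lambda>i. \<beta> * c i + (1 - \<beta>) * c' i)(j := \<beta> * x + (1 - \<beta>) * y)) (\<beta> * t + (1 - \<beta>) * t')"
        using log_concave_onD[OF insert.prems(5) \<beta> ext[OF c(1), of x] ext[OF c(2), of y], of t t'] by (simp only:)
    qed (rule nn bd i1 m1 cv c c'' | erule sp(1)[rotated])+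
  qed
  show ?case unfolding int
  proof (rule insert.IH[where M="max M 0 * (2 * max R 0)"])
    fix t
    show "(\<lambda>c. \<psi> c t) \<in> borel_measurable (coords B)"
      unfolding \<psi>_def using m2[of t] by (intro lborel.borel_measurable_lebesgue_integral) (simp add: case_prod_unfold)
  next
    fix c :: "'a \<Rightarrow> real" and t assume c: "c \<in> extensional B"
    show "0 \<le> \<psi> c t" unfolding \<psi>_def using nn[OF c] by (intro integral_nonneg_AE AE_I2)
    have "\<psi> c t \<le> (LINT x|lborel. max M 0 * indicator {-R..R} x)" unfolding \<psi>_def
    proof (rule integral_mono[OF i1[OF c]])
      show "integrable lborel (\<lambda>x. max M 0 * indicator {- R..R} x :: real)"
        by (auto simp: emeasure_lborel_Icc_eq)
      show "\<phi> (c(j := x)) t \<le> max M 0 * indicator {- R..R} x" for x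
        using bd[OF c, of x t] sp(1)[OF c, of x t]
        by (cases "\<phi> (c(j := x)) t = 0") (auto simp: indicator_def abs_le_iff max_def)
    qed
    also have "\<dots> \<le> max M 0 * (2 * max R 0)"
      by (cases "0 \<le> R") (auto simp: max_def)
    finally show "\<psi> c t \<le> max M 0 * (2 * max R 0)" .
    fix i assume "\<psi> c t \<noteq> 0" "i \<in> B"
    then have "(\<lambda>x. \<phi> (c(j := x)) t) \<noteq> (\<lambda>_. 0)" unfolding \<psi>_def by auto
    then obtain x where "\<phi> (c(j := x)) t \<noteq> 0" by (auto simp: fun_eq_iff)
    from sp(2)[OF c this \<open>i \<in> B\<close>] show "\<bar>c i\<bar> \<le> R" .
  next
    show "log_concave_on B \<psi>" unfolding log_concave_on_def using lc by blast
  qed fact+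
qed

section \<open>Parallel sections of a symmetric convex body\<close>

lemma integrable_pair_mult:
  fixes f :: "'a \<Rightarrow> real" and g :: "'b \<Rightarrow> real"
  assumes "sigma_finite_measure M1" "sigma_finite_measure M2" and f: "integrable M1 f" and g: "integrable M2 g"
  shows "integrable (M1 \<Otimes>\<^sub>M M2) (\<lambda>p. f (fst p) * g (snd p))"
proof -
  interpret pair_sigma_finite M1 M2 using assms by (simp add: pair_sigma_finite_def)
  have [measurable]: "f \<in> borel_measurable M1" "g \<in> borel_measurable M2" using f g by auto
  show ?thesis
  proof (rule Fubini_integrable)
    have "(\<lambda>x. LINT y|M2. norm (f (fst (x, y)) * g (snd (x, y)))) = (\<lambda>x. \<bar>f x\<bar> * (LINT y|M2. \<bar>g y\<bar>))"
      by (simp add: abs_mult)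
    then show "integrable M1 (\<lambda>x. LINT y|M2. norm (f (fst (x, y)) * g (snd (x, y))))"
      using f by simp
    show "AE x in M1. integrable M2 (\<lambda>y. f (fst (x, y)) * g (snd (x, y)))"
      using g by simp
  qed measurable
qed

lemma Fubini_dominated:
  fixes F :: "'a \<Rightarrow> 'b \<Rightarrow> real"
  assumes sf: "sigma_finite_measure M1" "sigma_finite_measure M2" and f: "integrable M1 f" and g: "integrable M2 g"
    and meas: "(\<lambda>p. F (fst p) (snd p)) \<in> borel_measurable (M1 \<Otimes>\<^sub>M M2)"
    and le: "\<And>x y. \<bar>F x y\<bar> \<le> f x * g y"
  shows "(LINT x|M1. LINT y|M2. F x y) = (LINT y|M2. LINT x|M1. F x y)"
proof -
  interpret pair_sigma_finite M1 M2 using assms by (simp add: pair_sigma_finite_def)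
  have "integrable (M1 \<Otimes>\<^sub>M M2) (case_prod F)"
    by (rule Bochner_Integration.integrable_bound[OF integrable_pair_mult[OF sf f g]])
      (use meas le in \<open>auto simp: case_prod_unfold intro!: AE_I2 order_trans[OF le abs_ge_self]\<close>)
  from Fubini_integral[OF this] show ?thesis by simp
qed

text \<open>
The Fourier transform of the indicator of \<open>K\<close>; for symmetric \<open>K\<close> the sine part vanishes.
\<close>
definition body_cos :: "'a::euclidean_space set \<Rightarrow> 'a \<Rightarrow> real" where
  "body_cos K \<xi> = (LINT y|lborel. indicator K y * cos (y \<bullet> \<xi>))"

context
  fixes K :: "'a::euclidean_space set"
  assumes cpt: "compact K"
begin

lemma body_borel[measurable]: "K \<in> sets borel"
  using cpt by (simp add: compact_imp_closed)

lemma body_integrable: "integrable lborel (indicator K :: 'a \<Rightarrow> real)"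
  using emeasure_compact_finite[OF cpt] by (simp add: less_top)

lemma body_cos_measurable[measurable]: "body_cos K \<in> borel_measurable borel"
proof -
  have "(\<lambda>\<xi>. LINT y|lborel. indicator K y * cos (y \<bullet> \<xi>) :: real) \<in> borel_measurable borel"
    by (rule lborel.borel_measurable_lebesgue_integral) (simp add: case_prod_unfold)
  then show ?thesis unfolding body_cos_def[abs_def] .
qed

lemma body_cos_bound: "\<bar>body_cos K \<xi>\<bar> \<le> measure lborel K"
proof -
  have "\<bar>body_cos K \<xi>\<bar> \<le> (LINT y|lborel. \<bar>indicator K y * cos (y \<bullet> \<xi>)\<bar>)"
    unfolding body_cos_def by (rule integral_abs_bound)
  also have "\<dots> \<le> (LINT y|lborel. indicator K y)"
  proof (rule integral_mono[OF _ body_integrable])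
    show "integrable lborel (\<lambda>y. \<bar>indicator K y * cos (y \<bullet> \<xi>)\<bar> :: real)"
      by (rule Bochner_Integration.integrable_bound[OF body_integrable]) (auto simp: indicator_def)
  qed (auto simp: indicator_def)
  finally show ?thesis using body_borel by simp
qed

text \<open>
A weighted integral of the transform along the line of \<open>\<zeta>\<close> is the integral over \<open>K\<close> of the cosine
transform of the weight, evaluated at \<open>y \<bullet> \<zeta>\<close>.
\<close>
lemma radial_Fubini:
  fixes w :: "real \<Rightarrow> real"
  assumes w: "integrable lborel w"
  shows "(LINT s|lborel. w s * body_cos K (s *\<^sub>R \<zeta>))
       = (LINT y|lborel. indicator K y * (LINT s|lborel. w s * cos ((y \<bullet> \<zeta>) * s)))"
proof -
  have [measurable]: "w \<in> borel_measurable borel" using w by auto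
  have "(LINT s|lborel. w s * body_cos K (s *\<^sub>R \<zeta>))
      = (LINT s|lborel. LINT y|lborel. w s * (indicator K y * cos ((y \<bullet> \<zeta>) * s)))"
    by (simp add: body_cos_def mult.commute)
  also have "\<dots> = (LINT y|lborel. LINT s|lborel. w s * (indicator K y * cos ((y \<bullet> \<zeta>) * s)))"
    by (rule Fubini_dominated[OF _ _ integrable_abs[OF w] body_integrable])
      (auto simp: abs_mult indicator_def sigma_finite_lborel intro!: mult_left_le)
  also have "\<dots> = (LINT y|lborel. indicator K y * (LINT s|lborel. w s * cos ((y \<bullet> \<zeta>) * s)))"
    by (simp add: integral_mult_right_zero[symmetric] mult.left_commute del: integral_mult_right_zero)
  finally show ?thesis .
qed

end

lemma lincomb_perp:
  assumes B: "orthonormal_basis B (perp e)"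
  shows "lincomb B c \<bullet> e = 0"
proof -
  have "lincomb B c \<in> span B" unfolding lincomb_def by (intro span_sum span_scale span_base)
  then show ?thesis using B by (simp add: orthonormal_basis_def perp_def)
qed

lemma coords_bound:
  assumes B: "orthonormal_basis B (perp e)" and e: "norm e = 1" and R: "lincomb B c + t *\<^sub>R e \<in> cball 0 R"
  shows "\<bar>t\<bar> \<le> R" "norm (lincomb B c) \<le> R" "b \<in> B \<Longrightarrow> \<bar>c b\<bar> \<le> R"
proof -
  let ?x = "lincomb B c + t *\<^sub>R e"
  have R: "norm ?x \<le> R" using R by simp
  have "(norm ?x)\<^sup>2 = (norm (lincomb B c))\<^sup>2 + t\<^sup>2"
    using e by (simp add: norm_add_Pythagorean orthogonal_def lincomb_perp[OF B])
  then have "(norm (lincomb B c))\<^sup>2 \<le> (norm ?x)\<^sup>2" "\<bar>t\<bar>\<^sup>2 \<le> (norm ?x)\<^sup>2"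
    by simp_all
  then have "norm (lincomb B c) \<le> norm ?x" "\<bar>t\<bar> \<le> norm ?x"
    by (meson norm_ge_zero power2_le_imp_le)+
  then show "\<bar>t\<bar> \<le> R" and n: "norm (lincomb B c) \<le> R" using R by linarith+
  assume b: "b \<in> B"
  have "norm b = 1" using B b by (simp add: orthonormal_basis_def)
  then have "\<bar>lincomb B c \<bullet> b\<bar> \<le> norm (lincomb B c)" using Cauchy_Schwarz_ineq2[of "lincomb B c" b] by simp
  then show "\<bar>c b\<bar> \<le> R" using n lincomb_inner[OF B b] by simp
qed

context
  fixes K B :: "'a::euclidean_space set" and e :: 'a and A :: "real \<Rightarrow> real"
  assumes cpt: "compact K" and cvx: "convex K" and sym: "origin_symmetric K"
    and B: "orthonormal_basis B (perp e)" and e: "norm e = 1"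
    and A_def: "\<And>t. A t = (LINT c|coords B. indicator K (lincomb B c + t *\<^sub>R e))"
begin

lemma profile_nonneg: "0 \<le> A t"
  unfolding A_def by simp

lemma profile_measurable: "A \<in> borel_measurable borel"
proof -
  note body_borel[OF cpt, measurable]
  interpret product_sigma_finite "\<lambda>_::'a. lborel :: real measure"
    by (rule product_sigma_finite_lborel)
  interpret P: sigma_finite_measure "coords B"
    using orthonormal_finite[OF B] by (rule sigma_finite)
  have "(\<lambda>t. LINT c|coords B. indicator K (lincomb B c + t *\<^sub>R e) :: real) \<in> borel_measurable borel"
    by (rule P.borel_measurable_lebesgue_integral) (simp add: case_prod_unfold)
  then show ?thesis by (simp add: A_def[abs_def])
qed

text \<open>
The section at height \<open>- t\<close> is the reflection of the section at height \<open>t\<close>.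
\<close>
lemma profile_even: "A (- t) = A t"
proof -
  note body_borel[OF cpt, measurable]
  let ?P = "coords B"
  have "uminus ` K = K" using sym by (simp add: origin_symmetric_def)
  then have m: "- x \<in> K \<longleftrightarrow> x \<in> K" for x by (metis image_iff minus_minus)
  have "A (- t) = (LINT c|distr ?P ?P (\<lambda>c. \<lambda>b\<in>B. - c b). indicator K (lincomb B c + (- t) *\<^sub>R e))"
    by (simp add: A_def PiM_lborel_uminus[OF orthonormal_finite[OF B]])
  also have "\<dots> = (LINT c|?P. indicator K (lincomb B (\<lambda>b\<in>B. - c b) + (- t) *\<^sub>R e))"
    by (rule integral_distr) measurable
  also have "\<dots> = A t"
  proof -
    have eq: "lincomb B (\<lambda>b\<in>B. - c b) + (- t) *\<^sub>R e = - (lincomb B c + t *\<^sub>R e)" for c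
      by (simp add: lincomb_def sum_negf)
    have "indicator K (- x) = (indicator K x :: real)" for x using m by (simp add: indicator_def)
    then show ?thesis unfolding A_def eq by (simp only:)
  qed
  finally show ?thesis .
qed

lemma profile_support:
  assumes "K \<subseteq> cball 0 R" "R < t"
  shows "A t = 0"
proof -
  have "lincomb B c + t *\<^sub>R e \<notin> K" for c
    using coords_bound(1)[OF B e, of c t R] assms by auto
  then show ?thesis by (simp add: A_def)
qed

text \<open>
Brunn's theorem for a symmetric body: \<open>s\<close> is a convex combination of \<open>t\<close> and \<open>- t\<close>, where the
profile takes the same value, and the profile is log-concave.
\<close>
lemma profile_decreasing:
  assumes "0 \<le> s" "s \<le> t"
  shows "A t \<le> A s"
proof (cases "s = t")
  case False
  note body_borel[OF cpt, measurable]
  have t: "t > 0" using assms False by simp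
  obtain R where R: "K \<subseteq> cball 0 R" using compact_imp_bounded[OF cpt] by (auto simp: bounded_iff subset_iff)
  \<comment> \<open>the weight for which \<open>\<alpha> * t + (1 - \<alpha>) * (- t) = s\<close>\<close>
  define \<alpha> where "\<alpha> = (1 + s / t) / 2"
  have \<alpha>: "0 < \<alpha>" "\<alpha> < 1" using assms False t by (auto simp: \<alpha>_def intro!: add_pos_nonneg)
  have comb: "\<alpha> * t + (1 - \<alpha>) * (- t) = s" using t by (simp add: \<alpha>_def field_simps)
  have "log_concave_on B (\<lambda>c t. indicator K (lincomb B c + t *\<^sub>R e))"
    unfolding log_concave_on_def
  proof (intro allI impI)
    fix \<beta> t t' :: real and c c' assume \<beta>: "0 < \<beta>" "\<beta> < 1"
    let ?x = "lincomb B c + t *\<^sub>R e" and ?y = "lincomb B c' + t' *\<^sub>R e"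
    have "lincomb B (\<lambda>i. \<beta> * c i + (1 - \<beta>) * c' i) + (\<beta> * t + (1 - \<beta>) * t') *\<^sub>R e = \<beta> *\<^sub>R ?x + (1 - \<beta>) *\<^sub>R ?y"
      by (simp add: lincomb_def scaleR_add_left sum.distrib scaleR_add_right scaleR_sum_right)
    moreover have "\<beta> *\<^sub>R ?x + (1 - \<beta>) *\<^sub>R ?y \<in> K" if "?x \<in> K" "?y \<in> K"
      using cvx that \<beta> by (intro convexD) auto
    ultimately show "indicator K ?x powr \<beta> * indicator K ?y powr (1 - \<beta>)
      \<le> (indicator K (lincomb B (\<lambda>i. \<beta> * c i + (1 - \<beta>) * c' i) + (\<beta> * t + (1 - \<beta>) * t') *\<^sub>R e) :: real)"
      using \<beta> by (auto simp: indicator_def)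
  qed
  then have "A t powr \<alpha> * A (- t) powr (1 - \<alpha>) \<le> A (\<alpha> * t + (1 - \<alpha>) * (- t))"
    unfolding A_def using coords_bound(3)[OF B e, of _ _ R] R
    by (intro marginal_log_concave[where M=1 and R=R] orthonormal_finite[OF B] \<alpha>)
       (auto simp: indicator_def split: if_splits)
  then show ?thesis
    using profile_nonneg[of t] \<alpha> unfolding comb profile_even
    by (cases "A t = 0") (auto simp: profile_nonneg powr_add[symmetric])
qed simp

lemma lborel_integral_profile:
  assumes g: "continuous_on UNIV g" "\<And>t. \<bar>g t\<bar> \<le> M"
  shows "(LINT y|lborel. indicator K y * g (y \<bullet> e)) = (LINT t|lborel. g t * A t)"
proof -
  note body_borel[OF cpt, measurable]
  have [measurable]: "g \<in> borel_measurable borel" using g(1) by (rule borel_measurable_continuous_onI)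
  let ?P = "coords B"
  let ?h = "\<lambda>y. indicator K y * g (y \<bullet> e)"
  have int: "integrable lborel ?h"
    by (rule Bochner_Integration.integrable_bound[OF integrable_mult_right[OF body_integrable[OF cpt], of M]])
       (use g(2) in \<open>auto simp: indicator_def intro!: order_trans[OF g(2) abs_ge_self]\<close>)
  have ie: "(lincomb B c + t *\<^sub>R e) \<bullet> e = t" for c t
    using e by (simp add: inner_add_left lincomb_perp[OF B] norm_eq_1)
  have "(LINT y|lborel. ?h y) = (LINT t|lborel. LINT c|?P. indicator K (lincomb B c + t *\<^sub>R e) * g t)"
    unfolding lborel_integral_split(2)[OF B e int] ie ..
  also have "\<dots> = (LINT t|lborel. g t * A t)" by (simp add: A_def mult.commute)
  finally show ?thesis .
qed

end

context
  fixes K :: "'a::euclidean_space set"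
  assumes cpt: "compact K" and cvx: "convex K" and sym: "origin_symmetric K"
begin

text \<open>
Slicing \<open>K\<close> by hyperplanes orthogonal to \<open>\<zeta>\<close> reduces this to the unimodality of the section profile.
\<close>
lemma mexican_hat_body_nonneg:
  "0 \<le> (LINT y|lborel. indicator K y * ((1 - (y \<bullet> \<zeta>)\<^sup>2) * gauss (y \<bullet> \<zeta>)))"
proof (cases "\<zeta> = 0")
  case False
  define \<kappa> e where "\<kappa> = norm \<zeta>" and "e = \<zeta> /\<^sub>R \<kappa>"
  have e: "norm e = 1" and \<zeta>: "\<zeta> = \<kappa> *\<^sub>R e" using False by (auto simp: \<kappa>_def e_def)
  obtain B where B: "orthonormal_basis B (perp e)" using orthonormal_basis_exists[OF subspace_perp] by blast
  obtain R where R: "K \<subseteq> cball 0 R" using compact_imp_bounded[OF cpt] by (auto simp: bounded_iff subset_iff)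
  define A :: "real \<Rightarrow> real" where "A t = (LINT c|coords B. indicator K (lincomb B c + t *\<^sub>R e))" for t
  let ?k = "\<lambda>t. (1 - (\<kappa> * t)\<^sup>2) * gauss (\<kappa> * t)"
  note pr = cpt cvx sym B e A_def
  have bd: "\<bar>?k t\<bar> \<le> 2" for t
  proof -
    let ?u = "(\<kappa> * t)\<^sup>2"
    have "1 + ?u / 2 \<le> exp (?u / 2)" by (rule exp_ge_add_one_self)
    then have "\<bar>1 - ?u\<bar> \<le> 2 * exp (?u / 2)" using zero_le_power2[of "\<kappa> * t"] by linarith
    then have "\<bar>1 - ?u\<bar> * exp (- (?u / 2)) \<le> 2 * exp (?u / 2) * exp (- (?u / 2))"
      by (rule mult_right_mono) simp
    also have "\<dots> = 2" by (simp add: mult.assoc mult_exp_exp)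
    finally show ?thesis by (simp only: abs_mult abs_exp_cancel)
  qed
  have "(LINT y|lborel. indicator K y * ((1 - (y \<bullet> \<zeta>)\<^sup>2) * gauss (y \<bullet> \<zeta>)))
      = (LINT y|lborel. indicator K y * ?k (y \<bullet> e))" by (simp add: \<zeta>)
  also have "\<dots> = (LINT t|lborel. ?k t * A t)"
    by (rule lborel_integral_profile[OF pr _ bd]) (intro continuous_intros; simp)
  also have "\<dots> \<ge> 0"
    using profile_nonneg[OF pr] profile_even[OF pr] profile_decreasing[OF pr] profile_support[OF pr R]
      profile_measurable[OF pr]
    by (intro unimodal_integral_nonneg[where R=R] mexican_hat_integral_nonneg)
       (auto intro!: continuous_intros)
  finally show ?thesis .
qed simp

text \<open>
The case of dimension 4, in which \<open>\<bar>s\<bar> ^ (n - 2) = s\<^sup>2\<close> and the kernel is the Mexican hat. The width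
\<open>c\<close> is arbitrary because a change of scale is absorbed by \<open>\<zeta>\<close>.
\<close>
lemma radial_fourier_sq_nonneg:
  assumes c: "c > 0"
  shows "0 \<le> (LINT s|lborel. s\<^sup>2 * gauss (c * s) * body_cos K (s *\<^sub>R \<zeta>))"
proof -
  have *: "0 \<le> (LINT s|lborel. s\<^sup>2 * gauss s * body_cos K (s *\<^sub>R \<zeta>))" for \<zeta>
  proof -
    have "(LINT s|lborel. s\<^sup>2 * gauss s * body_cos K (s *\<^sub>R \<zeta>))
        = (LINT y|lborel. indicator K y * (sqrt (2 * pi) * (1 - (y \<bullet> \<zeta>)\<^sup>2) * gauss (y \<bullet> \<zeta>)))"
      by (subst radial_Fubini[OF cpt gauss_integrable(3)]) (simp add: gauss_sq_cos)
    also have "\<dots> = sqrt (2 * pi) * (LINT y|lborel. indicator K y * ((1 - (y \<bullet> \<zeta>)\<^sup>2) * gauss (y \<bullet> \<zeta>)))"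
      by (subst integral_mult_right_zero[symmetric]) (simp add: mult_ac)
    also have "\<dots> \<ge> 0" using mexican_hat_body_nonneg[of \<zeta>] by simp
    finally show ?thesis .
  qed
  have "(LINT s|lborel. s\<^sup>2 * gauss (c * s) * body_cos K (s *\<^sub>R \<zeta>))
      = \<bar>1 / c\<bar> *\<^sub>R (LINT s|lborel. (0 + 1 / c * s)\<^sup>2 * gauss (c * (0 + 1 / c * s)) * body_cos K ((0 + 1 / c * s) *\<^sub>R \<zeta>))"
    using c by (intro lborel_integral_real_affine) simp
  also have "\<dots> = (1 / c) * (LINT s|lborel. (1 / c)\<^sup>2 * (s\<^sup>2 * gauss s * body_cos K (s *\<^sub>R ((1 / c) *\<^sub>R \<zeta>))))"
    using c by (simp add: power_divide)
  also have "\<dots> \<ge> 0" using * c by (simp del: scaleR_scaleR)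
  finally show ?thesis .
qed

end

section \<open>Positivity of the radial Fourier integrals and Gaussians near a hyperplane\<close>

lemma gauss_fourier_scaled:
  fixes t \<sigma> :: real
  assumes "\<sigma> > 0"
  shows "integrable lborel (\<lambda>s::real. complex_of_real (gauss (\<sigma> * s)) * iexp (t * s))"
    and "(LINT s|lborel. complex_of_real (gauss (\<sigma> * s)) * iexp (t * s))
      = complex_of_real (sqrt (2 * pi) / \<sigma> * gauss (t / \<sigma>))"
proof -
  let ?f = "\<lambda>s::real. complex_of_real (gauss s) * iexp (t / \<sigma> * s)"
  have eq: "?f (0 + \<sigma> * s) = complex_of_real (gauss (\<sigma> * s)) * iexp (t * s)" for s
    using assms by simp
  show "integrable lborel (\<lambda>s::real. complex_of_real (gauss (\<sigma> * s)) * iexp (t * s))"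
    using lborel_integrable_real_affine[OF gauss_fourier(1)[of "t / \<sigma>"], of \<sigma> 0] assms unfolding eq by simp
  have "complex_of_real (sqrt (2 * pi) * gauss (t / \<sigma>)) = \<bar>\<sigma>\<bar> *\<^sub>R (LINT s|lborel. ?f (0 + \<sigma> * s))"
    unfolding gauss_fourier(2)[symmetric] using assms by (intro lborel_integral_real_affine) simp
  then show "(LINT s|lborel. complex_of_real (gauss (\<sigma> * s)) * iexp (t * s))
      = complex_of_real (sqrt (2 * pi) / \<sigma> * gauss (t / \<sigma>))"
    using assms unfolding eq by (simp add: scaleR_conv_of_real field_simps)
qed

lemma gauss_scaled:
  fixes t \<sigma> :: real
  assumes "\<sigma> > 0"
  shows "integrable lborel (\<lambda>s. gauss (\<sigma> * s))"
    and "(LINT s|lborel. gauss (\<sigma> * s) * cos (t * s)) = sqrt (2 * pi) / \<sigma> * gauss (t / \<sigma>)"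
    and "(LINT s|lborel. gauss (\<sigma> * s)) = sqrt (2 * pi) / \<sigma>"
proof -
  show "integrable lborel (\<lambda>s. gauss (\<sigma> * s))"
    using lborel_integrable_real_affine[OF gauss_integrable(1), of \<sigma> 0] assms by simp
  show eq: "(LINT s|lborel. gauss (\<sigma> * s) * cos (t * s)) = sqrt (2 * pi) / \<sigma> * gauss (t / \<sigma>)" for t
  proof -
    have "(LINT s|lborel. Re (complex_of_real (gauss (\<sigma> * s)) * iexp (t * s)))
        = Re (LINT s|lborel. complex_of_real (gauss (\<sigma> * s)) * iexp (t * s))"
      using gauss_fourier_scaled(1)[OF assms, of t] by (rule integral_Re)
    then show ?thesis unfolding gauss_fourier_scaled(2)[OF assms] by (simp add: Re_exp)
  qed
  show "(LINT s|lborel. gauss (\<sigma> * s)) = sqrt (2 * pi) / \<sigma>" using eq[of 0] by simp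
qed

lemma gauss_abs_scaled_integrable:
  assumes "\<sigma> > 0"
  shows "integrable lborel (\<lambda>s::real. \<bar>s\<bar> * gauss (\<sigma> * s))"
proof -
  have "integrable lborel (\<lambda>s. (1 / \<sigma>) * (\<bar>0 + \<sigma> * s\<bar> * gauss (0 + \<sigma> * s)))"
    using lborel_integrable_real_affine[OF gauss_integrable(2), of \<sigma> 0] assms by (intro integrable_mult_right) simp
  then show ?thesis using assms by (simp add: abs_mult)
qed

context
  fixes K :: "'a::euclidean_space set"
  assumes cpt: "compact K" and cvx: "convex K" and sym: "origin_symmetric K"
begin

text \<open>
The case of dimension 2: the kernel is a positive Gaussian, whatever the shape of \<open>K\<close>.
\<close>
lemma radial_fourier_const_nonneg:
  assumes \<kappa>: "\<kappa> > 0"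
  shows "0 \<le> (LINT s|lborel. gauss (\<kappa> * s) * body_cos K (s *\<^sub>R \<zeta>))"
  unfolding radial_Fubini[OF cpt gauss_scaled(1)[OF \<kappa>]] gauss_scaled(2)[OF \<kappa>]
  using \<kappa> by (intro integral_nonneg_AE AE_I2) auto

text \<open>
The case of dimension 3. Since \<open>\<integral> exp (- (s v)\<^sup>2 / 2) dv = sqrt (2 \<pi>) / \<bar>s\<bar>\<close>, the weight
\<open>\<bar>s\<bar> * exp (- (\<kappa> s)\<^sup>2 / 2)\<close> is a positive mixture over \<open>v\<close> of the weights
\<open>s\<^sup>2 * exp (- (c s)\<^sup>2 / 2)\<close> with \<open>c\<^sup>2 = \<kappa>\<^sup>2 + v\<^sup>2\<close>.
\<close>
lemma radial_fourier_abs_nonneg: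
  assumes \<kappa>: "\<kappa> > 0"
  shows "0 \<le> (LINT s|lborel. \<bar>s\<bar> * gauss (\<kappa> * s) * body_cos K (s *\<^sub>R \<zeta>))"
proof -
  note [measurable] = body_cos_measurable[OF cpt]
  let ?F = "\<lambda>s v. s\<^sup>2 * gauss (\<kappa> * s) * body_cos K (s *\<^sub>R \<zeta>) * gauss (s * v)"
  have gv: "s\<^sup>2 * (LINT v|lborel. gauss (s * v)) = sqrt (2 * pi) * \<bar>s\<bar>" for s :: real
  proof (cases "s = 0")
    case False
    have "(LINT v|lborel. gauss (s * v)) = sqrt (2 * pi) / \<bar>s\<bar>"
      using gauss_scaled(3)[of "\<bar>s\<bar>"] False by (simp add: power_mult_distrib)
    moreover have "\<bar>s\<bar>\<^sup>2 * (sqrt (2 * pi) / \<bar>s\<bar>) = sqrt (2 * pi) * \<bar>s\<bar>"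
    proof -
      have "a\<^sup>2 * (X / a) = X * a" if "a \<noteq> 0" for a X :: real using that by (simp add: power2_eq_square)
      then show ?thesis using False by (simp only: abs_eq_0 not_False_eq_True)
    qed
    ultimately show ?thesis by (simp only: power2_abs)
  qed simp
  have gi: "integrable lborel (\<lambda>v. s\<^sup>2 * gauss (s * v))" for s :: real
  proof (cases "s = 0")
    case False
    then show ?thesis using gauss_scaled(1)[of "\<bar>s\<bar>"] by (intro integrable_mult_right) (simp add: power_mult_distrib)
  qed simp
  have int: "integrable (lborel \<Otimes>\<^sub>M lborel) (\<lambda>(s, v). ?F s v)"
  proof (rule lborel_pair.Fubini_integrable)
    have "norm (?F s v) = (gauss (\<kappa> * s) * \<bar>body_cos K (s *\<^sub>R \<zeta>)\<bar>) * (s\<^sup>2 * gauss (s * v))" for s v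
      by (simp add: abs_mult)
    then have "(LINT v|lborel. norm (?F s v)) = (gauss (\<kappa> * s) * \<bar>body_cos K (s *\<^sub>R \<zeta>)\<bar>) * (sqrt (2 * pi) * \<bar>s\<bar>)" for s
      by (simp only: gv[symmetric] integral_mult_right_zero)
    moreover have "integrable lborel (\<lambda>s. (gauss (\<kappa> * s) * \<bar>body_cos K (s *\<^sub>R \<zeta>)\<bar>) * (sqrt (2 * pi) * \<bar>s\<bar>))"
    proof (rule Bochner_Integration.integrable_bound[OF integrable_mult_right[OF gauss_abs_scaled_integrable[OF \<kappa>], of "measure lborel K * sqrt (2 * pi)"]])
      show "AE s in lborel. norm (gauss (\<kappa> * s) * \<bar>body_cos K (s *\<^sub>R \<zeta>)\<bar> * (sqrt (2 * pi) * \<bar>s\<bar>))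
        \<le> norm (measure lborel K * sqrt (2 * pi) * (\<bar>s\<bar> * gauss (\<kappa> * s)))"
        using body_cos_bound[OF cpt] by (intro AE_I2) (auto simp: abs_mult mult_ac intro!: mult_left_mono)
    qed measurable
    ultimately show "integrable lborel (\<lambda>s. LINT v|lborel. norm (case (s, v) of (s, v) \<Rightarrow> ?F s v))" by simp
    have "integrable lborel (\<lambda>v. (gauss (\<kappa> * s) * body_cos K (s *\<^sub>R \<zeta>)) * (s\<^sup>2 * gauss (s * v)))" for s
      by (intro integrable_mult_right gi)
    then show "AE s in lborel. integrable lborel (\<lambda>v. case (s, v) of (s, v) \<Rightarrow> ?F s v)" by (simp add: mult_ac)
  qed measurable
  have "sqrt (2 * pi) * (LINT s|lborel. \<bar>s\<bar> * gauss (\<kappa> * s) * body_cos K (s *\<^sub>R \<zeta>))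
      = (LINT s|lborel. (gauss (\<kappa> * s) * body_cos K (s *\<^sub>R \<zeta>)) * (sqrt (2 * pi) * \<bar>s\<bar>))"
    by (subst integral_mult_right_zero[symmetric]) (simp add: mult_ac)
  also have "\<dots> = (LINT s|lborel. LINT v|lborel. ?F s v)"
    unfolding gv[symmetric] integral_mult_right_zero[symmetric] by (simp add: mult_ac)
  also have "\<dots> = (LINT v|lborel. LINT s|lborel. ?F s v)"
    using lborel_pair.Fubini_integral[OF int] by simp
  also have "\<dots> \<ge> 0"
  proof (rule integral_nonneg_AE, rule AE_I2)
    fix v :: real
    \<comment> \<open>for fixed \<open>v\<close> the two Gaussian factors combine into one\<close>
    define c where "c = sqrt (\<kappa>\<^sup>2 + v\<^sup>2)"
    have c: "c > 0" "c\<^sup>2 = \<kappa>\<^sup>2 + v\<^sup>2" using \<kappa> by (auto simp: c_def intro!: add_pos_nonneg)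
    have "?F s v = s\<^sup>2 * gauss (c * s) * body_cos K (s *\<^sub>R \<zeta>)" for s
    proof -
      have "gauss (c * s) = gauss (\<kappa> * s) * gauss (s * v)"
        unfolding mult_exp_exp power_mult_distrib c(2) by (simp add: field_simps)
      then show ?thesis by simp
    qed
    then show "0 \<le> (LINT s|lborel. ?F s v)"
      using radial_fourier_sq_nonneg[OF cpt cvx sym c(1), of \<zeta>] by (simp only:)
  qed
  finally show ?thesis using pi_gt_zero by (auto simp: zero_le_mult_iff)
qed

text \<open>
This is where the dimension enters: the cosine transform of \<open>\<bar>s\<bar> ^ (n - 2)\<close> times a Gaussian has
a nonnegative primitive on \<open>{0..}\<close> for \<open>n \<le> 4\<close>, but for \<open>n = 5\<close> the primitive is negative at large
arguments.
\<close>
lemma radial_fourier_nonneg: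
  assumes "2 \<le> n" "n \<le> 4" and \<kappa>: "\<kappa> > 0"
  shows "0 \<le> (LINT s|lborel. \<bar>s\<bar> ^ (n - 2) * gauss (\<kappa> * s) * body_cos K (s *\<^sub>R \<zeta>))"
proof -
  consider "n = 2" | "n = 3" | "n = 4" using assms by linarith
  then show ?thesis
    using radial_fourier_const_nonneg[OF \<kappa>, of \<zeta>] radial_fourier_abs_nonneg[OF \<kappa>, of \<zeta>]
      radial_fourier_sq_nonneg[OF cpt cvx sym \<kappa>, of \<zeta>]
    by cases (simp_all add: power2_eq_square)
qed

end

lemma lborel_prod_integral:
  fixes f :: "'a::euclidean_space \<Rightarrow> real \<Rightarrow> 'b::{real_normed_field, banach, second_countable_topology}"
  assumes B: "orthonormal_basis B UNIV" and f: "\<And>b. b \<in> B \<Longrightarrow> integrable lborel (f b)"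
  shows "integrable lborel (\<lambda>\<xi>. \<Prod>b\<in>B. f b (\<xi> \<bullet> b))"
    and "(LINT \<xi>|lborel. (\<Prod>b\<in>B. f b (\<xi> \<bullet> b))) = (\<Prod>b\<in>B. (LINT s|lborel. f b s))"
proof -
  interpret product_sigma_finite "\<lambda>_::'a. lborel :: real measure"
    by (rule product_sigma_finite_lborel)
  have fin: "finite B" using B by (rule orthonormal_finite)
  have [measurable]: "f b \<in> borel_measurable borel" if "b \<in> B" for b using f[OF that] by auto
  have m: "(\<lambda>\<xi>. \<Prod>b\<in>B. f b (\<xi> \<bullet> b)) \<in> borel_measurable borel" by measurable
  have eq: "(\<Prod>b\<in>B. f b (lincomb B c \<bullet> b)) = (\<Prod>b\<in>B. f b (c b))" for c
    by (intro prod.cong) (auto simp: lincomb_inner[OF B])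
  show "integrable lborel (\<lambda>\<xi>. \<Prod>b\<in>B. f b (\<xi> \<bullet> b))"
    unfolding lborel_orthonormal[OF B] using m
    by (subst integrable_distr_eq) (auto simp: eq intro!: product_integrable_prod fin f)
  show "(LINT \<xi>|lborel. (\<Prod>b\<in>B. f b (\<xi> \<bullet> b))) = (\<Prod>b\<in>B. (LINT s|lborel. f b s))"
    by (subst lborel_orthonormal[OF B], subst integral_distr[OF _ m]) (auto simp: eq intro!: product_integral_prod fin f)
qed

lemma norm_sum_inner:
  assumes B: "orthonormal_basis B (UNIV::'a::euclidean_space set)"
  shows "(\<Sum>b\<in>B. (y \<bullet> b)\<^sup>2) = (norm y)\<^sup>2" "(\<Sum>b\<in>B. (y \<bullet> b) * (\<xi> \<bullet> b)) = y \<bullet> \<xi>"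
proof -
  have "(\<Sum>b\<in>B. (y \<bullet> b) * (\<xi> \<bullet> b)) = y \<bullet> lincomb B (\<lambda>b. \<xi> \<bullet> b)" for \<xi>
    by (simp add: lincomb_def inner_sum_right mult.commute)
  then show *: "(\<Sum>b\<in>B. (y \<bullet> b) * (\<xi> \<bullet> b)) = y \<bullet> \<xi>" for \<xi>
    by (simp only: lincomb_eq[OF B UNIV_I])
  show "(\<Sum>b\<in>B. (y \<bullet> b)\<^sup>2) = (norm y)\<^sup>2"
    using *[of y] by (simp only: power2_eq_square[of "_ \<bullet> _"] power2_norm_eq_inner)
qed

lemma gauss_lborel_integrable: "integrable lborel (\<lambda>\<xi>::'a::euclidean_space. gauss (norm \<xi>))"
proof -
  obtain B where B: "orthonormal_basis B (UNIV :: 'a set)" using orthonormal_basis_exists[OF subspace_UNIV] by blast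
  have "integrable lborel (\<lambda>\<xi>::'a. \<Prod>b\<in>B. gauss (\<xi> \<bullet> b))"
    by (rule lborel_prod_integral(1)[OF B gauss_integrable(1)])
  moreover have "(\<Prod>b\<in>B. gauss (\<xi> \<bullet> b)) = gauss (norm \<xi>)" for \<xi> :: 'a
    using norm_sum_inner(1)[OF B, of \<xi>]
    by (simp add: exp_sum[OF orthonormal_finite[OF B], symmetric] sum_negf sum_divide_distrib[symmetric])
  ultimately show ?thesis by simp
qed

text \<open>
The normal density of standard deviation \<open>\<delta>\<close>. Applied to \<open>x \<bullet> \<xi>\<close>, it approximates the condition
\<open>x \<bottom> \<xi>\<close> symmetrically in the two vectors. A Gaussian profile keeps the integrals over \<open>\<xi>\<close> explicit.
\<close>
definition thick_delta :: "real \<Rightarrow> real \<Rightarrow> real" where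
  "thick_delta \<delta> t = gauss (t / \<delta>) / (sqrt (2 * pi) * \<delta>)"

lemma thick_delta_bound: "\<delta> > 0 \<Longrightarrow> \<bar>thick_delta \<delta> t\<bar> \<le> 1 / (sqrt (2 * pi) * \<delta>)"
  by (auto simp: thick_delta_def intro!: divide_right_mono)

lemma thick_delta_nonneg: "\<delta> > 0 \<Longrightarrow> 0 \<le> thick_delta \<delta> t"
  by (auto simp: thick_delta_def)

lemma thick_delta_measurable[measurable]: "thick_delta \<delta> \<in> borel_measurable borel"
  unfolding thick_delta_def[abs_def] by measurable

text \<open>
The Fourier transform of a Gaussian on the slab around the hyperplane orthogonal to \<open>x\<close>, computed
as a product over an orthonormal basis containing the direction of \<open>x\<close>: the other directions
give the Gaussian of the distance of \<open>y\<close> from the line through \<open>x\<close>, and the direction of \<open>x\<close> gives a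
factor that tends to \<open>1 / norm x\<close> as \<open>\<delta>\<close> tends to 0.
\<close>
lemma gauss_thick_hyperplane:
  fixes x y :: "'a::euclidean_space"
  assumes x: "x \<noteq> 0" and \<delta>: "\<delta> > 0"
  defines "u \<equiv> (y \<bullet> x) / norm x"
  shows "(LINT \<xi>|lborel. gauss (norm \<xi>) * thick_delta \<delta> (x \<bullet> \<xi>) * cos (y \<bullet> \<xi>))
    = sqrt (2 * pi) ^ (DIM('a) - 1) * exp (- (((norm y)\<^sup>2 - u\<^sup>2) / 2)) *
      (exp (- (u\<^sup>2 * \<delta>\<^sup>2 / (2 * (\<delta>\<^sup>2 + (norm x)\<^sup>2)))) / sqrt (\<delta>\<^sup>2 + (norm x)\<^sup>2))"
proof -
  define e where "e = x /\<^sub>R norm x"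
  have e: "norm e = 1" and xe: "x = norm x *\<^sub>R e" and ue: "u = y \<bullet> e"
    using x by (auto simp: e_def u_def divide_inverse mult.commute)
  obtain B where B: "orthonormal_basis B (perp e)" using orthonormal_basis_exists[OF subspace_perp] by blast
  note ins = orthonormal_insert[OF B e]
  have fin: "finite B" using B by (rule orthonormal_finite)
  have "card (insert e B) = DIM('a)"
    using ins(2) orthonormal_independent[OF ins(2)] by (metis orthonormal_basis_def dim_UNIV dim_eq_card dim_span)
  then have card: "card B = DIM('a) - 1" using fin ins(1) by simp
  \<comment> \<open>in the direction of \<open>x\<close> the slab weight sharpens the standard Gaussian to \<open>exp (- (\<sigma> * s)\<^sup>2 / 2)\<close>\<close>
  define \<sigma> where "\<sigma> = sqrt (1 + (norm x / \<delta>)\<^sup>2)"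
  have \<sigma>: "\<sigma> > 0" "\<sigma>\<^sup>2 = 1 + (norm x / \<delta>)\<^sup>2" by (auto simp: \<sigma>_def intro!: add_pos_nonneg)
  define f where "f b s = (if b = e then complex_of_real (1 / (sqrt (2 * pi) * \<delta>)) * (complex_of_real (gauss (\<sigma> * s)) * iexp ((y \<bullet> e) * s))
      else complex_of_real (gauss s) * iexp ((y \<bullet> b) * s))" for b s
  have fint: "integrable lborel (f b)" for b
  proof (cases "b = e")
    case True
    then show ?thesis unfolding f_def by (simp only: refl if_True) (intro integrable_mult_right gauss_fourier_scaled(1)[OF \<sigma>(1)])
  next
    case False
    then show ?thesis unfolding f_def by (simp only: if_False gauss_fourier(1))
  qed
  have prod: "(\<Prod>b\<in>insert e B. f b (\<xi> \<bullet> b))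
      = complex_of_real (gauss (norm \<xi>) * thick_delta \<delta> (x \<bullet> \<xi>)) * iexp (y \<bullet> \<xi>)" for \<xi>
  proof -
    have xx: "x \<bullet> \<xi> / \<delta> = (norm x / \<delta>) * (\<xi> \<bullet> e)" by (subst xe) (simp add: inner_commute)
    have s1: "gauss (\<sigma> * (\<xi> \<bullet> e)) / (sqrt (2 * pi) * \<delta>) = gauss (\<xi> \<bullet> e) * thick_delta \<delta> (x \<bullet> \<xi>)"
      unfolding thick_delta_def xx power_mult_distrib \<sigma>(2) times_divide_eq_right mult_exp_exp
      by (simp add: algebra_simps add_divide_distrib)
    have "f e (\<xi> \<bullet> e) = complex_of_real (thick_delta \<delta> (x \<bullet> \<xi>)) *
        (complex_of_real (gauss (\<xi> \<bullet> e)) * iexp ((y \<bullet> e) * (\<xi> \<bullet> e)))"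
    proof -
      have "f e (\<xi> \<bullet> e) = complex_of_real (gauss (\<sigma> * (\<xi> \<bullet> e)) / (sqrt (2 * pi) * \<delta>)) * iexp ((y \<bullet> e) * (\<xi> \<bullet> e))"
        by (simp add: f_def)
      then show ?thesis unfolding s1 by (simp only: of_real_mult mult_ac)
    qed
    moreover have "(\<Prod>b\<in>B. f b (\<xi> \<bullet> b)) = (\<Prod>b\<in>B. complex_of_real (gauss (\<xi> \<bullet> b)) * iexp ((y \<bullet> b) * (\<xi> \<bullet> b)))"
      using ins(1) by (intro prod.cong) (auto simp: f_def)
    ultimately have "(\<Prod>b\<in>insert e B. f b (\<xi> \<bullet> b)) = complex_of_real (thick_delta \<delta> (x \<bullet> \<xi>)) *
        (\<Prod>b\<in>insert e B. complex_of_real (gauss (\<xi> \<bullet> b)) * iexp ((y \<bullet> b) * (\<xi> \<bullet> b)))"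
      using fin ins(1) by simp
    also have "(\<Prod>b\<in>insert e B. complex_of_real (gauss (\<xi> \<bullet> b)) * iexp ((y \<bullet> b) * (\<xi> \<bullet> b)))
        = complex_of_real (exp (\<Sum>b\<in>insert e B. - ((\<xi> \<bullet> b)\<^sup>2 / 2))) * exp (\<Sum>b\<in>insert e B. \<i> * complex_of_real ((y \<bullet> b) * (\<xi> \<bullet> b)))"
      using fin by (simp only: prod.distrib exp_sum[OF finite.insertI[OF fin]] of_real_prod)
    also have "(\<Sum>b\<in>insert e B. \<i> * complex_of_real ((y \<bullet> b) * (\<xi> \<bullet> b))) = \<i> * complex_of_real (y \<bullet> \<xi>)"
      unfolding sum_distrib_left[symmetric] of_real_sum[symmetric] norm_sum_inner(2)[OF ins(2)] ..
    also have "(\<Sum>b\<in>insert e B. - ((\<xi> \<bullet> b)\<^sup>2 / 2)) = - ((norm \<xi>)\<^sup>2 / 2)"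
      unfolding sum_negf sum_divide_distrib[symmetric] norm_sum_inner(1)[OF ins(2)] ..
    finally show ?thesis by (simp add: mult_ac)
  qed
  have sum: "(\<Sum>b\<in>B. (y \<bullet> b)\<^sup>2) = (norm y)\<^sup>2 - u\<^sup>2"
    using norm_sum_inner(1)[OF ins(2), of y] fin ins(1) ue by simp
  have fe: "(LINT s|lborel. f e s) = complex_of_real (exp (- (u\<^sup>2 * \<delta>\<^sup>2 / (2 * (\<delta>\<^sup>2 + (norm x)\<^sup>2)))) / sqrt (\<delta>\<^sup>2 + (norm x)\<^sup>2))"
  proof -
    have "\<delta> * \<sigma> = sqrt (\<delta>\<^sup>2 * (1 + (norm x / \<delta>)\<^sup>2))" using \<delta> by (simp add: \<sigma>_def real_sqrt_mult)
    also have "\<delta>\<^sup>2 * (1 + (norm x / \<delta>)\<^sup>2) = \<delta>\<^sup>2 + (norm x)\<^sup>2" using \<delta> by (simp add: field_simps power_divide)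
    finally have ds: "\<delta> * \<sigma> = sqrt (\<delta>\<^sup>2 + (norm x)\<^sup>2)" .
    have "(u / \<sigma>)\<^sup>2 = u\<^sup>2 * \<delta>\<^sup>2 / (\<delta> * \<sigma>)\<^sup>2" using \<delta> \<sigma> by (simp add: power_divide power_mult_distrib)
    also have "\<dots> = u\<^sup>2 * \<delta>\<^sup>2 / (\<delta>\<^sup>2 + (norm x)\<^sup>2)" unfolding ds by simp
    finally have uu: "(u / \<sigma>)\<^sup>2 / 2 = u\<^sup>2 * \<delta>\<^sup>2 / (2 * (\<delta>\<^sup>2 + (norm x)\<^sup>2))" by simp
    have "(LINT s|lborel. f e s) = complex_of_real (1 / (sqrt (2 * pi) * \<delta>)) *
        complex_of_real (sqrt (2 * pi) / \<sigma> * gauss (u / \<sigma>))"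
    proof -
      have "f e s = complex_of_real (1 / (sqrt (2 * pi) * \<delta>)) * (complex_of_real (gauss (\<sigma> * s)) * iexp ((y \<bullet> e) * s))" for s
        by (simp only: f_def refl if_True)
      then show ?thesis unfolding ue gauss_fourier_scaled(2)[OF \<sigma>(1), symmetric] by (simp only: integral_mult_right_zero)
    qed
    also have "\<dots> = complex_of_real (gauss (u / \<sigma>) / (\<delta> * \<sigma>))"
      unfolding of_real_mult[symmetric] by simp
    finally show ?thesis unfolding uu ds .
  qed
  have fb: "(\<Prod>b\<in>B. (LINT s|lborel. f b s)) = complex_of_real (sqrt (2 * pi) ^ (DIM('a) - 1) * exp (- (((norm y)\<^sup>2 - u\<^sup>2) / 2)))"
  proof -
    have "(\<Prod>b\<in>B. (LINT s|lborel. f b s)) = (\<Prod>b\<in>B. complex_of_real (sqrt (2 * pi) * gauss (y \<bullet> b)))"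
    proof (intro prod.cong refl)
      fix b assume "b \<in> B"
      then have "b \<noteq> e" using ins(1) by auto
      then show "(LINT s|lborel. f b s) = complex_of_real (sqrt (2 * pi) * gauss (y \<bullet> b))"
        by (simp only: f_def if_False gauss_fourier(2))
    qed
    also have "\<dots> = complex_of_real (sqrt (2 * pi) ^ card B * exp (\<Sum>b\<in>B. - ((y \<bullet> b)\<^sup>2 / 2)))"
      unfolding of_real_prod[symmetric] prod.distrib prod_constant exp_sum[OF fin] ..
    finally show ?thesis unfolding sum_negf sum_divide_distrib[symmetric] sum card .
  qed
  have int: "integrable lborel (\<lambda>\<xi>. complex_of_real (gauss (norm \<xi>) * thick_delta \<delta> (x \<bullet> \<xi>)) * iexp (y \<bullet> \<xi>))"
    using lborel_prod_integral(1)[OF ins(2), of f, OF fint] unfolding prod .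
  have "(LINT \<xi>|lborel. Re (complex_of_real (gauss (norm \<xi>) * thick_delta \<delta> (x \<bullet> \<xi>)) * iexp (y \<bullet> \<xi>)))
      = Re (\<Prod>b\<in>insert e B. (LINT s|lborel. f b s))"
    using integral_Re[OF int] lborel_prod_integral(2)[OF ins(2), of f, OF fint] unfolding prod by simp
  also have "(\<Prod>b\<in>insert e B. (LINT s|lborel. f b s)) = (LINT s|lborel. f e s) * (\<Prod>b\<in>B. (LINT s|lborel. f b s))"
    using fin ins(1) by simp
  also have "Re \<dots> = sqrt (2 * pi) ^ (DIM('a) - 1) * exp (- (((norm y)\<^sup>2 - u\<^sup>2) / 2)) *
      (exp (- (u\<^sup>2 * \<delta>\<^sup>2 / (2 * (\<delta>\<^sup>2 + (norm x)\<^sup>2)))) / sqrt (\<delta>\<^sup>2 + (norm x)\<^sup>2))"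
    unfolding fe fb of_real_mult[symmetric] Re_complex_of_real by (rule mult.commute)
  finally show ?thesis by (simp add: Re_exp)
qed

section \<open>Chords through the origin, and coordinates on central hyperplanes\<close>

lemma nn_integral_dilation:
  fixes h :: "'a::euclidean_space \<Rightarrow> ennreal"
  assumes [measurable]: "h \<in> borel_measurable borel" and c: "c \<noteq> 0"
  shows "(\<integral>\<^sup>+x. h x \<partial>lborel) = ennreal (\<bar>c\<bar> ^ DIM('a)) * (\<integral>\<^sup>+x. h (c *\<^sub>R x) \<partial>lborel)"
  by (subst lborel_affine[OF c, of 0]) (simp add: nn_integral_density nn_integral_distr nn_integral_cmult)

lemma nn_integral_tail_power:
  assumes "2 \<le> n"
  shows "(\<integral>\<^sup>+s. ennreal (1 / s ^ n) * indicator {1..} s \<partial>lborel) = ennreal (1 / (real n - 1))"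
proof -
  define m where "m = n - 1"
  have m: "n = Suc m" "m \<ge> 1" using assms by (auto simp: m_def)
  let ?F = "\<lambda>s::real. - inverse (s ^ m) / real m"
  have "(\<integral>\<^sup>+s. ennreal (1 / s ^ n) * indicator {1..} s \<partial>lborel) = ennreal (0 - ?F 1)"
  proof (rule nn_integral_FTC_atLeast)
    fix s :: real assume s: "1 \<le> s"
    have "(?F has_real_derivative - (- (inverse (s ^ m) * (real m * s ^ (m - 1)) * inverse (s ^ m))) / real m) (at s)"
      using s m by (auto intro!: derivative_eq_intros)
    moreover have "s ^ m = s * s ^ (m - 1)" using m(2) by (cases m) auto
    then have "- (- (inverse (s ^ m) * (real m * s ^ (m - 1)) * inverse (s ^ m))) / real m = 1 / s ^ n"
      using s m by (simp add: field_simps)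
    ultimately show "(?F has_real_derivative 1 / s ^ n) (at s)" by simp
    show "0 \<le> 1 / s ^ n" using s by simp
  next
    have "filterlim (\<lambda>s::real. s ^ m) at_top at_top"
      using m(2) by (intro filterlim_pow_at_top filterlim_ident) simp
    then have "((\<lambda>s::real. inverse (s ^ m)) \<longlongrightarrow> 0) at_top"
      by (rule tendsto_inverse_0_at_top)
    then show "(?F \<longlongrightarrow> 0) at_top"
      using tendsto_divide[OF tendsto_minus, of _ 0 at_top "\<lambda>_. real m" "real m"] m(2) by simp
  qed measurable
  then show ?thesis using m by simp
qed

lemma nn_integral_min_power:
  assumes n: "2 \<le> n"
  shows "(\<integral>\<^sup>+s. ennreal (if \<bar>s\<bar> \<le> 1 then 1 else 1 / \<bar>s\<bar> ^ n) \<partial>lborel) \<le> ennreal (2 * (real n / (real n - 1)))"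
proof -
  let ?t = "\<lambda>s::real. ennreal (1 / s ^ n) * indicator {1..} s"
  have "(\<integral>\<^sup>+s. ennreal (if \<bar>s\<bar> \<le> 1 then 1 else 1 / \<bar>s\<bar> ^ n) \<partial>lborel)
      \<le> (\<integral>\<^sup>+s. indicator {-1..1} s + (?t s + ?t (- s)) \<partial>lborel)"
    by (intro nn_integral_mono) (auto simp: indicator_def abs_if)
  also have "\<dots> = (\<integral>\<^sup>+s. indicator {-1..1::real} s \<partial>lborel) + ((\<integral>\<^sup>+s. ?t s \<partial>lborel) + (\<integral>\<^sup>+s. ?t (- s) \<partial>lborel))"
    by (subst nn_integral_add, simp, simp, subst nn_integral_add) simp_all
  also have "(\<integral>\<^sup>+s. ?t (- s) \<partial>lborel) = (\<integral>\<^sup>+s. ?t s \<partial>lborel)"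
    using nn_integral_real_affine[of ?t "-1" 0] by simp
  also have "(\<integral>\<^sup>+s. indicator {-1..1::real} s \<partial>lborel) + ((\<integral>\<^sup>+s. ?t s \<partial>lborel) + (\<integral>\<^sup>+s. ?t s \<partial>lborel))
      = ennreal (2 + (1 / (real n - 1) + 1 / (real n - 1)))"
    unfolding nn_integral_tail_power[OF n] using n by (subst ennreal_plus, simp, simp, subst ennreal_plus) auto
  also have "2 + (1 / (real n - 1) + 1 / (real n - 1)) = 2 * (real n / (real n - 1))"
    using n by (simp add: field_simps)
  finally show ?thesis .
qed

text \<open>
The length of \<open>{s. s *\<^sub>R x \<in> K}\<close>. For a symmetric convex body this is twice the reciprocal of the gauge
of \<open>K\<close> at \<open>x\<close>, but as an integral it is open to Fubini.
\<close>
definition chord :: "'a::euclidean_space set \<Rightarrow> 'a \<Rightarrow> ennreal" where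
  "chord K x = (\<integral>\<^sup>+s. indicator K (s *\<^sub>R x) \<partial>(lborel :: real measure))"

lemma chord_measurable[measurable]:
  assumes [measurable]: "K \<in> sets borel"
  shows "chord K \<in> borel_measurable borel"
  unfolding chord_def[abs_def] by measurable

text \<open>
By Fubini the integral is \<open>\<integral> \<bar>{x \<in> K. s *\<^sub>R x \<in> K}\<bar> ds\<close>, and the set has volume at most
\<open>min 1 (\<bar>s\<bar> powr - n)\<close> times that of \<open>K\<close>.
\<close>
lemma nn_integral_chord:
  fixes K :: "'a::euclidean_space set"
  assumes K[measurable]: "K \<in> sets borel" and n: "2 \<le> DIM('a)"
  shows "(\<integral>\<^sup>+x. indicator K x * chord K x \<partial>lborel)
      \<le> ennreal (2 * (real DIM('a) / (real DIM('a) - 1))) * emeasure lborel K"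
proof -
  let ?w = "\<lambda>s::real. if \<bar>s\<bar> \<le> 1 then 1 else 1 / \<bar>s\<bar> ^ DIM('a)"
  have "(\<integral>\<^sup>+x. indicator K x * chord K x \<partial>lborel)
      = (\<integral>\<^sup>+x. \<integral>\<^sup>+s. indicator K x * indicator K (s *\<^sub>R x) \<partial>(lborel :: real measure) \<partial>lborel)"
    unfolding chord_def by (intro nn_integral_cong nn_integral_cmult[symmetric]) measurable
  also have "\<dots> = (\<integral>\<^sup>+s. \<integral>\<^sup>+x. indicator K x * indicator K (s *\<^sub>R x) \<partial>lborel \<partial>(lborel :: real measure))"
    by (rule pair_sigma_finite.Fubini') (auto simp: pair_sigma_finite_def sigma_finite_lborel)
  also have "\<dots> \<le> (\<integral>\<^sup>+s. ennreal (?w s) * emeasure lborel K \<partial>lborel)"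
  proof (rule nn_integral_mono)
    fix s :: real
    show "(\<integral>\<^sup>+x. indicator K x * indicator K (s *\<^sub>R x) \<partial>lborel) \<le> ennreal (?w s) * emeasure lborel K"
    proof (cases "\<bar>s\<bar> \<le> 1")
      case True
      have "(\<integral>\<^sup>+x. indicator K x * indicator K (s *\<^sub>R x) \<partial>lborel) \<le> (\<integral>\<^sup>+x. indicator K x \<partial>lborel)"
        by (intro nn_integral_mono) (auto simp: indicator_def)
      then show ?thesis using True by simp
    next
      case False
      have e: "emeasure lborel K = ennreal (\<bar>s\<bar> ^ DIM('a)) * (\<integral>\<^sup>+x. indicator K (s *\<^sub>R x) \<partial>(lborel :: 'a measure))"
        using nn_integral_dilation[of "indicator K" s] False by simp
      have "(\<integral>\<^sup>+x. indicator K x * indicator K (s *\<^sub>R x) \<partial>lborel) \<le> (\<integral>\<^sup>+x. indicator K (s *\<^sub>R x) \<partial>(lborel :: 'a measure))"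
        by (intro nn_integral_mono) (auto simp: indicator_def)
      also have "\<dots> = ennreal (1 / \<bar>s\<bar> ^ DIM('a)) * emeasure lborel K"
        unfolding e mult.assoc[symmetric] using False by (simp flip: ennreal_mult)
      finally show ?thesis using False by simp
    qed
  qed
  also have "\<dots> = (\<integral>\<^sup>+s. ennreal (?w s) \<partial>lborel) * emeasure lborel K"
    by (rule nn_integral_multc) measurable
  also have "\<dots> \<le> ennreal (2 * (real DIM('a) / (real DIM('a) - 1))) * emeasure lborel K"
    by (intro mult_right_mono nn_integral_min_power n) simp
  finally show ?thesis .
qed

lemma chord_cball:
  assumes "x \<noteq> 0" "R \<ge> 0"
  shows "chord (cball 0 R) x = ennreal (2 * (R / norm x))"
proof -
  have "s *\<^sub>R x \<in> cball 0 R \<longleftrightarrow> s \<in> {- (R / norm x)..R / norm x}" for s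
    using assms(1) by (simp add: pos_le_divide_eq[symmetric] abs_le_iff minus_le_iff del: pos_le_divide_eq) auto
  then have "chord (cball 0 R) x = (\<integral>\<^sup>+s. indicator {- (R / norm x)..R / norm x} s \<partial>lborel)"
    unfolding chord_def by (intro nn_integral_cong) (simp only: indicator_def)
  then show ?thesis using assms by simp
qed

text \<open>
The chord of a ball in the direction of \<open>x\<close> is a multiple of \<open>1 / norm x\<close>, so this is an instance of
\<open>nn_integral_chord\<close>.
\<close>
lemma inverse_norm_integrable:
  assumes n: "2 \<le> DIM('a::euclidean_space)" and R: "R > 0"
  shows "integrable lborel (\<lambda>x::'a. indicator (cball 0 R) x / norm x)"
proof (rule integrableI_bounded)
  have "(\<integral>\<^sup>+x. ennreal (norm (indicator (cball 0 R) x / norm x :: real)) \<partial>(lborel :: 'a measure))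
      = (\<integral>\<^sup>+x. ennreal (1 / (2 * R)) * (indicator (cball 0 R) x * chord (cball 0 R) x) \<partial>(lborel :: 'a measure))"
  proof (rule nn_integral_cong_AE)
    have "AE x in (lborel :: 'a measure). x \<noteq> 0" by (rule AE_lborel_singleton)
    then show "AE x in (lborel :: 'a measure). ennreal (norm (indicator (cball 0 R) x / norm x :: real))
      = ennreal (1 / (2 * R)) * (indicator (cball 0 R) x * chord (cball 0 R) x)"
    proof eventually_elim
      fix x :: 'a assume "x \<noteq> 0"
      then show "ennreal (norm (indicator (cball 0 R) x / norm x :: real))
          = ennreal (1 / (2 * R)) * (indicator (cball 0 R) x * chord (cball 0 R) x)"
        using R by (auto simp: chord_cball indicator_def simp flip: ennreal_mult)
    qed
  qed
  also have "\<dots> = ennreal (1 / (2 * R)) * (\<integral>\<^sup>+x. indicator (cball 0 R) x * chord (cball 0 R) x \<partial>(lborel :: 'a measure))"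
    by (rule nn_integral_cmult) measurable
  also have "\<dots> \<le> ennreal (1 / (2 * R)) * (ennreal (2 * (real DIM('a) / (real DIM('a) - 1))) * emeasure lborel (cball (0::'a) R))"
    by (intro mult_left_mono nn_integral_chord n) auto
  also have "\<dots> < \<infinity>" using R by (auto simp: ennreal_mult_less_top emeasure_cball)
  finally show "(\<integral>\<^sup>+x. ennreal (norm (indicator (cball 0 R) x / norm x :: real)) \<partial>(lborel :: 'a measure)) < \<infinity>" .
qed measurable

lemma gauss_inverse_norm_integrable:
  assumes n: "2 \<le> DIM('a::euclidean_space)"
  shows "integrable lborel (\<lambda>\<xi>::'a. gauss (norm \<xi>) / norm \<xi>)"
proof (rule Bochner_Integration.integrable_bound)
  \<comment> \<open>the singularity is handled by the first summand, the decay by the second\<close>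
  show "integrable lborel (\<lambda>\<xi>::'a. indicator (cball 0 1) \<xi> / norm \<xi> + gauss (norm \<xi>))"
    by (intro Bochner_Integration.integrable_add gauss_lborel_integrable inverse_norm_integrable n) simp
  have "gauss (norm \<xi>) / norm \<xi> \<le> indicator (cball 0 1) \<xi> / norm \<xi> + gauss (norm \<xi>)" for \<xi> :: 'a
  proof (cases "norm \<xi> \<le> 1")
    case True
    then show ?thesis by (auto simp: indicator_def intro!: add_increasing2 divide_right_mono)
  next
    case False
    then have "gauss (norm \<xi>) / norm \<xi> \<le> gauss (norm \<xi>) / 1"
      by (intro divide_left_mono) auto
    with False show ?thesis by simp
  qed
  then show "AE \<xi>::'a in lborel. norm (gauss (norm \<xi>) / norm \<xi>)
      \<le> norm (indicator (cball 0 1) \<xi> / norm \<xi> + gauss (norm \<xi>))"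
    by (intro AE_I2) (simp add: order_trans[OF _ abs_ge_self])
qed measurable

text \<open>
The same choice of basis as in the Lebesgue measure of the hyperplane orthogonal to \<open>\<xi>\<close>, so that
integrals over that hyperplane become integrals over coordinates. It depends on \<open>\<xi>\<close> only through
the hyperplane, hence is unchanged when \<open>\<xi>\<close> is rescaled.
\<close>
definition onb :: "'a::euclidean_space \<Rightarrow> 'a set" where
  "onb \<xi> = (SOME B. orthonormal_basis B (perp \<xi>))"

lemma orthonormal_onb: "orthonormal_basis (onb \<xi>) (perp \<xi>)"
  unfolding onb_def by (rule someI_ex) (rule orthonormal_basis_exists[OF subspace_perp])

lemma perp_scaleR: "c \<noteq> 0 \<Longrightarrow> perp (c *\<^sub>R \<xi>) = perp \<xi>"
  by (simp add: perp_def)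

lemma onb_scaleR: "c \<noteq> 0 \<Longrightarrow> onb (c *\<^sub>R \<xi>) = onb \<xi>"
  by (simp add: onb_def perp_scaleR)

lemma card_onb:
  assumes "\<xi> \<noteq> (0::'a::euclidean_space)"
  shows "card (onb \<xi>) = DIM('a) - 1"
proof -
  have e: "norm (\<xi> /\<^sub>R norm \<xi>) = 1" using assms by simp
  have "orthonormal_basis (onb \<xi>) (perp (\<xi> /\<^sub>R norm \<xi>))"
    using orthonormal_onb[of \<xi>] assms by (simp add: perp_scaleR)
  note ins = orthonormal_insert[OF this e]
  have "card (insert (\<xi> /\<^sub>R norm \<xi>) (onb \<xi>)) = DIM('a)"
    using ins(2) orthonormal_independent[OF ins(2)] by (metis orthonormal_basis_def dim_UNIV dim_eq_card dim_span)
  then show ?thesis using card_insert_disjoint[OF orthonormal_finite[OF orthonormal_onb] ins(1)] by linarith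
qed

definition central_section :: "('a::euclidean_space \<Rightarrow> real) \<Rightarrow> 'a \<Rightarrow> real" where
  "central_section v \<xi> = (LINT c|coords (onb \<xi>). v (lincomb (onb \<xi>) c))"

definition coord_box :: "'a set \<Rightarrow> real \<Rightarrow> ('a \<Rightarrow> real) set" where
  "coord_box B R = (\<Pi>\<^sub>E b\<in>B. {-R..R})"

lemma coord_box_sets: "finite B \<Longrightarrow> coord_box B R \<in> sets (coords B)"
  unfolding coord_box_def by (intro sets_PiM_I_finite) auto

lemma coord_box_integral:
  assumes B: "finite B" and R: "R \<ge> 0"
  shows "integrable (coords B) (indicator (coord_box B R) :: _ \<Rightarrow> real)"
    and "(LINT c|coords B. indicator (coord_box B R) c) = (2 * R) ^ card B"
proof -
  interpret product_sigma_finite "\<lambda>_::'a. lborel :: real measure"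
    by (rule product_sigma_finite_lborel)
  have e: "emeasure (coords B) (coord_box B R) = ennreal ((2 * R) ^ card B)"
    unfolding coord_box_def using B R by (subst emeasure_PiM) (auto simp: ennreal_power)
  then show "integrable (coords B) (indicator (coord_box B R) :: _ \<Rightarrow> real)"
    using coord_box_sets[OF B] by (intro integrable_real_indicator) auto
  show "(LINT c|coords B. indicator (coord_box B R) c) = (2 * R) ^ card B"
    using coord_box_sets[OF B, of R] sets.sets_into_space[OF coord_box_sets[OF B, of R]] e R
    by (simp add: measure_def Int_absorb2)
qed

section \<open>Hyperplane integrals as limits of integrals over thin slabs\<close>

lemma thick_delta_scaled: "\<delta> > 0 \<Longrightarrow> \<delta> * thick_delta \<delta> (\<delta> * s) = thick_delta 1 s"
  by (simp add: thick_delta_def)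

lemma thick_delta_1: "integrable lborel (thick_delta 1)" "(LINT s|lborel. thick_delta 1 s) = 1"
proof -
  have "thick_delta 1 = (\<lambda>s. (1 / sqrt (2 * pi)) * (gauss (1 * s)))"
    by (simp add: thick_delta_def fun_eq_iff)
  moreover have "integrable lborel (\<lambda>s. (1 / sqrt (2 * pi)) * (gauss (1 * s)))"
    using gauss_scaled(1)[of 1] by (intro integrable_mult_right) simp
  moreover have "(LINT s|lborel. (1 / sqrt (2 * pi)) * (gauss (1 * s))) = 1"
  proof -
    have "(1 / sqrt (2 * pi)) * (sqrt (2 * pi) / 1) = 1" by simp
    then show ?thesis unfolding integral_mult_right_zero gauss_scaled(3)[OF zero_less_one] .
  qed
  ultimately show "integrable lborel (thick_delta 1)" "(LINT s|lborel. thick_delta 1 s) = 1" by (simp_all only:)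
qed

text \<open>
The exponent is minus half the squared distance of \<open>y\<close> from the line through \<open>x\<close>.
\<close>
definition gauss_tube :: "'a::euclidean_space set \<Rightarrow> 'a \<Rightarrow> real" where
  "gauss_tube K x = (LINT y|lborel. indicator K y * exp (- (((norm y)\<^sup>2 - ((y \<bullet> x) / norm x)\<^sup>2) / 2)))"

text \<open>
The assumption \<open>v_cont\<close> makes the integrals of \<open>v\<close> over thin slabs converge to its integrals over
central hyperplanes; boundary points of bodies are the only discontinuities in the application.
\<close>
locale test_density =
  fixes v :: "'a::euclidean_space \<Rightarrow> real" and M R :: real
  assumes v_borel[measurable]: "v \<in> borel_measurable borel"
    and v_bound: "\<And>x. \<bar>v x\<bar> \<le> M" and v_support: "\<And>x. v x \<noteq> 0 \<Longrightarrow> norm x \<le> R"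
    and R_pos: "R > 0" and dim2: "2 \<le> DIM('a)"
    and v_cont: "\<And>\<xi>. \<xi> \<noteq> 0 \<Longrightarrow> AE c in coords (onb \<xi>). isCont v (lincomb (onb \<xi>) c)"
begin

lemma M_nonneg: "0 \<le> M" using v_bound[of 0] by linarith

lemma v_le: "\<bar>v x\<bar> \<le> M * indicator (cball 0 R) x"
  using v_bound[of x] v_support[of x] by (cases "v x = 0") (auto simp: indicator_def M_nonneg)

lemma cball_integrable: "integrable lborel (indicator (cball 0 R) :: 'a \<Rightarrow> real)"
  by (rule body_integrable) simp

lemma v_integrable: "integrable lborel v"
  by (rule Bochner_Integration.integrable_bound[OF integrable_mult_right[OF cball_integrable, of M]])
     (auto intro!: AE_I2 order_trans[OF v_le abs_ge_self])

lemma v_div_norm_integrable: "integrable lborel (\<lambda>x. v x / norm x)"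
proof (rule Bochner_Integration.integrable_bound[OF integrable_mult_right[OF inverse_norm_integrable[OF dim2 R_pos], of M]])
  show "AE x in lborel. norm (v x / norm x) \<le> norm (M * (indicator (cball 0 R) x / norm x))"
  proof (rule AE_I2)
    fix x
    have "\<bar>v x\<bar> / norm x \<le> M * indicator (cball 0 R) x / norm x" by (intro divide_right_mono v_le) simp
    then show "norm (v x / norm x) \<le> norm (M * (indicator (cball 0 R) x / norm x))"
      using M_nonneg by (simp add: abs_mult)
  qed
qed measurable

definition thick_section :: "real \<Rightarrow> 'a \<Rightarrow> real" where
  "thick_section \<delta> \<xi> = (LINT x|lborel. v x * thick_delta \<delta> (x \<bullet> \<xi>))"

lemma thick_section_measurable[measurable]: "thick_section \<delta> \<in> borel_measurable borel"
proof -
  have "(\<lambda>\<xi>. LINT x|lborel. v x * thick_delta \<delta> (x \<bullet> \<xi>)) \<in> borel_measurable borel"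
    by (rule lborel.borel_measurable_lebesgue_integral) (simp add: case_prod_unfold)
  then show ?thesis unfolding thick_section_def[abs_def] .
qed

text \<open>
At height \<open>s\<close> over the hyperplane the slab weight is a function of \<open>norm \<xi> * s\<close> alone. Rescaling the
height by \<open>\<delta> / norm \<xi>\<close> moves \<open>\<delta>\<close> from the weight into the argument of \<open>v\<close>.
\<close>
lemma thick_section_slices:
  assumes \<xi>: "\<xi> \<noteq> 0" and \<delta>: "\<delta> > 0"
  defines "e \<equiv> \<xi> /\<^sub>R norm \<xi>" and "B \<equiv> onb \<xi>"
  shows "norm \<xi> * thick_section \<delta> \<xi>
    = (LINT c|coords B. (LINT s|lborel. v (lincomb B c + ((\<delta> / norm \<xi>) * s) *\<^sub>R e) * thick_delta 1 s))"
proof -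
  have e: "norm e = 1" and \<xi>e: "\<xi> = norm \<xi> *\<^sub>R e" using \<xi> by (auto simp: e_def)
  have B: "orthonormal_basis B (perp e)" using orthonormal_onb[of \<xi>] \<xi> by (simp add: B_def e_def perp_scaleR)
  let ?P = "coords B"
  let ?h = "\<lambda>x. v x * thick_delta \<delta> (x \<bullet> \<xi>)"
  have int: "integrable lborel ?h"
  proof (rule Bochner_Integration.integrable_bound[OF integrable_mult_right[OF v_integrable, of "1 / (sqrt (2 * pi) * \<delta>)"]])
    show "AE x in lborel. norm (?h x) \<le> norm (1 / (sqrt (2 * pi) * \<delta>) * v x)"
    proof (rule AE_I2)
      fix x
      have "\<bar>v x\<bar> * \<bar>thick_delta \<delta> (x \<bullet> \<xi>)\<bar> \<le> \<bar>v x\<bar> * (1 / (sqrt (2 * pi) * \<delta>))"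
        by (intro mult_left_mono thick_delta_bound \<delta>) simp
      then show "norm (?h x) \<le> norm (1 / (sqrt (2 * pi) * \<delta>) * v x)" using \<delta> by (simp add: abs_mult)
    qed
  qed measurable
  have ie: "(lincomb B c + t *\<^sub>R e) \<bullet> \<xi> = norm \<xi> * t" for c t
    using e by (subst \<xi>e) (simp add: inner_add_left lincomb_perp[OF B] norm_eq_1)
  have "thick_section \<delta> \<xi> = (LINT c|?P. (LINT t|lborel. v (lincomb B c + t *\<^sub>R e) * thick_delta \<delta> (norm \<xi> * t)))"
    unfolding thick_section_def lborel_integral_split(1)[OF B e int] ie ..
  also have "\<dots> = (LINT c|?P. (LINT s|lborel. v (lincomb B c + ((\<delta> / norm \<xi>) * s) *\<^sub>R e) * thick_delta 1 s) / norm \<xi>)"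
  proof (rule Bochner_Integration.integral_cong[OF refl])
    fix c
    let ?g = "\<lambda>t. v (lincomb B c + t *\<^sub>R e) * thick_delta \<delta> (norm \<xi> * t)"
    have "(LINT t|lborel. ?g t) = \<bar>\<delta> / norm \<xi>\<bar> *\<^sub>R (LINT s|lborel. ?g (0 + (\<delta> / norm \<xi>) * s))"
      using \<delta> \<xi> by (intro lborel_integral_real_affine) simp
    also have "\<dots> = (LINT s|lborel. (\<delta> / norm \<xi>) * ?g ((\<delta> / norm \<xi>) * s))"
      using \<delta> by simp
    also have "\<dots> = (LINT s|lborel. (v (lincomb B c + ((\<delta> / norm \<xi>) * s) *\<^sub>R e) * thick_delta 1 s) / norm \<xi>)"
    proof (rule Bochner_Integration.integral_cong[OF refl])
      fix s
      have "norm \<xi> * ((\<delta> / norm \<xi>) * s) = \<delta> * s" using \<xi> by simp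
      then show "(\<delta> / norm \<xi>) * ?g ((\<delta> / norm \<xi>) * s)
        = v (lincomb B c + ((\<delta> / norm \<xi>) * s) *\<^sub>R e) * thick_delta 1 s / norm \<xi>"
        by (simp only: thick_delta_scaled[OF \<delta>, of s, symmetric]) (simp add: mult_ac)
    qed
    finally show "(LINT t|lborel. ?g t) = (LINT s|lborel. v (lincomb B c + ((\<delta> / norm \<xi>) * s) *\<^sub>R e) * thick_delta 1 s) / norm \<xi>"
      by simp
  qed
  finally show ?thesis using \<xi> by simp
qed

lemma slice_bound:
  fixes c :: "'a \<Rightarrow> real"
  assumes \<xi>: "\<xi> \<noteq> 0" and c: "c \<in> extensional (onb \<xi>)"
  shows "\<bar>v (lincomb (onb \<xi>) c + t *\<^sub>R (\<xi> /\<^sub>R norm \<xi>))\<bar> \<le> M * indicator (coord_box (onb \<xi>) R) c"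
proof (cases "v (lincomb (onb \<xi>) c + t *\<^sub>R (\<xi> /\<^sub>R norm \<xi>)) = 0")
  case False
  have e: "norm (\<xi> /\<^sub>R norm \<xi>) = 1" using \<xi> by simp
  have B: "orthonormal_basis (onb \<xi>) (perp (\<xi> /\<^sub>R norm \<xi>))" using orthonormal_onb[of \<xi>] \<xi> by (simp add: perp_scaleR)
  have "\<bar>c b\<bar> \<le> R" if "b \<in> onb \<xi>" for b
    using coords_bound(3)[OF B e _ that, of c t R] v_support[OF False] by simp
  then have "c \<in> coord_box (onb \<xi>) R" using c by (auto simp: coord_box_def PiE_def abs_le_iff minus_le_iff)
  then show ?thesis using v_bound by simp
qed (simp add: M_nonneg)

lemma slice_weight_bound:
  assumes \<xi>: "\<xi> \<noteq> 0" and c: "c \<in> extensional (onb \<xi>)"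
  shows "\<bar>LINT s|lborel. v (lincomb (onb \<xi>) c + (\<tau> * s) *\<^sub>R (\<xi> /\<^sub>R norm \<xi>)) * thick_delta 1 s\<bar>
    \<le> M * indicator (coord_box (onb \<xi>) R) c"
proof -
  let ?m = "M * indicator (coord_box (onb \<xi>) R) c"
  let ?f = "\<lambda>s. v (lincomb (onb \<xi>) c + (\<tau> * s) *\<^sub>R (\<xi> /\<^sub>R norm \<xi>)) * thick_delta 1 s"
  have le: "\<bar>?f s\<bar> \<le> ?m * thick_delta 1 s" for s
    unfolding abs_mult using slice_bound[OF \<xi> c, of "\<tau> * s"] thick_delta_nonneg[of 1 s]
    by (auto intro: mult_right_mono)
  have i: "integrable lborel (\<lambda>s. ?m * thick_delta 1 s)" by (intro integrable_mult_right thick_delta_1(1))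
  have i2: "integrable lborel ?f"
    by (rule Bochner_Integration.integrable_bound[OF i]) (auto intro!: AE_I2 order_trans[OF le abs_ge_self] simp del: scaleR_scaleR)
  have "\<bar>LINT s|lborel. ?f s\<bar> \<le> (LINT s|lborel. \<bar>?f s\<bar>)" by (rule integral_abs_bound)
  also have "\<dots> \<le> (LINT s|lborel. ?m * thick_delta 1 s)" by (intro integral_mono integrable_abs i i2 le)
  also have "\<dots> = ?m" by (simp add: thick_delta_1)
  finally show ?thesis .
qed

lemma thick_section_bound:
  assumes \<xi>: "\<xi> \<noteq> 0" and \<delta>: "\<delta> > 0"
  shows "\<bar>thick_section \<delta> \<xi>\<bar> \<le> M * (2 * R) ^ (DIM('a) - 1) / norm \<xi>"
proof -
  let ?B = "onb \<xi>"
  let ?P = "coords ?B"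
  let ?f = "\<lambda>c. LINT s|lborel. v (lincomb ?B c + ((\<delta> / norm \<xi>) * s) *\<^sub>R (\<xi> /\<^sub>R norm \<xi>)) * thick_delta 1 s"
  have fin: "finite ?B" using orthonormal_onb by (rule orthonormal_finite)
  note box = coord_box_integral[OF fin less_imp_le[OF R_pos]]
  have i: "integrable ?P (\<lambda>c. M * indicator (coord_box ?B R) c)" by (intro integrable_mult_right box(1))
  have m: "?f \<in> borel_measurable ?P"
    by (rule lborel.borel_measurable_lebesgue_integral) (simp add: case_prod_unfold)
  have le: "\<bar>?f c\<bar> \<le> M * indicator (coord_box ?B R) c" if "c \<in> space ?P" for c
    using that by (intro slice_weight_bound \<xi>) (auto simp: space_PiM PiE_def)
  have i2: "integrable ?P ?f"
    by (rule Bochner_Integration.integrable_bound[OF i m], rule AE_I2, unfold real_norm_def)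
       (rule order_trans[OF le abs_ge_self])
  have "\<bar>norm \<xi> * thick_section \<delta> \<xi>\<bar> \<le> (LINT c|?P. \<bar>?f c\<bar>)"
    unfolding thick_section_slices[OF \<xi> \<delta>] by (rule integral_abs_bound)
  also have "\<dots> \<le> (LINT c|?P. M * indicator (coord_box ?B R) c)"
    by (intro integral_mono integrable_abs i i2 le)
  also have "\<dots> = M * (2 * R) ^ (DIM('a) - 1)" by (simp only: integral_mult_right_zero box(2) card_onb[OF \<xi>])
  finally show ?thesis using \<xi> by (simp add: abs_mult pos_le_divide_eq mult.commute)
qed

text \<open>
The factor \<open>1 / norm \<xi>\<close> is the Jacobian between \<open>x \<bullet> \<xi>\<close> and the height of \<open>x\<close> over the hyperplane.
\<close>
lemma thick_section_tendsto:
  assumes \<xi>: "\<xi> \<noteq> 0"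
  shows "(\<lambda>k. thick_section (1 / real (Suc k)) \<xi>) \<longlonglongrightarrow> central_section v \<xi> / norm \<xi>"
proof -
  let ?B = "onb \<xi>" and ?e = "\<xi> /\<^sub>R norm \<xi>"
  let ?P = "coords ?B"
  let ?\<tau> = "\<lambda>k. (1 / real (Suc k)) / norm \<xi>"
  let ?f = "\<lambda>k c. LINT s|lborel. v (lincomb ?B c + (?\<tau> k * s) *\<^sub>R ?e) * thick_delta 1 s"
  have fin: "finite ?B" using orthonormal_onb by (rule orthonormal_finite)
  note box = coord_box_integral[OF fin less_imp_le[OF R_pos]]
  have \<tau>: "?\<tau> \<longlonglongrightarrow> 0"
    using tendsto_divide[OF LIMSEQ_Suc[OF lim_1_over_n] tendsto_const[of "norm \<xi>"]] \<xi> by simp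
  have "(\<lambda>k. LINT c|?P. ?f k c) \<longlonglongrightarrow> (LINT c|?P. v (lincomb ?B c))"
  proof (rule integral_dominated_convergence[where w="\<lambda>c. M * indicator (coord_box ?B R) c"])
    show "(\<lambda>c. v (lincomb ?B c)) \<in> borel_measurable ?P" by measurable
    show "?f k \<in> borel_measurable ?P" for k
      by (rule lborel.borel_measurable_lebesgue_integral) (simp add: case_prod_unfold)
    show "integrable ?P (\<lambda>c. M * indicator (coord_box ?B R) c)" by (intro integrable_mult_right box(1))
    show "AE c in ?P. norm (?f k c) \<le> M * indicator (coord_box ?B R) c" for k
      unfolding real_norm_def by (rule AE_I2, rule slice_weight_bound[OF \<xi>]) (auto simp: space_PiM PiE_def)
    show "AE c in ?P. (\<lambda>k. ?f k c) \<longlonglongrightarrow> v (lincomb ?B c)"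
      using v_cont[OF \<xi>]
    proof eventually_elim
      fix c assume cont: "isCont v (lincomb ?B c)"
      have "(\<lambda>k. ?f k c) \<longlonglongrightarrow> (LINT s|lborel. v (lincomb ?B c) * thick_delta 1 s)"
      proof (rule integral_dominated_convergence[where w="\<lambda>s. M * thick_delta 1 s"])
        show "integrable lborel (\<lambda>s. M * thick_delta 1 s)" by (intro integrable_mult_right thick_delta_1(1))
        show "AE s in lborel. norm (v (lincomb ?B c + (?\<tau> k * s) *\<^sub>R ?e) * thick_delta 1 s) \<le> M * thick_delta 1 s" for k
          using v_bound thick_delta_nonneg[of 1] by (intro AE_I2) (auto simp: abs_mult M_nonneg intro!: mult_mono)
        show "AE s in lborel. (\<lambda>k. v (lincomb ?B c + (?\<tau> k * s) *\<^sub>R ?e) * thick_delta 1 s)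
            \<longlonglongrightarrow> v (lincomb ?B c) * thick_delta 1 s"
        proof (rule AE_I2)
          fix s :: real
          have "(\<lambda>k. lincomb ?B c + (?\<tau> k * s) *\<^sub>R ?e) \<longlonglongrightarrow> lincomb ?B c + (0 * s) *\<^sub>R ?e"
            by (intro tendsto_intros \<tau>)
          then have "(\<lambda>k. lincomb ?B c + (?\<tau> k * s) *\<^sub>R ?e) \<longlonglongrightarrow> lincomb ?B c" by simp
          then show "(\<lambda>k. v (lincomb ?B c + (?\<tau> k * s) *\<^sub>R ?e) * thick_delta 1 s)
            \<longlonglongrightarrow> v (lincomb ?B c) * thick_delta 1 s"
            by (intro tendsto_mult tendsto_const isCont_tendsto_compose[OF cont])
        qed
      qed measurable
      then show "(\<lambda>k. ?f k c) \<longlonglongrightarrow> v (lincomb ?B c)" by (simp add: thick_delta_1)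
    qed
  qed
  then have "(\<lambda>k. norm \<xi> * thick_section (1 / real (Suc k)) \<xi>) \<longlonglongrightarrow> central_section v \<xi>"
    by (simp add: thick_section_slices[OF \<xi>] central_section_def)
  from tendsto_divide[OF this tendsto_const[of "norm \<xi>"]] show ?thesis using \<xi> by simp
qed


context
  fixes K :: "'a set"
  assumes cpt: "compact K"
begin

text \<open>
For positive \<open>\<delta>\<close> everything converges absolutely, so the integrals over \<open>\<xi>\<close>, \<open>x\<close> and \<open>y \<in> K\<close>
may be taken in any order.
\<close>
lemma thick_section_swap:
  assumes \<delta>: "\<delta> > 0"
  shows "(LINT \<xi>|lborel. gauss (norm \<xi>) * body_cos K \<xi> * thick_section \<delta> \<xi>)
    = (LINT x|lborel. v x * (LINT y|lborel. indicator K y *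
        (LINT \<xi>|lborel. gauss (norm \<xi>) * thick_delta \<delta> (x \<bullet> \<xi>) * cos (y \<bullet> \<xi>))))"
proof -
  note [measurable] = body_cos_measurable[OF cpt] body_borel[OF cpt]
  let ?c = "1 / (sqrt (2 * pi) * \<delta>)"
  have sf: "sigma_finite_measure (lborel :: 'a measure)" by (rule sigma_finite_lborel)
  have c0: "0 \<le> ?c" using \<delta> by simp
  note td = thick_delta_bound[OF \<delta>]
  have "(LINT \<xi>|lborel. gauss (norm \<xi>) * body_cos K \<xi> * thick_section \<delta> \<xi>)
      = (LINT \<xi>|lborel. LINT x|lborel. gauss (norm \<xi>) * body_cos K \<xi> * (v x * thick_delta \<delta> (x \<bullet> \<xi>)))"
    unfolding thick_section_def by simp
  also have "\<dots> = (LINT x|lborel. LINT \<xi>|lborel. gauss (norm \<xi>) * body_cos K \<xi> * (v x * thick_delta \<delta> (x \<bullet> \<xi>)))"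
  proof (rule Fubini_dominated[OF sf sf])
    show "integrable lborel (\<lambda>\<xi>::'a. gauss (norm \<xi>) * (measure lborel K * ?c))"
      by (intro integrable_mult_left gauss_lborel_integrable)
    show "integrable lborel (\<lambda>x. \<bar>v x\<bar>)" by (intro integrable_abs v_integrable)
    fix \<xi> x :: 'a
    have "\<bar>gauss (norm \<xi>) * body_cos K \<xi> * (v x * thick_delta \<delta> (x \<bullet> \<xi>))\<bar>
        = gauss (norm \<xi>) * (\<bar>body_cos K \<xi>\<bar> * \<bar>thick_delta \<delta> (x \<bullet> \<xi>)\<bar>) * \<bar>v x\<bar>" by (simp add: abs_mult)
    also have "\<dots> \<le> gauss (norm \<xi>) * (measure lborel K * ?c) * \<bar>v x\<bar>"
      by (intro mult_right_mono mult_left_mono mult_mono body_cos_bound[OF cpt] td) auto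
    finally show "\<bar>gauss (norm \<xi>) * body_cos K \<xi> * (v x * thick_delta \<delta> (x \<bullet> \<xi>))\<bar> \<le> gauss (norm \<xi>) * (measure lborel K * ?c) * \<bar>v x\<bar>" .
  qed measurable
  also have "\<dots> = (LINT x|lborel. v x * (LINT \<xi>|lborel. gauss (norm \<xi>) * body_cos K \<xi> * thick_delta \<delta> (x \<bullet> \<xi>)))"
    by (simp only: integral_mult_right_zero[symmetric] mult_ac)
  also have "\<dots> = (LINT x|lborel. v x * (LINT y|lborel. indicator K y *
        (LINT \<xi>|lborel. gauss (norm \<xi>) * thick_delta \<delta> (x \<bullet> \<xi>) * cos (y \<bullet> \<xi>))))"
  proof (rule Bochner_Integration.integral_cong[OF refl], rule arg_cong2[where f="(*)", OF refl])
    fix x :: 'a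
    have "(LINT \<xi>|lborel. gauss (norm \<xi>) * body_cos K \<xi> * thick_delta \<delta> (x \<bullet> \<xi>))
        = (LINT \<xi>|lborel. LINT y|lborel. gauss (norm \<xi>) * thick_delta \<delta> (x \<bullet> \<xi>) * (indicator K y * cos (y \<bullet> \<xi>)))"
      unfolding body_cos_def integral_mult_right_zero by (simp only: mult_ac)
    also have "\<dots> = (LINT y|lborel. LINT \<xi>|lborel. gauss (norm \<xi>) * thick_delta \<delta> (x \<bullet> \<xi>) * (indicator K y * cos (y \<bullet> \<xi>)))"
    proof (rule Fubini_dominated[OF sf sf _ body_integrable[OF cpt]])
      show "integrable lborel (\<lambda>\<xi>::'a. gauss (norm \<xi>) * ?c)" by (intro integrable_mult_left gauss_lborel_integrable)
      fix \<xi> y :: 'a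
      have "\<bar>gauss (norm \<xi>) * thick_delta \<delta> (x \<bullet> \<xi>) * (indicator K y * cos (y \<bullet> \<xi>))\<bar>
          = gauss (norm \<xi>) * \<bar>thick_delta \<delta> (x \<bullet> \<xi>)\<bar> * (indicator K y * \<bar>cos (y \<bullet> \<xi>)\<bar>)" by (simp add: abs_mult)
      also have "\<dots> \<le> gauss (norm \<xi>) * ?c * (indicator K y * 1)"
        using c0 by (intro mult_mono mult_left_mono td) auto
      finally show "\<bar>gauss (norm \<xi>) * thick_delta \<delta> (x \<bullet> \<xi>) * (indicator K y * cos (y \<bullet> \<xi>))\<bar> \<le> gauss (norm \<xi>) * ?c * indicator K y"
        by simp
    qed measurable
    also have "\<dots> = (LINT y|lborel. indicator K y * (LINT \<xi>|lborel. gauss (norm \<xi>) * thick_delta \<delta> (x \<bullet> \<xi>) * cos (y \<bullet> \<xi>)))"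
      by (simp only: integral_mult_right_zero[symmetric] mult_ac)
    finally show "(LINT \<xi>|lborel. gauss (norm \<xi>) * body_cos K \<xi> * thick_delta \<delta> (x \<bullet> \<xi>))
      = (LINT y|lborel. indicator K y * (LINT \<xi>|lborel. gauss (norm \<xi>) * thick_delta \<delta> (x \<bullet> \<xi>) * cos (y \<bullet> \<xi>)))" .
  qed
  finally show ?thesis .
qed

text \<open>
The inner integrals are explicit by \<open>gauss_thick_hyperplane\<close> and bounded by a multiple of
\<open>1 / norm x\<close> uniformly in \<open>\<delta>\<close>. That bound is integrable near the origin because the dimension is at
least 2.
\<close>
lemma tube_limit:
  "(\<lambda>k. LINT x|lborel. v x * (LINT y|lborel. indicator K y *
      (LINT \<xi>|lborel. gauss (norm \<xi>) * thick_delta (1 / real (Suc k)) (x \<bullet> \<xi>) * cos (y \<bullet> \<xi>))))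
    \<longlonglongrightarrow> (LINT x|lborel. v x * (sqrt (2 * pi) ^ (DIM('a) - 1) / norm x * gauss_tube K x))"
proof -
  note [measurable] = body_borel[OF cpt]
  let ?\<delta> = "\<lambda>k. 1 / real (Suc k)" and ?C = "sqrt (2 * pi) ^ (DIM('a) - 1)"
  let ?t = "\<lambda>x y. exp (- (((norm y)\<^sup>2 - ((y \<bullet> x) / norm x)\<^sup>2) / 2))"
  let ?u = "\<lambda>k x y. exp (- (((y \<bullet> x) / norm x)\<^sup>2 * (?\<delta> k)\<^sup>2 / (2 * ((?\<delta> k)\<^sup>2 + (norm x)\<^sup>2)))) / sqrt ((?\<delta> k)\<^sup>2 + (norm x)\<^sup>2)"
  have \<delta>: "?\<delta> \<longlonglongrightarrow> 0" using LIMSEQ_Suc[OF lim_1_over_n] by simp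
  define I where "I k x = (LINT y|lborel. indicator K y * (LINT \<xi>|lborel. gauss (norm \<xi>) * thick_delta (?\<delta> k) (x \<bullet> \<xi>) * cos (y \<bullet> \<xi>)))" for k x
  have I: "I k x = (LINT y|lborel. indicator K y * (?C * ?t x y * ?u k x y))" if "x \<noteq> 0" for k x
    unfolding I_def by (subst gauss_thick_hyperplane[OF that]) simp_all
  have t1: "?t x y \<le> 1" for x y :: 'a
  proof -
    have "\<bar>(y \<bullet> x) / norm x\<bar> \<le> norm y"
      using Cauchy_Schwarz_ineq2[of y x] by (cases "x = 0") (auto simp: pos_divide_le_eq abs_divide)
    then have "((y \<bullet> x) / norm x)\<^sup>2 \<le> (norm y)\<^sup>2" by (rule abs_le_square_iff[THEN iffD1, OF order_trans]) simp
    then show ?thesis by simp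
  qed
  have u1: "?u k x y \<le> 1 / norm x" if "x \<noteq> 0" for k and x y :: 'a
  proof (rule frac_le)
    show "norm x \<le> sqrt ((?\<delta> k)\<^sup>2 + (norm x)\<^sup>2)" by (rule real_le_rsqrt) simp
  qed (use that in auto)
  have bd: "\<bar>indicator K y * (?C * ?t x y * ?u k x y)\<bar> \<le> (?C / norm x) * indicator K y" if "x \<noteq> 0" for k and x y :: 'a
  proof -
    have "?C * ?t x y * ?u k x y \<le> ?C * 1 * (1 / norm x)"
      by (intro mult_mono t1 u1 that) auto
    then show ?thesis by (auto simp: indicator_def)
  qed
  have iK: "integrable lborel (\<lambda>y. (?C / norm x) * indicator K y)" for x
    by (intro integrable_mult_right body_integrable[OF cpt])
  have m[measurable]: "I k \<in> borel_measurable borel" for k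
  proof -
    have "(\<lambda>p. LINT \<xi>|lborel. gauss (norm \<xi>) * thick_delta (?\<delta> k) (fst p \<bullet> \<xi>) * cos (snd p \<bullet> \<xi>)) \<in> borel_measurable (borel \<Otimes>\<^sub>M borel)"
      by (rule lborel.borel_measurable_lebesgue_integral) (simp add: case_prod_unfold)
    then have "(\<lambda>p. indicator K (snd p) * (LINT \<xi>|lborel. gauss (norm \<xi>) * thick_delta (?\<delta> k) (fst p \<bullet> \<xi>) * cos (snd p \<bullet> \<xi>))) \<in> borel_measurable (borel \<Otimes>\<^sub>M lborel)"
      by measurable
    then show ?thesis unfolding I_def[abs_def]
      by (intro lborel.borel_measurable_lebesgue_integral) (simp add: case_prod_unfold)
  qed
  have Ibd: "\<bar>I k x\<bar> \<le> ?C / norm x * measure lborel K" if x: "x \<noteq> 0" for k x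
  proof -
    have "\<bar>I k x\<bar> \<le> (LINT y|lborel. \<bar>indicator K y * (?C * ?t x y * ?u k x y)\<bar>)"
      unfolding I[OF x] by (rule integral_abs_bound)
    also have "\<dots> \<le> (LINT y|lborel. (?C / norm x) * indicator K y)"
      by (intro integral_mono' iK bd x) auto
    finally show ?thesis by simp
  qed
  have Ilim: "(\<lambda>k. I k x) \<longlonglongrightarrow> ?C / norm x * gauss_tube K x" if x: "x \<noteq> 0" for x
  proof -
    have "(\<lambda>k. LINT y|lborel. indicator K y * (?C * ?t x y * ?u k x y)) \<longlonglongrightarrow> (LINT y|lborel. indicator K y * (?C * ?t x y * (1 / norm x)))"
    proof (rule integral_dominated_convergence[OF _ _ iK[of x]])
      show "AE y in lborel. norm (indicator K y * (?C * ?t x y * ?u k x y)) \<le> ?C / norm x * indicator K y" for k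
        unfolding real_norm_def by (intro AE_I2 bd x)
      show "AE y in lborel. (\<lambda>k. indicator K y * (?C * ?t x y * ?u k x y)) \<longlonglongrightarrow> indicator K y * (?C * ?t x y * (1 / norm x))"
      proof (rule AE_I2)
        fix y :: 'a
        have n: "2 * (0\<^sup>2 + (norm x)\<^sup>2) \<noteq> 0" "sqrt (0\<^sup>2 + (norm x)\<^sup>2) \<noteq> 0" using x by auto
        have "(\<lambda>k. ?u k x y) \<longlonglongrightarrow> exp (- (((y \<bullet> x) / norm x)\<^sup>2 * 0\<^sup>2 / (2 * (0\<^sup>2 + (norm x)\<^sup>2)))) / sqrt (0\<^sup>2 + (norm x)\<^sup>2)"
          by (rule tendsto_divide[OF tendsto_exp[OF tendsto_minus[OF tendsto_divide[OF _ _ n(1)]]] _ n(2)]) (intro tendsto_intros \<delta>)+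
        then have "(\<lambda>k. ?u k x y) \<longlonglongrightarrow> 1 / norm x" by simp
        then show "(\<lambda>k. indicator K y * (?C * ?t x y * ?u k x y)) \<longlonglongrightarrow> indicator K y * (?C * ?t x y * (1 / norm x))"
          by (intro tendsto_mult tendsto_const)
      qed
    qed measurable
    also have "(LINT y|lborel. indicator K y * (?C * ?t x y * (1 / norm x))) = ?C / norm x * gauss_tube K x"
      unfolding gauss_tube_def by (subst integral_mult_right_zero[symmetric]) (simp add: mult_ac)
    finally show ?thesis unfolding I[OF x] .
  qed
  have ae0: "AE x::'a in lborel. x \<noteq> 0" by (rule AE_lborel_singleton)
  have "(\<lambda>k. LINT x|lborel. v x * I k x) \<longlonglongrightarrow> (LINT x|lborel. v x * (?C / norm x * gauss_tube K x))"
  proof (rule integral_dominated_convergence[where w="\<lambda>x. (?C * measure lborel K) * \<bar>v x / norm x\<bar>"])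
    show "integrable lborel (\<lambda>x. (?C * measure lborel K) * \<bar>v x / norm x\<bar>)"
      by (intro integrable_mult_right integrable_abs v_div_norm_integrable)
    show "AE x in lborel. norm (v x * I k x) \<le> (?C * measure lborel K) * \<bar>v x / norm x\<bar>" for k
      using ae0
    proof eventually_elim
      fix x :: 'a assume x: "x \<noteq> 0"
      have "\<bar>v x\<bar> * \<bar>I k x\<bar> \<le> \<bar>v x\<bar> * (?C / norm x * measure lborel K)"
        by (intro mult_left_mono Ibd x) simp
      then show "norm (v x * I k x) \<le> (?C * measure lborel K) * \<bar>v x / norm x\<bar>"
        by (simp add: abs_mult mult_ac)
    qed
    show "AE x in lborel. (\<lambda>k. v x * I k x) \<longlonglongrightarrow> v x * (?C / norm x * gauss_tube K x)"
      using ae0 by eventually_elim (intro tendsto_mult tendsto_const Ilim)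
    have "gauss_tube K \<in> borel_measurable borel"
      unfolding gauss_tube_def[abs_def] by (rule lborel.borel_measurable_lebesgue_integral) (simp add: case_prod_unfold)
    then show "(\<lambda>x. v x * (?C / norm x * gauss_tube K x)) \<in> borel_measurable lborel" by measurable
  qed measurable
  then show ?thesis unfolding I_def .
qed

end

end

section \<open>Polar coordinates and the sign of the tube integral\<close>

lemma lborel_integral_dilation:
  fixes g :: "'a::euclidean_space \<Rightarrow> real"
  assumes c: "c \<noteq> 0" and [measurable]: "g \<in> borel_measurable borel"
  shows "(LINT x|lborel. g x) = \<bar>c\<bar> ^ DIM('a) * (LINT x|lborel. g (c *\<^sub>R x))"
    and "integrable lborel (\<lambda>x. g (c *\<^sub>R x)) \<longleftrightarrow> integrable lborel g"
proof -
  have T: "(\<lambda>x. 0 + c *\<^sub>R x) \<in> lborel \<rightarrow>\<^sub>M (borel :: 'a measure)" by measurable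
  show "(LINT x|lborel. g x) = \<bar>c\<bar> ^ DIM('a) * (LINT x|lborel. g (c *\<^sub>R x))"
    by (subst lborel_affine[OF c, of 0]) (simp add: integral_density integral_distr)
  show "integrable lborel (\<lambda>x. g (c *\<^sub>R x)) \<longleftrightarrow> integrable lborel g"
  proof -
    have "integrable lborel g \<longleftrightarrow> integrable (density (distr lborel borel (\<lambda>x. 0 + c *\<^sub>R x)) (\<lambda>_. ennreal (\<bar>c\<bar> ^ DIM('a)))) g"
      using lborel_affine[OF c, of "0::'a"] by simp
    also have "\<dots> \<longleftrightarrow> integrable lborel (\<lambda>x. \<bar>c\<bar> ^ DIM('a) *\<^sub>R g (c *\<^sub>R x))"
      by (subst integrable_density, simp, simp, simp, subst integrable_distr_eq) auto
    also have "\<dots> \<longleftrightarrow> integrable lborel (\<lambda>x. g (c *\<^sub>R x))" using c by simp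
    finally show ?thesis by simp
  qed
qed

text \<open>
For nonzero \<open>s\<close> the condition says that \<open>a / \<bar>s\<bar>\<close> lies between 1 and 2. The density \<open>1 / \<bar>s\<bar>\<close> is that
of the invariant measure of the multiplicative group, so the total mass is independent of \<open>a\<close>.
\<close>
definition ring_kernel :: "real \<Rightarrow> real \<Rightarrow> real" where
  "ring_kernel a s = indicator {a / 2..a} \<bar>s\<bar> / \<bar>s\<bar>"

lemma ring_kernel_measurable[measurable]:
  "(\<lambda>p. ring_kernel (fst p) (snd p)) \<in> borel_measurable (borel \<Otimes>\<^sub>M borel)"
proof -
  have "(\<lambda>p. ring_kernel (fst p) (snd p)) = (\<lambda>p. (if fst p / 2 \<le> \<bar>snd p\<bar> \<and> \<bar>snd p\<bar> \<le> fst p then 1 else 0) / \<bar>snd p\<bar>)"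
    by (auto simp: ring_kernel_def indicator_def fun_eq_iff)
  then show ?thesis by simp
qed

lemma ring_kernel_measurable'[measurable (raw)]:
  assumes "f \<in> borel_measurable M" "g \<in> borel_measurable M"
  shows "(\<lambda>x. ring_kernel (f x) (g x)) \<in> borel_measurable M"
  using measurable_compose[OF measurable_Pair[OF assms] ring_kernel_measurable] by simp

definition "ring_mass = (LINT s|lborel. ring_kernel 1 s)"

lemma ring_kernel_integrable_1: "integrable lborel (ring_kernel 1)"
proof (rule Bochner_Integration.integrable_bound[where f="\<lambda>s. 2 * indicator {-1..1} s :: real"])
  show "AE s in lborel. norm (ring_kernel 1 s) \<le> norm (2 * indicator {- 1..1} s :: real)"
    by (rule AE_I2) (auto simp: ring_kernel_def indicator_def abs_le_iff divide_simps)
qed (auto intro!: integrable_mult_right integrable_real_indicator)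

lemma ring_mass_pos: "0 < ring_mass"
proof -
  have "(LINT s|lborel. indicator {1/2..1::real} s :: real) \<le> ring_mass"
    unfolding ring_mass_def
    by (intro integral_mono ring_kernel_integrable_1 body_integrable compact_Icc)
       (auto simp: ring_kernel_def indicator_def divide_simps)
  then show ?thesis by simp
qed

lemma ring_kernel_integral:
  assumes a: "a > 0"
  shows "integrable lborel (ring_kernel a)" "(LINT s|lborel. ring_kernel a s) = ring_mass"
proof -
  have sc: "ring_kernel a (0 + a * s) = ring_kernel 1 s / a" for s
  proof -
    have "\<bar>a * s\<bar> = a * \<bar>s\<bar>" using a by (simp add: abs_mult)
    moreover have "a * \<bar>s\<bar> \<in> {a / 2..a} \<longleftrightarrow> \<bar>s\<bar> \<in> {1/2..1}"
      using a mult_le_cancel_left_pos[of a "1/2" "\<bar>s\<bar>"] mult_le_cancel_left_pos[of a "\<bar>s\<bar>" 1] by simp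
    ultimately show ?thesis by (simp add: ring_kernel_def indicator_def)
  qed
  have "integrable lborel (\<lambda>s. ring_kernel a (0 + a * s))"
    unfolding sc using ring_kernel_integrable_1 by simp
  then show "integrable lborel (ring_kernel a)"
    using lborel_integrable_real_affine_iff[of a "ring_kernel a" 0] a by simp
  have "(LINT s|lborel. ring_kernel a s) = \<bar>a\<bar> *\<^sub>R (LINT s|lborel. ring_kernel a (0 + a * s))"
    using a by (intro lborel_integral_real_affine) simp
  then show "(LINT s|lborel. ring_kernel a s) = ring_mass"
    unfolding sc ring_mass_def using a by simp
qed

text \<open>
A substitute for polar coordinates. Multiplying \<open>h \<xi>\<close> by \<open>\<integral> ring_kernel (norm \<xi>) s ds\<close>, which is a
positive constant, and substituting \<open>\<xi> = s *\<^sub>R \<zeta>\<close>, one obtains the integral over the ring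
\<open>1 \<le> norm \<zeta> \<le> 2\<close> of the radial integrals of \<open>h\<close>.
\<close>
lemma integral_nonpos_radially:
  fixes h :: "'a::euclidean_space \<Rightarrow> real"
  assumes int: "integrable lborel h"
    and rad: "\<And>\<zeta>. \<zeta> \<noteq> 0 \<Longrightarrow> (LINT s|lborel. \<bar>s\<bar> ^ (DIM('a) - 1) * h (s *\<^sub>R \<zeta>)) \<le> 0"
  shows "(LINT \<xi>|lborel. h \<xi>) \<le> 0"
proof -
  have [measurable]: "h \<in> borel_measurable borel" using int by auto
  have ae0: "AE x::'a in lborel. x \<noteq> 0" by (rule AE_lborel_singleton)
  let ?F = "\<lambda>\<xi> s. h \<xi> * ring_kernel (norm \<xi>) s"
  have i1: "integrable (lborel \<Otimes>\<^sub>M lborel) (\<lambda>(\<xi>, s). ?F \<xi> s)"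
  proof (rule lborel_pair.Fubini_integrable)
    have rk: "0 \<le> ring_kernel a s" for a s by (simp add: ring_kernel_def)
    have "AE \<xi> in lborel. (LINT s|lborel. norm (?F \<xi> s)) = \<bar>h \<xi>\<bar> * ring_mass"
      using ae0 by eventually_elim (simp add: abs_mult rk ring_kernel_integral)
    moreover have "integrable lborel (\<lambda>\<xi>. \<bar>h \<xi>\<bar> * ring_mass)" using int by simp
    ultimately show "integrable lborel (\<lambda>\<xi>. LINT s|lborel. norm (case (\<xi>, s) of (\<xi>, s) \<Rightarrow> ?F \<xi> s))"
      by (subst integrable_cong_AE[where g="\<lambda>\<xi>. \<bar>h \<xi>\<bar> * ring_mass"]) auto
    show "AE \<xi> in lborel. integrable lborel (\<lambda>s. case (\<xi>, s) of (\<xi>, s) \<Rightarrow> ?F \<xi> s)"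
      using ae0 by eventually_elim (auto intro!: integrable_mult_right ring_kernel_integral)
  qed measurable
  let ?W = "\<lambda>\<zeta>::'a. indicator {1..2} (norm \<zeta>) :: real"
  let ?G = "\<lambda>s \<zeta>. ?W \<zeta> * (\<bar>s\<bar> ^ (DIM('a) - 1) * h (s *\<^sub>R \<zeta>))"
  have FG: "?F (s *\<^sub>R \<zeta>) s * \<bar>s\<bar> ^ DIM('a) = ?G s \<zeta>" if "s \<noteq> 0" for s \<zeta>
  proof -
    have "norm (s *\<^sub>R \<zeta>) / 2 \<le> \<bar>s\<bar> \<longleftrightarrow> norm \<zeta> \<le> 2" "\<bar>s\<bar> \<le> norm (s *\<^sub>R \<zeta>) \<longleftrightarrow> 1 \<le> norm \<zeta>"
      using that mult_le_cancel_left_pos[of "\<bar>s\<bar>" "norm \<zeta>" 2] mult_le_cancel_left_pos[of "\<bar>s\<bar>" 1 "norm \<zeta>"]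
      by (simp_all add: mult.commute)
    then have "ring_kernel (norm (s *\<^sub>R \<zeta>)) s = ?W \<zeta> / \<bar>s\<bar>"
      by (auto simp: ring_kernel_def indicator_def)
    moreover have "\<bar>s\<bar> ^ DIM('a) = \<bar>s\<bar> * \<bar>s\<bar> ^ (DIM('a) - 1)" by (metis DIM_positive power_minus_mult mult.commute)
    ultimately show ?thesis using that by simp
  qed
  have G: "(LINT \<zeta>|lborel. ?G s \<zeta>) = (LINT \<xi>|lborel. ?F \<xi> s)"
    and Gabs: "(LINT \<zeta>|lborel. \<bar>?G s \<zeta>\<bar>) = (LINT \<xi>|lborel. \<bar>?F \<xi> s\<bar>)"
    and Gint: "integrable lborel (?G s) \<longleftrightarrow> integrable lborel (\<lambda>\<xi>. ?F \<xi> s)" if s: "s \<noteq> 0" for s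
  proof -
    have mF: "(\<lambda>\<xi>. ?F \<xi> s) \<in> borel_measurable borel" and mFa: "(\<lambda>\<xi>. \<bar>?F \<xi> s\<bar>) \<in> borel_measurable borel"
      by measurable
    show "(LINT \<zeta>|lborel. ?G s \<zeta>) = (LINT \<xi>|lborel. ?F \<xi> s)"
      unfolding FG[OF s, symmetric]
      by (subst lborel_integral_dilation(1)[OF s mF]) (simp add: mult.commute)
    have abs: "\<bar>?G s \<zeta>\<bar> = \<bar>?F (s *\<^sub>R \<zeta>) s\<bar> * \<bar>s\<bar> ^ DIM('a)" for \<zeta>
      unfolding FG[OF s, symmetric] by (simp add: abs_mult)
    show "(LINT \<zeta>|lborel. \<bar>?G s \<zeta>\<bar>) = (LINT \<xi>|lborel. \<bar>?F \<xi> s\<bar>)"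
      unfolding abs by (subst lborel_integral_dilation(1)[OF s mFa]) (simp add: mult.commute)
    show "integrable lborel (?G s) \<longleftrightarrow> integrable lborel (\<lambda>\<xi>. ?F \<xi> s)"
      unfolding FG[OF s, symmetric] using s lborel_integral_dilation(2)[OF s mF] by simp
  qed
  have aes: "AE s::real in lborel. s \<noteq> 0" by (rule AE_lborel_singleton)
  have i1': "integrable (lborel \<Otimes>\<^sub>M lborel) (\<lambda>(s, \<xi>). ?F \<xi> s)"
    using lborel_pair.integrable_product_swap[OF i1] by (simp add: case_prod_unfold)
  have i2: "integrable (lborel \<Otimes>\<^sub>M lborel) (\<lambda>(s, \<zeta>). ?G s \<zeta>)"
  proof (rule lborel_pair.Fubini_integrable)
    have "integrable (lborel \<Otimes>\<^sub>M lborel) (\<lambda>(s, \<xi>). \<bar>?F \<xi> s\<bar>)"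
      using integrable_abs[OF i1'] by (simp add: case_prod_unfold)
    from lborel_pair.integrable_fst[OF this] have "integrable lborel (\<lambda>s. LINT \<xi>|lborel. \<bar>?F \<xi> s\<bar>)" .
    moreover have "AE s in lborel. (LINT \<zeta>|lborel. norm (?G s \<zeta>)) = (LINT \<xi>|lborel. \<bar>?F \<xi> s\<bar>)"
      using aes by eventually_elim (unfold real_norm_def, rule Gabs)
    ultimately show "integrable lborel (\<lambda>s. LINT \<zeta>|lborel. norm (case (s, \<zeta>) of (s, \<zeta>) \<Rightarrow> ?G s \<zeta>))"
      by (subst integrable_cong_AE[where g="\<lambda>s. LINT \<xi>|lborel. \<bar>?F \<xi> s\<bar>"]) auto
    show "AE s in lborel. integrable lborel (\<lambda>\<zeta>. case (s, \<zeta>) of (s, \<zeta>) \<Rightarrow> ?G s \<zeta>)"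
      using lborel_pair.AE_integrable_fst[OF i1'] aes by eventually_elim (use Gint in simp)
  qed measurable
  have "(LINT \<xi>|lborel. h \<xi>) * ring_mass = (LINT \<xi>|lborel. h \<xi> * ring_mass)" by simp
  also have "\<dots> = (LINT \<xi>|lborel. LINT s|lborel. ?F \<xi> s)"
    using ae0 by (intro integral_cong_AE) (auto elim!: eventually_mono simp: ring_kernel_integral)
  also have "\<dots> = (LINT s|lborel. LINT \<xi>|lborel. ?F \<xi> s)"
    using lborel_pair.Fubini_integral[OF i1] by simp
  also have "\<dots> = (LINT s|lborel. LINT \<zeta>|lborel. ?G s \<zeta>)"
  proof (rule integral_cong_AE)
    show "AE s in lborel. (LINT \<xi>|lborel. ?F \<xi> s) = (LINT \<zeta>|lborel. ?G s \<zeta>)"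
      using aes by eventually_elim (rule G[symmetric])
  qed measurable
  also have "\<dots> = (LINT \<zeta>|lborel. LINT s|lborel. ?G s \<zeta>)"
    using lborel_pair.Fubini_integral[OF i2] by simp
  also have "\<dots> \<le> 0"
  proof -
    have "(LINT s|lborel. ?G s \<zeta>) \<le> 0" for \<zeta>
      using rad[of \<zeta>] by (cases "\<zeta> = 0") (auto simp: indicator_def)
    then have "0 \<le> (LINT \<zeta>|lborel. - (LINT s|lborel. ?G s \<zeta>))" by (intro integral_nonneg_AE AE_I2) simp
    then show ?thesis by simp
  qed
  finally show ?thesis using ring_mass_pos by (simp add: mult_le_0_iff)
qed

context test_density
begin

text \<open>
The integral of \<open>exp (- \<bar>\<xi>\<bar>\<^sup>2 / 2) * body_cos K \<xi> * central_section v \<xi> / norm \<xi>\<close> read in both ways.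
As the limit of \<open>thick_section_swap\<close> it is a positive multiple of the tube integral. On each line
the factor \<open>central_section v\<close> is constant and nonpositive, and the remaining radial integral is
nonnegative, so the whole is nonpositive.
\<close>
lemma tube_integral_nonpos:
  assumes cpt: "compact K" and cvx: "convex K" and sym: "origin_symmetric K"
    and dim4: "DIM('a) \<le> 4"
    and sec: "\<And>\<xi>. \<xi> \<noteq> 0 \<Longrightarrow> central_section v \<xi> \<le> 0"
  shows "(LINT x|lborel. v x * (gauss_tube K x / norm x)) \<le> 0"
proof -
  note [measurable] = body_cos_measurable[OF cpt]
  let ?g = "\<lambda>\<xi>::'a. gauss (norm \<xi>)"
  let ?\<delta> = "\<lambda>k. 1 / real (Suc k)"
  have \<delta>: "?\<delta> k > 0" for k by simp
  \<comment> \<open>homogeneous of degree -1; the value at 0 only serves measurability\<close>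
  define V where "V \<xi> = (if \<xi> = 0 then 0 else central_section v \<xi> / norm \<xi>)" for \<xi>
  define C where "C = M * (2 * R) ^ (DIM('a) - 1)"
  have V_lim: "(\<lambda>k. if \<xi> = 0 then 0 else thick_section (?\<delta> k) \<xi>) \<longlonglongrightarrow> V \<xi>" for \<xi>
    using thick_section_tendsto[of \<xi>] by (auto simp: V_def)
  have [measurable]: "V \<in> borel_measurable borel"
    by (rule borel_measurable_LIMSEQ_real[OF V_lim]) measurable
  have Vb: "\<bar>V \<xi>\<bar> \<le> C / norm \<xi>" for \<xi>
  proof (rule LIMSEQ_le_const2[OF tendsto_rabs[OF V_lim]], intro exI allI impI)
    show "\<bar>if \<xi> = 0 then 0 else thick_section (?\<delta> k) \<xi>\<bar> \<le> C / norm \<xi>" for k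
      using thick_section_bound[of \<xi> "?\<delta> k"] by (auto simp: C_def)
  qed
  let ?w = "\<lambda>\<xi>::'a. (measure lborel K * C) * (?g \<xi> / norm \<xi>)"
  have wi: "integrable lborel ?w" by (intro integrable_mult_right gauss_inverse_norm_integrable dim2)
  have dom: "\<bar>?g \<xi> * body_cos K \<xi> * t\<bar> \<le> ?w \<xi>" if "\<bar>t\<bar> \<le> C / norm \<xi>" for \<xi> t
  proof -
    have "?g \<xi> * (\<bar>body_cos K \<xi>\<bar> * \<bar>t\<bar>) \<le> ?g \<xi> * (measure lborel K * (C / norm \<xi>))"
      by (intro mult_left_mono mult_mono body_cos_bound[OF cpt] that) auto
    then show ?thesis by (simp add: abs_mult mult_ac)
  qed
  let ?h = "\<lambda>\<xi>. ?g \<xi> * body_cos K \<xi> * V \<xi>"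
  have hi: "integrable lborel ?h"
    by (rule Bochner_Integration.integrable_bound[OF wi], measurable, rule AE_I2, unfold real_norm_def)
       (rule order_trans[OF dom[OF Vb] abs_ge_self])
  have ae0: "AE x::'a in lborel. x \<noteq> 0" by (rule AE_lborel_singleton)
  have lim: "(\<lambda>k. LINT \<xi>|lborel. ?g \<xi> * body_cos K \<xi> * thick_section (?\<delta> k) \<xi>) \<longlonglongrightarrow> (LINT \<xi>|lborel. ?h \<xi>)"
  proof (rule integral_dominated_convergence[OF _ _ wi])
    show "AE \<xi> in lborel. norm (?g \<xi> * body_cos K \<xi> * thick_section (?\<delta> k) \<xi>) \<le> ?w \<xi>" for k
      using ae0 by eventually_elim (unfold real_norm_def, rule dom, unfold C_def, rule thick_section_bound, assumption, simp)
    show "AE \<xi> in lborel. (\<lambda>k. ?g \<xi> * body_cos K \<xi> * thick_section (?\<delta> k) \<xi>) \<longlonglongrightarrow> ?h \<xi>"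
      using ae0
    proof eventually_elim
      fix \<xi> :: 'a assume "\<xi> \<noteq> 0"
      then show "(\<lambda>k. ?g \<xi> * body_cos K \<xi> * thick_section (?\<delta> k) \<xi>) \<longlonglongrightarrow> ?h \<xi>"
        using V_lim[of \<xi>] by (intro tendsto_mult tendsto_const) simp
    qed
  qed measurable
  have "(LINT \<xi>|lborel. ?h \<xi>) = (LINT x|lborel. v x * (sqrt (2 * pi) ^ (DIM('a) - 1) / norm x * gauss_tube K x))"
  proof (rule LIMSEQ_unique[OF lim])
    show "(\<lambda>k. LINT \<xi>|lborel. ?g \<xi> * body_cos K \<xi> * thick_section (?\<delta> k) \<xi>)
        \<longlonglongrightarrow> (LINT x|lborel. v x * (sqrt (2 * pi) ^ (DIM('a) - 1) / norm x * gauss_tube K x))"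
      using tube_limit[OF cpt] by (simp only: thick_section_swap[OF cpt \<delta>])
  qed
  also have "\<dots> = sqrt (2 * pi) ^ (DIM('a) - 1) * (LINT x|lborel. v x * (gauss_tube K x / norm x))"
    by (subst integral_mult_right_zero[symmetric]) (simp add: mult_ac)
  finally have eq: "(LINT \<xi>|lborel. ?h \<xi>) = sqrt (2 * pi) ^ (DIM('a) - 1) * (LINT x|lborel. v x * (gauss_tube K x / norm x))" .
  have "(LINT \<xi>|lborel. ?h \<xi>) \<le> 0"
  proof (rule integral_nonpos_radially[OF hi])
    fix \<zeta> :: 'a assume \<zeta>: "\<zeta> \<noteq> 0"
    have Vs: "V (s *\<^sub>R \<zeta>) = V \<zeta> / \<bar>s\<bar>" if "s \<noteq> 0" for s
      using that \<zeta> by (simp add: V_def central_section_def onb_scaleR)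
    have pw: "\<bar>s\<bar> ^ (DIM('a) - 1) / \<bar>s\<bar> = \<bar>s\<bar> ^ (DIM('a) - 2)" if "s \<noteq> 0" for s :: real
    proof -
      have "DIM('a) - 1 = Suc (DIM('a) - 2)" using dim2 by simp
      then show ?thesis using that by simp
    qed
    have "(LINT s|lborel. \<bar>s\<bar> ^ (DIM('a) - 1) * ?h (s *\<^sub>R \<zeta>))
        = (LINT s|lborel. V \<zeta> * (\<bar>s\<bar> ^ (DIM('a) - 2) * gauss (norm \<zeta> * s) * body_cos K (s *\<^sub>R \<zeta>)))"
    proof (rule integral_cong_AE)
      show "AE s in lborel. \<bar>s\<bar> ^ (DIM('a) - 1) * ?h (s *\<^sub>R \<zeta>)
        = V \<zeta> * (\<bar>s\<bar> ^ (DIM('a) - 2) * gauss (norm \<zeta> * s) * body_cos K (s *\<^sub>R \<zeta>))"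
        using AE_lborel_singleton[of 0]
      proof eventually_elim
        fix s :: real assume s: "s \<noteq> 0"
        have "(norm (s *\<^sub>R \<zeta>))\<^sup>2 = (norm \<zeta> * s)\<^sup>2" by (simp add: power_mult_distrib mult.commute)
        then show "\<bar>s\<bar> ^ (DIM('a) - 1) * ?h (s *\<^sub>R \<zeta>)
          = V \<zeta> * (\<bar>s\<bar> ^ (DIM('a) - 2) * gauss (norm \<zeta> * s) * body_cos K (s *\<^sub>R \<zeta>))"
          unfolding Vs[OF s] pw[OF s, symmetric] by simp
      qed
    qed measurable
    also have "\<dots> = V \<zeta> * (LINT s|lborel. \<bar>s\<bar> ^ (DIM('a) - 2) * gauss (norm \<zeta> * s) * body_cos K (s *\<^sub>R \<zeta>))"
      by simp
    also have "\<dots> \<le> 0"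
      using sec[OF \<zeta>] \<zeta> radial_fourier_nonneg[OF cpt cvx sym dim2 dim4, of "norm \<zeta>" \<zeta>]
      by (intro mult_nonpos_nonneg) (auto simp: V_def divide_nonpos_pos)
    finally show "(LINT s|lborel. \<bar>s\<bar> ^ (DIM('a) - 1) * ?h (s *\<^sub>R \<zeta>)) \<le> 0" .
  qed
  moreover have "0 < sqrt (2 * pi) ^ (DIM('a) - 1)" by simp
  ultimately show ?thesis
    using mult_le_cancel_left_pos[of "sqrt (2 * pi) ^ (DIM('a) - 1)" "LINT x|lborel. v x * (gauss_tube K x / norm x)" 0]
    unfolding eq by (simp only: mult_zero_right)
qed

end

section \<open>From Gaussian tubes to chords\<close>

text \<open>
A convex body with 0 in its interior is radially thick: a boundary point cannot be moved outwards.
\<close>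
lemma star_interior:
  fixes K :: "'a::euclidean_space set"
  assumes cvx: "convex K" and int: "0 \<in> interior K" and t: "1 < t" and z: "t *\<^sub>R z \<in> K"
  shows "z \<in> interior K"
proof -
  have "t *\<^sub>R z - (1 - 1 / t) *\<^sub>R (t *\<^sub>R z - 0) \<in> interior K"
    using t by (intro mem_interior_convex_shrink[OF cvx int z]) auto
  moreover have "t *\<^sub>R z - (1 - 1 / t) *\<^sub>R (t *\<^sub>R z - 0) = z" using t by (simp add: algebra_simps)
  ultimately show ?thesis by simp
qed

lemma frontier_negligible_AE:
  fixes T :: "'a::euclidean_space set"
  assumes "convex T"
  shows "AE x in lborel. x \<notin> frontier T"
proof -
  have "frontier T \<in> null_sets lborel"
    using negligible_convex_frontier[OF assms] by (simp add: negligible_iff_null_sets null_sets_completion_iff)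
  then show ?thesis by (rule AE_not_in)
qed

lemma AE_line_not_frontier:
  fixes K :: "'a::euclidean_space set"
  assumes cpt: "compact K" and cvx: "convex K" and int: "0 \<in> interior K"
  shows "AE s in lborel. s *\<^sub>R x \<notin> frontier K"
proof -
  let ?T = "{s. s *\<^sub>R x \<in> K}"
  have "convex ?T"
    unfolding convex_alt using cvx by (auto simp: convex_alt scaleR_add_left simp flip: scaleR_scaleR)
  from frontier_negligible_AE[OF this] AE_lborel_singleton[of 0]
  show ?thesis
  proof eventually_elim
    fix s :: real assume s: "s \<notin> frontier ?T" "s \<noteq> 0"
    show "s *\<^sub>R x \<notin> frontier K"
    proof
      assume f: "s *\<^sub>R x \<in> frontier K"
      then have "s \<in> ?T" using compact_imp_closed[OF cpt] by (auto simp: frontier_def)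
      then have "s \<in> interior ?T" using s(1) closure_subset[of ?T] by (auto simp: frontier_def)
      then obtain d where d: "d > 0" "ball s d \<subseteq> ?T" by (auto simp: mem_interior)
      define t where "t = 1 + d / (2 * \<bar>s\<bar>)"
      have t: "t > 1" using d s by (simp add: t_def)
      have "dist s (t * s) = d / 2" using s d by (simp add: t_def dist_real_def abs_mult algebra_simps abs_divide)
      then have "t * s \<in> ?T" using d by (intro subsetD[OF d(2)]) simp
      then have "s *\<^sub>R x \<in> interior K" by (intro star_interior[OF cvx int t]) simp
      then show False using f by (simp add: frontier_def)
    qed
  qed
qed

text \<open>
The part of the frontier of \<open>K\<close> in a central hyperplane, times a segment orthogonal to the hyperplane, lies
in the frontier of a convex cylinder and hence is a null set; by Fubini its base is one. Having 0 in
the interior is what excludes a hyperplane that merely touches \<open>K\<close>.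
\<close>
lemma AE_section_not_frontier:
  fixes K :: "'a::euclidean_space set"
  assumes cpt: "compact K" and cvx: "convex K" and int: "0 \<in> interior K" and \<xi>: "\<xi> \<noteq> 0"
  shows "AE c in coords (onb \<xi>). lincomb (onb \<xi>) c \<notin> frontier K"
proof -
  define e where "e = \<xi> /\<^sub>R norm \<xi>"
  let ?B = "onb \<xi>" and ?P = "coords (onb \<xi>)"
  have e: "norm e = 1" using \<xi> by (simp add: e_def)
  have B: "orthonormal_basis ?B (perp e)" using orthonormal_onb[of \<xi>] \<xi> by (simp add: e_def perp_scaleR)
  interpret product_sigma_finite "\<lambda>_::'a. lborel :: real measure"
    by (rule product_sigma_finite_lborel)
  interpret P: sigma_finite_measure ?P using orthonormal_finite[OF B] by (rule sigma_finite)
  interpret PP: pair_sigma_finite ?P "lborel :: real measure" ..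
  \<comment> \<open>the orthogonal projection to the hyperplane; \<open>?C\<close> below is the cylinder over the section\<close>
  define p where "p x = x - (x \<bullet> e) *\<^sub>R e" for x
  have p_lin: "linear p" unfolding p_def by (intro linearI) (auto simp: inner_add_left algebra_simps)
  have p_cont: "continuous_on UNIV p" using p_lin by (simp add: linear_continuous_on linear_linear)
  let ?C = "{x. p x \<in> K \<and> \<bar>x \<bullet> e\<bar> \<le> 1}"
  have "?C = p -` K \<inter> {x. x \<bullet> e \<le> 1} \<inter> {x. x \<bullet> e \<ge> -1}" by (auto simp: abs_le_iff)
  moreover have "convex (p -` K)" by (rule convex_linear_vimage[OF p_lin cvx])
  moreover have "convex {x. x \<bullet> e \<le> 1}" "convex {x. x \<bullet> e \<ge> -1}"
    using convex_halfspace_le[of e 1] convex_halfspace_ge[of "-1" e] by (simp_all add: inner_commute)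
  ultimately have cvC: "convex ?C" by (simp add: convex_Int)
  let ?E = "{x. p x \<in> frontier K \<and> \<bar>x \<bullet> e\<bar> \<le> 1}"
  have pp: "p (p x) = p x" for x using e by (simp add: p_def inner_diff_left norm_eq_1)
  have sub: "?E \<subseteq> frontier ?C"
  proof
    fix x assume "x \<in> ?E"
    then have x: "p x \<in> frontier K" "\<bar>x \<bullet> e\<bar> \<le> 1" by auto
    then have "p x \<in> K" using compact_imp_closed[OF cpt] by (auto simp: frontier_def)
    then have xC: "x \<in> ?C" using x by simp
    show "x \<in> frontier ?C"
    proof (rule ccontr)
      assume "x \<notin> frontier ?C"
      then have "x \<in> interior ?C" using xC closure_subset[of ?C] by (auto simp: frontier_def)
      then obtain d where d: "d > 0" "ball x d \<subseteq> ?C" by (auto simp: mem_interior)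
      have p0: "p x \<noteq> 0" using x(1) int by (auto simp: frontier_def)
      \<comment> \<open>moving an interior point of the cylinder outwards by \<open>h *\<^sub>R p x\<close> stays in it, so \<open>p x\<close> is interior to \<open>K\<close>\<close>
      define h where "h = d / (2 * norm (p x))"
      have h: "h > 0" using d p0 by (simp add: h_def)
      have "dist x (x + h *\<^sub>R p x) = d / 2" using d p0 by (simp add: dist_norm h_def)
      then have "x + h *\<^sub>R p x \<in> ?C" using d by (intro subsetD[OF d(2)]) simp
      moreover have "p (x + h *\<^sub>R p x) = (1 + h) *\<^sub>R p x"
        using linear_add[OF p_lin, of x "h *\<^sub>R p x"] linear_scale[OF p_lin, of h "p x"] by (simp add: pp scaleR_add_left)
      ultimately have "(1 + h) *\<^sub>R p x \<in> K" by simp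
      then have "p x \<in> interior K" using h by (intro star_interior[OF cvx int, of "1 + h"]) auto
      then show False using x(1) by (simp add: frontier_def)
    qed
  qed
  have [measurable]: "p \<in> borel_measurable borel" using p_cont by (rule borel_measurable_continuous_onI)
  have [measurable]: "frontier K \<in> sets borel" by simp
  have "AE x in lborel. x \<notin> ?E"
    using frontier_negligible_AE[OF cvC] by eventually_elim (use sub in blast)
  then have "AE q in (?P \<Otimes>\<^sub>M lborel). lincomb ?B (fst q) + snd q *\<^sub>R e \<notin> ?E"
    unfolding lborel_split[OF B e] by (subst (asm) AE_distr_iff) (auto simp: case_prod_unfold)
  then have "AE c in ?P. AE s in lborel. lincomb ?B c + s *\<^sub>R e \<notin> ?E"
    using PP.AE_pair[of "\<lambda>q. lincomb ?B (fst q) + snd q *\<^sub>R e \<notin> ?E"] by simp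
  then show ?thesis
  proof eventually_elim
    fix c assume ae: "AE s in lborel. lincomb ?B c + s *\<^sub>R e \<notin> ?E"
    have pc: "p (lincomb ?B c + s *\<^sub>R e) = lincomb ?B c" "(lincomb ?B c + s *\<^sub>R e) \<bullet> e = s" for s
      using e by (simp_all add: p_def inner_add_left lincomb_perp[OF B] norm_eq_1)
    show "lincomb ?B c \<notin> frontier K"
    proof
      assume f: "lincomb ?B c \<in> frontier K"
      from ae have "AE s in lborel. s \<notin> {-1..1::real}"
      proof eventually_elim
        fix s assume "lincomb ?B c + s *\<^sub>R e \<notin> ?E"
        then have "\<not> \<bar>s\<bar> \<le> 1" using f by (simp add: pc)
        then show "s \<notin> {-1..1}" by auto
      qed
      then have "emeasure lborel {-1..1::real} = 0" by (subst (asm) AE_iff_measurable[of "{-1..1}"]) auto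
      then show False by simp
    qed
  qed
qed

text \<open>
The real counterpart of \<open>chord\<close>. They agree for nonzero \<open>x\<close>; at the origin of a body containing it the
integral diverges and takes the default value 0, so comparisons are made for nonzero \<open>x\<close>.
\<close>
definition chord_length :: "'a::euclidean_space set \<Rightarrow> 'a \<Rightarrow> real" where
  "chord_length K x = (LINT s|lborel. indicator K (s *\<^sub>R x))"

lemma lincomb_scale: "lincomb B (\<lambda>b. r * c b) = r *\<^sub>R lincomb B c"
  by (simp add: lincomb_def scaleR_sum_right)

lemma gauss_coords_integral:
  assumes \<xi>: "\<xi> \<noteq> (0::'a::euclidean_space)"
  shows "integrable (coords (onb \<xi>)) (\<lambda>c. gauss (norm (lincomb (onb \<xi>) c)))"
    and "(LINT c|coords (onb \<xi>). gauss (norm (lincomb (onb \<xi>) c))) = sqrt (2 * pi) ^ (DIM('a) - 1)"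
proof -
  interpret product_sigma_finite "\<lambda>_::'a. lborel :: real measure"
    by (rule product_sigma_finite_lborel)
  have fin: "finite (onb \<xi>)" using orthonormal_onb by (rule orthonormal_finite)
  have eq: "gauss (norm (lincomb (onb \<xi>) c)) = (\<Prod>b\<in>onb \<xi>. gauss (c b))" for c
    unfolding exp_sum[OF fin, symmetric] norm_lincomb[OF orthonormal_onb]
    by (simp add: sum_nonneg sum_negf sum_divide_distrib)
  show "integrable (coords (onb \<xi>)) (\<lambda>c. gauss (norm (lincomb (onb \<xi>) c)))"
    unfolding eq by (intro product_integrable_prod fin gauss_integrable(1))
  have "(LINT s|lborel. gauss s) = sqrt (2 * pi)" using gauss_scaled(3)[of 1] by simp
  then show "(LINT c|coords (onb \<xi>). gauss (norm (lincomb (onb \<xi>) c))) = sqrt (2 * pi) ^ (DIM('a) - 1)"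
    unfolding eq by (subst product_integral_prod[OF fin gauss_integrable(1)]) (simp add: card_onb[OF \<xi>])
qed

lemma gauss_tube_measurable[measurable]:
  assumes [measurable]: "K \<in> sets borel"
  shows "gauss_tube K \<in> borel_measurable borel"
  unfolding gauss_tube_def[abs_def] by (rule lborel.borel_measurable_lebesgue_integral) (simp add: case_prod_unfold)

text \<open>
Only the variable along the line through \<open>x\<close> is rescaled. The dilation of \<open>K\<close> then shrinks the orthogonal
component, while the Gaussian weight stays fixed.
\<close>
lemma gauss_tube_dilate:
  fixes K :: "'a::euclidean_space set"
  assumes cpt: "compact K" and r: "r > 0" and x: "x \<noteq> 0"
  shows "gauss_tube ((*\<^sub>R) r ` K) x / norm x / r
    = (LINT c|coords (onb x). gauss (norm (lincomb (onb x) c)) *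
        (LINT s|lborel. indicator K ((1 / r) *\<^sub>R lincomb (onb x) c + s *\<^sub>R x)))"
proof -
  define e where "e = x /\<^sub>R norm x"
  let ?B = "onb x" and ?P = "coords (onb x)" and ?K = "(*\<^sub>R) r ` K"
  have e: "norm e = 1" and xe: "x = norm x *\<^sub>R e" using x by (auto simp: e_def)
  have B: "orthonormal_basis ?B (perp e)" using orthonormal_onb[of x] x by (simp add: e_def perp_scaleR)
  have cK: "compact ?K" using cpt by (rule compact_scaling)
  note [measurable] = body_borel[OF cpt] body_borel[OF cK]
  have yx: "(y \<bullet> x) / norm x = y \<bullet> e" for y using x by (subst xe) simp
  let ?h = "\<lambda>y. indicator ?K y * exp (- (((norm y)\<^sup>2 - ((y \<bullet> x) / norm x)\<^sup>2) / 2)) :: real"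
  have h1: "?h y \<le> indicator ?K y" for y
  proof -
    have "\<bar>y \<bullet> e\<bar> \<le> norm y" using Cauchy_Schwarz_ineq2[of y e] e by simp
    then have "(y \<bullet> e)\<^sup>2 \<le> (norm y)\<^sup>2" using abs_le_square_iff[of "y \<bullet> e" "norm y"] by simp
    then show ?thesis unfolding yx by (auto simp: indicator_def)
  qed
  have int: "integrable lborel ?h"
    by (rule Bochner_Integration.integrable_bound[OF body_integrable[OF cK]]) (use h1 in auto)
  have ie: "((lincomb ?B c + t *\<^sub>R e) \<bullet> x) / norm x = t" for c t
    unfolding yx using e by (simp add: inner_add_left lincomb_perp[OF B] norm_eq_1)
  have ne: "(norm (lincomb ?B c + t *\<^sub>R e))\<^sup>2 - t\<^sup>2 = (norm (lincomb ?B c))\<^sup>2" for c t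
    using e by (simp add: norm_add_Pythagorean orthogonal_def lincomb_perp[OF B])
  have ind: "indicator ?K y = (indicator K ((1 / r) *\<^sub>R y) :: real)" for y
  proof -
    have "y \<in> ?K \<longleftrightarrow> (1 / r) *\<^sub>R y \<in> K"
      using r by (auto simp: image_iff intro!: bexI[of _ "(1 / r) *\<^sub>R y"])
    then show ?thesis by (simp add: indicator_def)
  qed
  have "gauss_tube ?K x = (LINT c|?P. (LINT t|lborel. indicator ?K (lincomb ?B c + t *\<^sub>R e) * gauss (norm (lincomb ?B c))))"
    unfolding gauss_tube_def lborel_integral_split(1)[OF B e int] ie ne ..
  also have "\<dots> = (LINT c|?P. (r * norm x) * (gauss (norm (lincomb ?B c)) *
        (LINT s|lborel. indicator K ((1 / r) *\<^sub>R lincomb ?B c + s *\<^sub>R x))))"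
  proof (rule Bochner_Integration.integral_cong[OF refl])
    fix c
    let ?g = "\<lambda>t. indicator ?K (lincomb ?B c + t *\<^sub>R e) :: real"
    have g: "?g (0 + (r * norm x) * s) = indicator K ((1 / r) *\<^sub>R lincomb ?B c + s *\<^sub>R x)" for s
    proof -
      have "(1 / r) *\<^sub>R (lincomb ?B c + (0 + (r * norm x) * s) *\<^sub>R e) = (1 / r) *\<^sub>R lincomb ?B c + s *\<^sub>R x"
        using r x by (simp add: scaleR_add_right e_def)
      then show ?thesis unfolding ind by simp
    qed
    have "(LINT t|lborel. ?g t) = \<bar>r * norm x\<bar> *\<^sub>R (LINT s|lborel. ?g (0 + (r * norm x) * s))"
      using r x by (intro lborel_integral_real_affine) simp
    also have "\<dots> = (r * norm x) * (LINT s|lborel. indicator K ((1 / r) *\<^sub>R lincomb ?B c + s *\<^sub>R x))"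
      unfolding g using r by simp
    finally show "(LINT t|lborel. indicator ?K (lincomb ?B c + t *\<^sub>R e) * gauss (norm (lincomb ?B c)))
      = (r * norm x) * (gauss (norm (lincomb ?B c)) *
        (LINT s|lborel. indicator K ((1 / r) *\<^sub>R lincomb ?B c + s *\<^sub>R x)))"
      using r by simp
  qed
  finally show ?thesis using r x by simp
qed

text \<open>
As the dilation grows, the orthogonal displacement in \<open>gauss_tube_dilate\<close> tends to 0, and the line through
the displaced point meets \<open>K\<close> in nearly the same chord. The second claim supplies an integrable bound.
\<close>
lemma tube_to_chord:
  fixes K :: "'a::euclidean_space set"
  assumes cpt: "compact K" and cvx: "convex K" and int0: "0 \<in> interior K" and x: "x \<noteq> 0"
    and \<rho>: "K \<subseteq> cball 0 \<rho>"
  shows "(\<lambda>k. gauss_tube ((*\<^sub>R) (real (Suc k)) ` K) x / norm x / real (Suc k))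
      \<longlonglongrightarrow> sqrt (2 * pi) ^ (DIM('a) - 1) * chord_length K x"
    and "\<And>k. \<bar>gauss_tube ((*\<^sub>R) (real (Suc k)) ` K) x / norm x / real (Suc k)\<bar>
      \<le> sqrt (2 * pi) ^ (DIM('a) - 1) * (2 * (\<rho> / norm x))"
proof -
  define e where "e = x /\<^sub>R norm x"
  let ?B = "onb x" and ?P = "coords (onb x)"
  let ?E = "\<lambda>c. gauss (norm (lincomb ?B c))"
  let ?j = "\<lambda>k c s. indicator K ((1 / real (Suc k)) *\<^sub>R lincomb ?B c + s *\<^sub>R x) :: real"
  let ?J = "\<lambda>k c. LINT s|lborel. ?j k c s"
  let ?I = "{- (\<rho> / norm x)..\<rho> / norm x}"
  have e: "norm e = 1" and xe: "x = norm x *\<^sub>R e" using x by (auto simp: e_def)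
  have B: "orthonormal_basis ?B (perp e)" using orthonormal_onb[of x] x by (simp add: e_def perp_scaleR)
  note [measurable] = body_borel[OF cpt]
  have \<rho>0: "0 \<le> \<rho>" using \<rho> int0 interior_subset by (force dest: subsetD)
  have iI: "integrable lborel (indicator ?I :: real \<Rightarrow> real)" by (intro body_integrable compact_Icc)
  have j: "?j k c s \<le> indicator ?I s" for k c s
  proof (cases "(1 / real (Suc k)) *\<^sub>R lincomb ?B c + s *\<^sub>R x \<in> K")
    case True
    have "(1 / real (Suc k)) *\<^sub>R lincomb ?B c + s *\<^sub>R x = lincomb ?B (\<lambda>b. (1 / real (Suc k)) * c b) + (s * norm x) *\<^sub>R e"
      unfolding lincomb_scale using x by (simp add: e_def)
    then have "\<bar>s * norm x\<bar> \<le> \<rho>" using coords_bound(1)[OF B e] True \<rho> by (metis subsetD)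
    then have "\<bar>s\<bar> \<le> \<rho> / norm x" using x by (simp add: abs_mult pos_le_divide_eq)
    then have "s \<in> ?I" by (simp only: abs_le_iff atLeastAtMost_iff minus_le_iff)
    then show ?thesis using True by simp
  qed simp
  have ij: "integrable lborel (?j k c)" for k c
    by (rule Bochner_Integration.integrable_bound[OF iI]) (use j in auto)
  have J: "0 \<le> ?J k c" "?J k c \<le> 2 * (\<rho> / norm x)" for k c
  proof -
    show "0 \<le> ?J k c" by simp
    have "?J k c \<le> (LINT s|lborel. indicator ?I s)" by (intro integral_mono ij iI j)
    then show "?J k c \<le> 2 * (\<rho> / norm x)" using \<rho>0 by simp
  qed
  have Jlim: "(\<lambda>k. ?J k c) \<longlonglongrightarrow> chord_length K x" for c
    unfolding chord_length_def
  proof (rule integral_dominated_convergence[OF _ _ iI])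
    show "AE s in lborel. norm (?j k c s) \<le> indicator ?I s" for k using j by auto
    show "AE s in lborel. (\<lambda>k. ?j k c s) \<longlonglongrightarrow> indicator K (s *\<^sub>R x)"
      using AE_line_not_frontier[OF cpt cvx int0, of x]
    proof eventually_elim
      fix s assume s: "s *\<^sub>R x \<notin> frontier K"
      have "(\<lambda>k. (1 / real (Suc k)) *\<^sub>R lincomb ?B c + s *\<^sub>R x) \<longlonglongrightarrow> 0 *\<^sub>R lincomb ?B c + s *\<^sub>R x"
        by (intro tendsto_intros LIMSEQ_Suc[OF lim_1_over_n])
      then have lim: "(\<lambda>k. (1 / real (Suc k)) *\<^sub>R lincomb ?B c + s *\<^sub>R x) \<longlonglongrightarrow> s *\<^sub>R x" by simp
      show "(\<lambda>k. ?j k c s) \<longlonglongrightarrow> indicator K (s *\<^sub>R x)"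
        by (rule isCont_tendsto_compose[OF _ lim]) (simp add: isCont_indicator s)
    qed
  qed measurable
  note gi = gauss_coords_integral[OF x]
  note dil = gauss_tube_dilate[OF cpt _ x, of "real (Suc _)"]
  have wi: "integrable ?P (\<lambda>c. ?E c * (2 * (\<rho> / norm x)))" by (intro integrable_mult_left gi(1))
  have bd: "\<bar>?E c * ?J k c\<bar> \<le> ?E c * (2 * (\<rho> / norm x))" for k c
  proof -
    have "?E c * ?J k c \<le> ?E c * (2 * (\<rho> / norm x))" by (intro mult_left_mono J(2)) simp
    moreover have "0 \<le> ?E c * ?J k c" using J(1) by (intro mult_nonneg_nonneg) auto
    ultimately show ?thesis by (simp only: abs_of_nonneg)
  qed
  have mJ: "?J k \<in> borel_measurable ?P" for k
    by (rule lborel.borel_measurable_lebesgue_integral) (simp add: case_prod_unfold)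
  have "(\<lambda>k. LINT c|?P. ?E c * ?J k c) \<longlonglongrightarrow> (LINT c|?P. ?E c * chord_length K x)"
  proof (rule integral_dominated_convergence[OF _ _ wi])
    show "AE c in ?P. norm (?E c * ?J k c) \<le> ?E c * (2 * (\<rho> / norm x))" for k
      unfolding real_norm_def by (intro AE_I2 bd)
    show "AE c in ?P. (\<lambda>k. ?E c * ?J k c) \<longlonglongrightarrow> ?E c * chord_length K x"
      by (intro AE_I2 tendsto_mult tendsto_const Jlim)
    show "(\<lambda>c. ?E c * ?J k c) \<in> borel_measurable ?P" for k using mJ[of k] by measurable
  qed measurable
  then show "(\<lambda>k. gauss_tube ((*\<^sub>R) (real (Suc k)) ` K) x / norm x / real (Suc k))
      \<longlonglongrightarrow> sqrt (2 * pi) ^ (DIM('a) - 1) * chord_length K x"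
    unfolding integral_mult_left_zero gi(2) by (subst dil) simp_all
  fix k
  have "\<bar>LINT c|?P. ?E c * ?J k c\<bar> \<le> (LINT c|?P. \<bar>?E c * ?J k c\<bar>)" by (rule integral_abs_bound)
  also have "\<dots> \<le> (LINT c|?P. ?E c * (2 * (\<rho> / norm x)))" by (intro integral_mono' wi bd) (use \<rho>0 in simp)
  also have "\<dots> = sqrt (2 * pi) ^ (DIM('a) - 1) * (2 * (\<rho> / norm x))" unfolding integral_mult_left_zero gi(2) ..
  finally show "\<bar>gauss_tube ((*\<^sub>R) (real (Suc k)) ` K) x / norm x / real (Suc k)\<bar>
      \<le> sqrt (2 * pi) ^ (DIM('a) - 1) * (2 * (\<rho> / norm x))" by (subst dil) simp_all
qed

text \<open>
A symmetric convex body in dimension at most 4 is an intersection body, in dual form: densities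
with nonpositive central sections have nonpositive pairing with the reciprocal of the gauge. The inequality
for Gaussian tubes is applied to the dilates of \<open>K\<close>; the hypotheses on \<open>v\<close> do not involve the body.
\<close>
lemma (in test_density) chord_integral_nonpos:
  assumes cpt: "compact K" and cvx: "convex K" and int0: "0 \<in> interior K" and sym: "origin_symmetric K"
    and dim4: "DIM('a) \<le> 4"
    and sec: "\<And>\<xi>. \<xi> \<noteq> 0 \<Longrightarrow> central_section v \<xi> \<le> 0"
  shows "(LINT x|lborel. v x * chord_length K x) \<le> 0"
proof -
  obtain \<rho> where \<rho>: "K \<subseteq> cball 0 \<rho>" using compact_imp_bounded[OF cpt] by (auto simp: bounded_iff subset_iff)
  note [measurable] = body_borel[OF cpt]
  let ?C = "sqrt (2 * pi) ^ (DIM('a) - 1)"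
  let ?K = "\<lambda>k. (*\<^sub>R) (real (Suc k)) ` K"
  let ?T = "\<lambda>k x. gauss_tube (?K k) x / norm x / real (Suc k)"
  have ae0: "AE x::'a in lborel. x \<noteq> 0" by (rule AE_lborel_singleton)
  have Kk: "?K k \<in> sets borel" for k by (intro body_borel compact_scaling cpt)
  have T_meas: "(\<lambda>x. v x * ?T k x) \<in> borel_measurable lborel" for k
    using gauss_tube_measurable[OF Kk[of k]] by simp
  have chord_meas[measurable]: "chord_length K \<in> borel_measurable borel"
    unfolding chord_length_def[abs_def] by (rule lborel.borel_measurable_lebesgue_integral) (simp add: case_prod_unfold)
  have "(\<lambda>k. LINT x|lborel. v x * ?T k x) \<longlonglongrightarrow> (LINT x|lborel. v x * (?C * chord_length K x))"
  proof (rule integral_dominated_convergence[where w="\<lambda>x. (?C * (2 * \<rho>)) * \<bar>v x / norm x\<bar>"])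
    show "integrable lborel (\<lambda>x. (?C * (2 * \<rho>)) * \<bar>v x / norm x\<bar>)"
      by (intro integrable_mult_right integrable_abs v_div_norm_integrable)
    show "AE x in lborel. norm (v x * ?T k x) \<le> (?C * (2 * \<rho>)) * \<bar>v x / norm x\<bar>" for k
      using ae0
    proof eventually_elim
      fix x :: 'a assume x: "x \<noteq> 0"
      have "\<bar>v x\<bar> * \<bar>?T k x\<bar> \<le> \<bar>v x\<bar> * (?C * (2 * (\<rho> / norm x)))"
        by (intro mult_left_mono tube_to_chord(2)[OF cpt cvx int0 x \<rho>]) simp
      then show "norm (v x * ?T k x) \<le> (?C * (2 * \<rho>)) * \<bar>v x / norm x\<bar>"
        unfolding real_norm_def abs_mult by (simp add: abs_divide mult_ac)
    qed
    show "AE x in lborel. (\<lambda>k. v x * ?T k x) \<longlonglongrightarrow> v x * (?C * chord_length K x)"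
      using ae0 by eventually_elim (intro tendsto_mult[OF tendsto_const] tube_to_chord(1)[OF cpt cvx int0 _ \<rho>])
    show "(\<lambda>x. v x * (?C * chord_length K x)) \<in> borel_measurable lborel" by simp
  qed (rule T_meas)
  moreover have "(LINT x|lborel. v x * ?T k x) \<le> 0" for k
  proof -
    have "?K k = uminus ` ?K k"
    proof -
      have "uminus ` ?K k = ?K k"
        using sym unfolding origin_symmetric_def by (metis (no_types, lifting) image_image image_cong scaleR_minus_right)
      then show ?thesis ..
    qed
    then have "origin_symmetric (?K k)" by (simp add: origin_symmetric_def)
    then have "(LINT x|lborel. v x * (gauss_tube (?K k) x / norm x)) \<le> 0"
      by (intro tube_integral_nonpos compact_scaling cpt convex_scaling cvx dim4 sec)
    moreover have "(LINT x|lborel. v x * ?T k x) = (LINT x|lborel. v x * (gauss_tube (?K k) x / norm x)) / real (Suc k)"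
      by (subst integral_divide_zero[symmetric]) simp
    ultimately show ?thesis by (simp add: divide_nonpos_pos del: of_nat_Suc)
  qed
  ultimately have "(LINT x|lborel. v x * (?C * chord_length K x)) \<le> 0"
    by (intro LIMSEQ_le_const2) auto
  moreover have "(LINT x|lborel. v x * (?C * chord_length K x)) = ?C * (LINT x|lborel. v x * chord_length K x)"
    by (subst integral_mult_right_zero[symmetric]) (simp add: mult_ac)
  moreover have "0 < ?C" by simp
  ultimately show ?thesis
    using mult_le_cancel_left_pos[of ?C "LINT x|lborel. v x * chord_length K x" 0] by (simp only: mult_zero_right)
qed

section \<open>Chords, balls and sections of a body\<close>

context
  fixes K :: "'a::euclidean_space set" and \<rho> :: real
  assumes cpt: "compact K" and cvx: "convex K" and int0: "0 \<in> interior K" and sym: "origin_symmetric K"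
    and \<rho>: "K \<subseteq> cball 0 \<rho>" and \<rho>_pos: "\<rho> > 0"
begin

lemma line_bound: "x \<noteq> 0 \<Longrightarrow> indicator K (s *\<^sub>R x) \<le> (indicator {- (\<rho> / norm x)..\<rho> / norm x} s :: real)"
proof (cases "s *\<^sub>R x \<in> K")
  case True
  assume x: "x \<noteq> 0"
  have "\<bar>s\<bar> * norm x \<le> \<rho>" using \<rho> True by auto
  then have "\<bar>s\<bar> \<le> \<rho> / norm x" using x by (simp add: pos_le_divide_eq)
  then have "s \<in> {- (\<rho> / norm x)..\<rho> / norm x}" unfolding atLeastAtMost_iff by linarith
  then show ?thesis using True by simp
qed simp

lemma line_integrable: "x \<noteq> 0 \<Longrightarrow> integrable lborel (\<lambda>s. indicator K (s *\<^sub>R x) :: real)"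
proof -
  assume x: "x \<noteq> 0"
  note [measurable] = body_borel[OF cpt]
  show ?thesis
    by (rule Bochner_Integration.integrable_bound[OF body_integrable[OF compact_Icc[of "- (\<rho> / norm x)" "\<rho> / norm x"]]])
       (use line_bound[OF x] in auto)
qed

lemma chord_length_le: "x \<noteq> 0 \<Longrightarrow> chord_length K x \<le> 2 * (\<rho> / norm x)"
proof -
  assume x: "x \<noteq> 0"
  have "chord_length K x \<le> (LINT s|lborel. indicator {- (\<rho> / norm x)..\<rho> / norm x} s)"
    unfolding chord_length_def by (intro integral_mono line_integrable body_integrable compact_Icc line_bound x)
  then show ?thesis using \<rho>_pos by simp
qed

lemma chord_length_nonneg: "0 \<le> chord_length K x"
  unfolding chord_length_def by simp

lemma chord_length_measurable: "chord_length K \<in> borel_measurable borel"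
proof -
  note [measurable] = body_borel[OF cpt]
  show ?thesis unfolding chord_length_def[abs_def]
    by (rule lborel.borel_measurable_lebesgue_integral) (simp add: case_prod_unfold)
qed

lemma scaled_mem: "x \<in> K \<Longrightarrow> \<bar>s\<bar> \<le> 1 \<Longrightarrow> s *\<^sub>R x \<in> K"
proof -
  assume x: "x \<in> K" and s: "\<bar>s\<bar> \<le> 1"
  have "- x \<in> K" using sym x by (force simp: origin_symmetric_def)
  moreover have "s *\<^sub>R x = ((1 + s) / 2) *\<^sub>R x + ((1 - s) / 2) *\<^sub>R (- x)"
    by (simp add: scaleR_minus_right flip: scaleR_diff_left) (simp add: field_simps)
  moreover have "((1 + s) / 2) *\<^sub>R x + ((1 - s) / 2) *\<^sub>R (- x) \<in> K"
    using s x \<open>- x \<in> K\<close> by (intro convexD[OF cvx]) (auto simp: abs_le_iff field_simps)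
  ultimately show ?thesis by simp
qed

text \<open>
Together with the next lemma: the reciprocal of the gauge is at least 1 on \<open>K\<close> and at most 1 off \<open>K\<close>.
The number 2 is the length of \<open>{-1..1}\<close>.
\<close>
lemma chord_length_inside: "x \<in> K \<Longrightarrow> x \<noteq> 0 \<Longrightarrow> 2 \<le> chord_length K x"
proof -
  assume x: "x \<in> K" "x \<noteq> 0"
  have "(LINT s|lborel. indicator {-1..1::real} s :: real) \<le> chord_length K x"
    unfolding chord_length_def
    by (intro integral_mono line_integrable body_integrable compact_Icc x)
       (use scaled_mem[OF x(1)] in \<open>auto simp: indicator_def abs_le_iff\<close>)
  then show ?thesis by simp
qed

lemma chord_length_outside: "x \<notin> K \<Longrightarrow> x \<noteq> 0 \<Longrightarrow> chord_length K x \<le> 2"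
proof -
  assume x: "x \<notin> K" "x \<noteq> 0"
  have "indicator K (s *\<^sub>R x) \<le> (indicator {-1..1} s :: real)" for s
  proof (cases "s *\<^sub>R x \<in> K")
    case True
    have "\<bar>s\<bar> \<le> 1"
    proof (rule ccontr)
      assume "\<not> \<bar>s\<bar> \<le> 1"
      then have "\<bar>1 / s\<bar> \<le> 1" "s \<noteq> 0" by (auto simp: abs_divide divide_le_eq)
      from scaled_mem[OF True this(1)] this(2) x(1) show False by simp
    qed
    then show ?thesis using True by (auto simp: indicator_def)
  qed simp
  then have "chord_length K x \<le> (LINT s|lborel. indicator {-1..1::real} s)"
    unfolding chord_length_def by (intro integral_mono line_integrable body_integrable compact_Icc x)
  then show ?thesis by simp
qed

lemma chord_integrable:
  fixes h :: "'a \<Rightarrow> real"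
  assumes n: "2 \<le> DIM('a)" and R: "R > 0" and [measurable]: "h \<in> borel_measurable borel"
    and h: "\<And>x. \<bar>h x\<bar> \<le> M * indicator (cball 0 R) x"
  shows "integrable lborel (\<lambda>x. h x * chord_length K x)"
proof (rule Bochner_Integration.integrable_bound)
  note [measurable] = chord_length_measurable
  show "integrable lborel (\<lambda>x::'a. (M * (2 * \<rho>)) * (indicator (cball 0 R) x / norm x))"
    by (intro integrable_mult_right inverse_norm_integrable n R)
  show "(\<lambda>x. h x * chord_length K x) \<in> borel_measurable lborel" by measurable
  show "AE x in lborel. norm (h x * chord_length K x) \<le> norm ((M * (2 * \<rho>)) * (indicator (cball 0 R) x / norm x))"
    using AE_lborel_singleton[of "0::'a"]
  proof eventually_elim
    fix x :: 'a assume x: "x \<noteq> 0"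
    have "\<bar>h x\<bar> * \<bar>chord_length K x\<bar> \<le> (M * indicator (cball 0 R) x) * (2 * (\<rho> / norm x))"
      using chord_length_le[OF x] chord_length_nonneg[of x] order_trans[OF abs_ge_zero h, of x]
      by (intro mult_mono h) auto
    also have "\<dots> = (M * (2 * \<rho>)) * (indicator (cball 0 R) x / norm x)" by simp
    finally show "norm (h x * chord_length K x) \<le> norm ((M * (2 * \<rho>)) * (indicator (cball 0 R) x / norm x))"
      unfolding real_norm_def abs_mult[of "h x"] by (rule order_trans[OF _ abs_ge_self])
  qed
qed

lemma body_chord_integral:
  assumes n: "2 \<le> DIM('a)"
  shows "(LINT x|lborel. indicator K x * chord_length K x) \<le> 2 * (real DIM('a) / (real DIM('a) - 1)) * measure lborel K"
proof -
  note [measurable] = body_borel[OF cpt] chord_length_measurable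
  have int: "integrable lborel (\<lambda>x. indicator K x * chord_length K x)"
    using \<rho> by (intro chord_integrable[OF n \<rho>_pos, where M=1]) (auto simp: indicator_def)
  have "ennreal (LINT x|lborel. indicator K x * chord_length K x) = (\<integral>\<^sup>+x. ennreal (indicator K x * chord_length K x) \<partial>lborel)"
    by (rule nn_integral_eq_integral[symmetric, OF int]) (simp add: chord_length_nonneg)
  also have "\<dots> = (\<integral>\<^sup>+x. indicator K x * chord K x \<partial>lborel)"
  proof (rule nn_integral_cong_AE)
    show "AE x in lborel. ennreal (indicator K x * chord_length K x) = indicator K x * chord K x"
      using AE_lborel_singleton[of "0::'a"]
    proof eventually_elim
      fix x :: 'a assume x: "x \<noteq> 0"
      have "chord K x = (\<integral>\<^sup>+s. ennreal (indicator K (s *\<^sub>R x)) \<partial>lborel)"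
        unfolding chord_def by (intro nn_integral_cong) (simp add: indicator_def)
      also have "\<dots> = ennreal (chord_length K x)"
        unfolding chord_length_def by (rule nn_integral_eq_integral[OF line_integrable[OF x]]) simp
      finally show "ennreal (indicator K x * chord_length K x) = indicator K x * chord K x"
        by (simp add: indicator_def)
    qed
  qed
  also have "\<dots> \<le> ennreal (2 * (real DIM('a) / (real DIM('a) - 1))) * emeasure lborel K"
    by (rule nn_integral_chord[OF body_borel[OF cpt] n])
  also have "\<dots> = ennreal (2 * (real DIM('a) / (real DIM('a) - 1)) * measure lborel K)"
  proof -
    have "emeasure lborel K = ennreal (measure lborel K)"
      using emeasure_compact_finite[OF cpt] by (intro emeasure_eq_ennreal_measure) simp
    moreover have "0 \<le> 2 * (real DIM('a) / (real DIM('a) - 1))" using n by simp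
    ultimately show ?thesis by (simp only: ennreal_mult measure_nonneg)
  qed
  finally show ?thesis using n by (subst (asm) ennreal_le_iff) auto
qed

text \<open>
The bathtub principle: among sets of the volume of \<open>K\<close>, the set \<open>K\<close> itself captures the largest values of
its chord length, as 2 separates the values inside from those outside.
\<close>
lemma ball_chord_integral_le:
  assumes n: "2 \<le> DIM('a)" and r: "r > 0" and vol: "measure lborel (cball (0::'a) r) = measure lborel K"
  shows "(LINT x|lborel. indicator (cball 0 r) x * chord_length K x) \<le> (LINT x|lborel. indicator K x * chord_length K x)"
proof -
  note [measurable] = body_borel[OF cpt] chord_length_measurable
  have iK: "integrable lborel (\<lambda>x. indicator K x * chord_length K x)"
    using \<rho> by (intro chord_integrable[OF n \<rho>_pos, where M=1]) (auto simp: indicator_def)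
  have iB: "integrable lborel (\<lambda>x. indicator (cball 0 r) x * chord_length K x)"
    by (intro chord_integrable[OF n r, where M=1]) (auto simp: indicator_def)
  have i1: "integrable lborel (indicator (cball 0 r) :: 'a \<Rightarrow> real)" "integrable lborel (indicator K :: 'a \<Rightarrow> real)"
    by (intro body_integrable compact_cball cpt)+
  have "(LINT x|lborel. indicator (cball 0 r) x * chord_length K x) - (LINT x|lborel. indicator K x * chord_length K x)
      = (LINT x|lborel. indicator (cball 0 r) x * chord_length K x - indicator K x * chord_length K x)"
    by (rule Bochner_Integration.integral_diff[symmetric, OF iB iK])
  also have "\<dots> \<le> (LINT x|lborel. 2 * indicator (cball 0 r) x - 2 * indicator K x)"
  proof (rule integral_mono_AE)
    show "AE x in lborel. indicator (cball 0 r) x * chord_length K x - indicator K x * chord_length K x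
        \<le> 2 * indicator (cball 0 r) x - 2 * indicator K x"
      using AE_lborel_singleton[of "0::'a"]
    proof eventually_elim
      fix x :: 'a assume x: "x \<noteq> 0"
      then show "indicator (cball 0 r) x * chord_length K x - indicator K x * chord_length K x
        \<le> 2 * indicator (cball 0 r) x - 2 * indicator K x"
        using chord_length_inside[of x] chord_length_outside[of x] by (cases "x \<in> K") (auto simp: indicator_def)
    qed
  qed (intro Bochner_Integration.integrable_diff integrable_mult_right iK iB i1)+
  also have "\<dots> = 2 * measure lborel (cball (0::'a) r) - 2 * measure lborel K"
    by (subst Bochner_Integration.integral_diff) (auto intro!: integrable_mult_right i1)
  finally show ?thesis using vol by simp
qed

end

text \<open>
With the explicit volumes \<open>\<pi>\<close>, \<open>4 * \<pi> / 3\<close> and \<open>\<pi>\<^sup>2 / 2\<close> of the unit balls, the three cases reduce to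
\<open>\<pi> \<le> 4\<close>, \<open>16 / 9 \<le> \<pi>\<close> and \<open>81 * \<pi>\<^sup>2 \<le> 2048\<close>.
\<close>
lemma unit_ball_vol_power_le:
  assumes "2 \<le> n" "n \<le> 4"
  shows "unit_ball_vol (real n) ^ (n - 1) \<le> unit_ball_vol (real (n - 1)) ^ n"
proof -
  have p: "3 < pi" "pi < 4" using pi_gt3 pi_less_4 by auto
  consider "n = 2" | "n = 3" | "n = 4" using assms by linarith
  then show ?thesis
  proof cases
    case 1
    then show ?thesis using p by (simp add: eval_unit_ball_vol)
  next
    case 2
    have "(4 / 3 * pi)\<^sup>2 = 16 / 9 * pi\<^sup>2" by (simp add: power_mult_distrib power_divide)
    also have "\<dots> \<le> pi * pi\<^sup>2" using p by (intro mult_right_mono) auto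
    finally show ?thesis using 2 by (simp add: eval_unit_ball_vol power2_eq_square power3_eq_cube)
  next
    case 3
    have "pi * pi \<le> 4 * 4" using p by (intro mult_mono) auto
    then have "(1 / 8) * pi\<^sup>2 * pi ^ 4 \<le> (256 / 81) * pi ^ 4"
      by (intro mult_right_mono) (auto simp: power2_eq_square)
    moreover have "(pi\<^sup>2 / 2) ^ 3 = (1 / 8) * pi\<^sup>2 * pi ^ 4" by (simp add: power_divide flip: power_mult power_add)
    moreover have "(4 / 3 * pi) ^ 4 = (256 / 81) * pi ^ 4" by (simp add: power_mult_distrib power_divide)
    ultimately show ?thesis using 3 by (simp add: eval_unit_ball_vol)
  qed
qed

text \<open>
The measure of the hyperplane is concentrated on it, so intersecting with the hyperplane changes nothing.
\<close>
lemma section_measure_eq: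
  fixes f :: "'a::euclidean_space \<Rightarrow> real"
  assumes [measurable]: "f \<in> borel_measurable borel" "S \<in> sets borel" and \<xi>: "\<xi> \<noteq> 0"
  shows "section_measure f (\<xi> /\<^sub>R norm \<xi>) (S \<inter> perp (\<xi> /\<^sub>R norm \<xi>)) = central_section (\<lambda>x. indicator S x * f x) \<xi>"
proof -
  have p: "perp (\<xi> /\<^sub>R norm \<xi>) = perp \<xi>" using \<xi> by (simp add: perp_scaleR)
  have [measurable]: "perp \<xi> \<in> sets borel"
  proof -
    have "closed (perp \<xi>)" unfolding perp_def using closed_hyperplane[of \<xi> 0] by (simp add: inner_commute)
    then show ?thesis by simp
  qed
  have s: "subspace_lborel (perp \<xi>) = distr (coords (onb \<xi>)) borel (lincomb (onb \<xi>))"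
    unfolding subspace_lborel_def onb_def Let_def lincomb_def[abs_def] ..
  have l: "lincomb (onb \<xi>) c \<in> perp \<xi>" for c
    using lincomb_perp[OF orthonormal_onb, of \<xi> c] by (simp add: perp_def)
  show ?thesis
    unfolding section_measure_def p s set_lebesgue_integral_def central_section_def
    by (subst integral_distr) (auto simp: indicator_def l)
qed

lemma central_section_ball:
  assumes \<xi>: "\<xi> \<noteq> (0::'a::euclidean_space)" and r: "r > 0"
  shows "central_section (indicator (cball 0 r)) \<xi> = unit_ball_vol (real (DIM('a) - 1)) * r ^ (DIM('a) - 1)"
proof -
  let ?P = "coords (onb \<xi>)"
  let ?S = "{c. sqrt (\<Sum>b\<in>onb \<xi>. (c b)\<^sup>2) \<le> r} \<inter> space ?P"
  have fin: "finite (onb \<xi>)" using orthonormal_onb by (rule orthonormal_finite)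
  have "?S = lincomb (onb \<xi>) -` cball 0 r \<inter> space ?P" by (auto simp: norm_lincomb[OF orthonormal_onb])
  then have S: "?S \<in> sets ?P" using measurable_sets[OF measurable_lincomb, of "cball 0 r" "onb \<xi>"] by simp
  have "central_section (indicator (cball 0 r)) \<xi> = (LINT c|?P. indicator ?S c)"
    unfolding central_section_def by (intro Bochner_Integration.integral_cong refl) (simp add: indicator_def norm_lincomb[OF orthonormal_onb])
  also have "\<dots> = measure ?P ?S" using S by simp
  also have "\<dots> = unit_ball_vol (real (DIM('a) - 1)) * r ^ (DIM('a) - 1)"
    unfolding measure_def emeasure_cball_aux[OF fin r] card_onb[OF \<xi>] using r by simp
  finally show ?thesis .
qed

section \<open>Stability of measures under comparison of sections\<close>

lemma central_section_integrable:
  fixes h :: "'a::euclidean_space \<Rightarrow> real"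
  assumes [measurable]: "h \<in> borel_measurable borel" and h: "\<And>x. \<bar>h x\<bar> \<le> M * indicator (cball 0 R) x"
    and R: "R > 0" and \<xi>: "\<xi> \<noteq> 0"
  shows "integrable (coords (onb \<xi>)) (\<lambda>c. h (lincomb (onb \<xi>) c))"
proof (rule Bochner_Integration.integrable_bound)
  let ?P = "coords (onb \<xi>)"
  show "integrable ?P (\<lambda>c. M * indicator (coord_box (onb \<xi>) R) c)"
    by (intro integrable_mult_right coord_box_integral(1) orthonormal_finite[OF orthonormal_onb] less_imp_le[OF R])
  show "AE c in ?P. norm (h (lincomb (onb \<xi>) c)) \<le> norm (M * indicator (coord_box (onb \<xi>) R) c)"
  proof (rule AE_I2)
    fix c assume "c \<in> space ?P"
    then have c: "c \<in> extensional (onb \<xi>)" by (auto simp: space_PiM PiE_def)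
    have e: "norm (\<xi> /\<^sub>R norm \<xi>) = 1" using \<xi> by simp
    have B: "orthonormal_basis (onb \<xi>) (perp (\<xi> /\<^sub>R norm \<xi>))" using orthonormal_onb[of \<xi>] \<xi> by (simp add: perp_scaleR)
    have "c \<in> coord_box (onb \<xi>) R" if "lincomb (onb \<xi>) c \<in> cball 0 R"
    proof -
      have "\<bar>c b\<bar> \<le> R" if "b \<in> onb \<xi>" for b
        using coords_bound(3)[OF B e, of c 0 R b] \<open>lincomb (onb \<xi>) c \<in> cball 0 R\<close> that by simp
      then show ?thesis using c by (auto simp: coord_box_def PiE_def abs_le_iff minus_le_iff)
    qed
    then have "\<bar>h (lincomb (onb \<xi>) c)\<bar> \<le> \<bar>M\<bar> * indicator (coord_box (onb \<xi>) R) c"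
      using h[of "lincomb (onb \<xi>) c"] by (cases "lincomb (onb \<xi>) c \<in> cball 0 R") (auto simp: indicator_def)
    then show "norm (h (lincomb (onb \<xi>) c)) \<le> norm (M * indicator (coord_box (onb \<xi>) R) c)"
      by (simp add: abs_mult)
  qed
qed measurable

lemma le_powr_of_power_le:
  assumes "0 \<le> a" "a ^ n \<le> V" "n > 0"
  shows "a \<le> V powr (1 / real n)"
proof (cases "a = 0")
  case False
  then have "a = (a ^ n) powr (1 / real n)" using assms by (simp add: powr_realpow[symmetric] powr_powr)
  also have "\<dots> \<le> V powr (1 / real n)" using assms by (intro powr_mono2) auto
  finally show ?thesis .
qed simp

text \<open>
The theorem in a Euclidean space of dimension 2 to 4, by the comparison of \<open>f * (1\<^sub>K - 1\<^sub>L)\<close> with a multiple of the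
indicator of a ball that is described at the beginning.
\<close>
lemma measure_stability:
  fixes f :: "'a::euclidean_space \<Rightarrow> real"
  assumes n2: "2 \<le> DIM('a)" and n4: "DIM('a) \<le> 4"
    and cont: "continuous_on UNIV f" and pos: "\<And>x. f x > 0"
    and K: "convex_body K" "origin_symmetric K" and L: "convex_body L"
    and \<epsilon>: "\<epsilon> > 0"
    and sec: "\<And>\<xi>. \<xi> \<in> sphere 0 1 \<Longrightarrow> section_measure f \<xi> (K \<inter> perp \<xi>) \<le> section_measure f \<xi> (L \<inter> perp \<xi>) + \<epsilon>"
  shows "body_measure f K \<le> body_measure f L
    + real DIM('a) * \<epsilon> / (real DIM('a) - 1) * measure lborel K powr (1 / real DIM('a))"
proof -
  define n where "n = DIM('a)"
  have n: "2 \<le> n" "n \<le> 4" "n > 0" using n2 n4 by (auto simp: n_def)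
  have cptK: "compact K" and cvxK: "convex K" and intK: "0 \<in> interior K" using K by (auto simp: convex_body_def)
  have cptL: "compact L" and cvxL: "convex L" and intL: "0 \<in> interior L" using L by (auto simp: convex_body_def)
  have fb[measurable]: "f \<in> borel_measurable borel" using cont by (rule borel_measurable_continuous_onI)
  note [measurable] = body_borel[OF cptK] body_borel[OF cptL]
  obtain \<rho>' where \<rho>': "\<And>x. x \<in> K \<union> L \<Longrightarrow> norm x \<le> \<rho>'"
    using compact_imp_bounded[OF compact_Un[OF cptK cptL]] by (auto simp: bounded_iff)
  define \<rho> where "\<rho> = max \<rho>' 1"
  have \<rho>: "K \<subseteq> cball 0 \<rho>" "L \<subseteq> cball 0 \<rho>" "\<rho> > 0" using \<rho>' by (force simp: \<rho>_def)+
  obtain F where F: "\<And>x. x \<in> cball 0 \<rho> \<Longrightarrow> \<bar>f x\<bar> \<le> F"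
    using compact_imp_bounded[OF compact_continuous_image[OF continuous_on_subset[OF cont], of "cball 0 \<rho>"]]
    by (force simp: bounded_iff)
  have F0: "0 \<le> F" using F[of 0] \<rho>(3) by (force intro: order_trans[OF abs_ge_zero])
  define V where "V = measure lborel K"
  have V: "V > 0"
  proof -
    obtain d where d: "d > 0" "cball 0 d \<subseteq> K" using intK by (meson mem_interior_cball)
    have "measure lborel (cball (0::'a) d) \<le> V"
      unfolding V_def using d emeasure_compact_finite[OF cptK] by (intro measure_mono_fmeasurable fmeasurableI) auto
    moreover have "measure lborel (cball (0::'a) d) > 0" using d by (simp add: content_cball)
    ultimately show ?thesis by linarith
  qed
  define \<kappa> where "\<kappa> j = unit_ball_vol (real j)" for j :: nat
  have \<kappa>: "\<kappa> j > 0" for j by (simp add: \<kappa>_def)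
  \<comment> \<open>the radius of the ball with the volume of \<open>K\<close>\<close>
  define r where "r = (V / \<kappa> n) powr (1 / real n)"
  have r: "r > 0" using V \<kappa>[of n] by (simp add: r_def)
  have rn: "r ^ n = V / \<kappa> n"
    using V \<kappa>[of n] n by (simp add: r_def powr_realpow[symmetric] powr_powr)
  have vol: "measure lborel (cball (0::'a) r) = V"
  proof -
    have "measure lborel (cball (0::'a) r) = \<kappa> n * r ^ n" using r by (simp add: content_cball n_def \<kappa>_def)
    then show ?thesis using rn \<kappa>[of n] by simp
  qed
  \<comment> \<open>every central section of \<open>b\<close> times the indicator of the ball has integral \<open>\<epsilon>\<close>\<close>
  define b where "b = \<epsilon> / (\<kappa> (n - 1) * r ^ (n - 1))"
  have b: "b > 0" using \<epsilon> \<kappa>[of "n - 1"] r by (simp add: b_def)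
  define u where "u x = indicator K x * f x - indicator L x * f x" for x
  define v where "v x = u x - b * indicator (cball 0 r) x" for x
  have [measurable]: "u \<in> borel_measurable borel" "v \<in> borel_measurable borel"
    unfolding u_def[abs_def] v_def[abs_def] by measurable
  have fK: "\<bar>indicator K x * f x\<bar> \<le> F * indicator (cball 0 \<rho>) x"
    and fL: "\<bar>indicator L x * f x\<bar> \<le> F * indicator (cball 0 \<rho>) x" for x
    using F[of x] F0 \<rho> by (auto simp: indicator_def)
  have ub: "\<bar>u x\<bar> \<le> (2 * F) * indicator (cball 0 \<rho>) x" for x
    unfolding u_def using fK[of x] fL[of x] by linarith
  interpret v: test_density v "2 * F + b" "max \<rho> r"
  proof
    show "v \<in> borel_measurable borel" by measurable
    show "\<bar>v x\<bar> \<le> 2 * F + b" for x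
    proof -
      have "\<bar>u x\<bar> \<le> 2 * F" using F0 by (intro order_trans[OF ub mult_left_le]) (auto simp: indicator_def)
      moreover have "0 \<le> b * indicator (cball 0 r) x" "b * indicator (cball 0 r) x \<le> b"
        using b by (auto simp: indicator_def)
      ultimately show ?thesis unfolding v_def by linarith
    qed
    show "norm x \<le> max \<rho> r" if "v x \<noteq> 0" for x
    proof (rule ccontr)
      assume "\<not> norm x \<le> max \<rho> r"
      then have "x \<notin> cball 0 \<rho>" "x \<notin> cball 0 r" by auto
      then have "u x = 0" using ub[of x] by simp
      then show False using that \<open>x \<notin> cball 0 r\<close> by (simp add: v_def)
    qed
    show "max \<rho> r > 0" using r by simp
    show "2 \<le> DIM('a)" by (rule n2)
    fix \<xi> :: 'a assume \<xi>: "\<xi> \<noteq> 0"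
    have cB: "convex (cball (0::'a) r)" "compact (cball (0::'a) r)" "0 \<in> interior (cball (0::'a) r)" using r by auto
    show "AE c in coords (onb \<xi>). isCont v (lincomb (onb \<xi>) c)"
      using AE_section_not_frontier[OF cptK cvxK intK \<xi>] AE_section_not_frontier[OF cptL cvxL intL \<xi>]
        AE_section_not_frontier[OF cB(2,1,3) \<xi>]
    proof eventually_elim
      fix c let ?z = "lincomb (onb \<xi>) c"
      assume z: "?z \<notin> frontier K" "?z \<notin> frontier L" "?z \<notin> frontier (cball 0 r)"
      have ci: "isCont (indicator A :: 'a \<Rightarrow> real) ?z" if "?z \<notin> frontier A" for A
        using that by (simp add: isCont_indicator)
      have "isCont f ?z" using cont by (simp add: continuous_on_eq_continuous_at)
      then show "isCont v ?z" unfolding v_def[abs_def] u_def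
        by (intro continuous_diff continuous_mult continuous_const ci z)
    qed
  qed
  have vsec: "central_section v \<xi> \<le> 0" if \<xi>: "\<xi> \<noteq> 0" for \<xi>
  proof -
    let ?P = "coords (onb \<xi>)"
    have i1: "integrable ?P (\<lambda>c. indicator K (lincomb (onb \<xi>) c) * f (lincomb (onb \<xi>) c))"
      by (rule central_section_integrable[OF _ fK \<rho>(3) \<xi>]) measurable
    have i2: "integrable ?P (\<lambda>c. indicator L (lincomb (onb \<xi>) c) * f (lincomb (onb \<xi>) c))"
      by (rule central_section_integrable[OF _ fL \<rho>(3) \<xi>]) measurable
    have i3: "integrable ?P (\<lambda>c. indicator (cball 0 r) (lincomb (onb \<xi>) c) :: real)"
      by (rule central_section_integrable[OF _ _ r \<xi>, where M=1]) auto
    have "central_section v \<xi> = central_section (\<lambda>x. indicator K x * f x) \<xi> - central_section (\<lambda>x. indicator L x * f x) \<xi>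
        - b * central_section (indicator (cball 0 r)) \<xi>"
      unfolding central_section_def v_def u_def using i1 i2 i3
      by (simp add: Bochner_Integration.integral_diff integrable_mult_right Bochner_Integration.integrable_diff)
    also have "b * central_section (indicator (cball 0 r)) \<xi> = \<epsilon>"
    proof -
      have "central_section (indicator (cball 0 r)) \<xi> = \<kappa> (n - 1) * r ^ (n - 1)"
        unfolding n_def \<kappa>_def by (rule central_section_ball[OF \<xi> r])
      then show ?thesis using \<kappa>[of "n - 1"] r by (simp add: b_def)
    qed
    also have "central_section (\<lambda>x. indicator K x * f x) \<xi> - central_section (\<lambda>x. indicator L x * f x) \<xi> - \<epsilon> \<le> 0"
      using sec[of "\<xi> /\<^sub>R norm \<xi>"] \<xi> section_measure_eq[OF fb body_borel[OF cptK] \<xi>] section_measure_eq[OF fb body_borel[OF cptL] \<xi>]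
      by simp
    finally show ?thesis .
  qed
  note ctx = cptK cvxK intK K(2) \<rho>(1) \<rho>(3)
  let ?C = "chord_length K"
  have neg: "(LINT x|lborel. v x * ?C x) \<le> 0"
    by (rule v.chord_integral_nonpos[OF cptK cvxK intK K(2) n4 vsec])
  have iu: "integrable lborel (\<lambda>x. u x * ?C x)" by (rule chord_integrable[OF ctx n2 \<rho>(3) _ ub]) measurable
  have iB: "integrable lborel (\<lambda>x. indicator (cball 0 r) x * ?C x)"
    by (intro chord_integrable[OF ctx n2 r, where M=1]) (auto simp: indicator_def)
  have iball: "integrable lborel (indicator (cball 0 \<rho>) :: 'a \<Rightarrow> real)" by (intro body_integrable compact_cball)
  have iK: "integrable lborel (\<lambda>x. indicator K x * f x)"
    by (rule Bochner_Integration.integrable_bound[OF integrable_mult_right[OF iball, of F]]) (auto intro!: AE_I2 order_trans[OF fK abs_ge_self])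
  have iL: "integrable lborel (\<lambda>x. indicator L x * f x)"
    by (rule Bochner_Integration.integrable_bound[OF integrable_mult_right[OF iball, of F]]) (auto intro!: AE_I2 order_trans[OF fL abs_ge_self])
  have "2 * (body_measure f K - body_measure f L) = (LINT x|lborel. 2 * u x)"
    unfolding u_def body_measure_def set_lebesgue_integral_def using iK iL by simp
  also have "\<dots> \<le> (LINT x|lborel. u x * ?C x)"
  proof (rule integral_mono_AE[OF _ iu])
    show "integrable lborel (\<lambda>x. 2 * u x)"
      unfolding u_def by (intro integrable_mult_right Bochner_Integration.integrable_diff iK iL)
    show "AE x in lborel. 2 * u x \<le> u x * ?C x"
      using AE_lborel_singleton[of "0::'a"]
    proof eventually_elim
      fix x :: 'a assume x: "x \<noteq> 0"
      show "2 * u x \<le> u x * ?C x"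
      proof (cases "x \<in> K")
        case True
        then have "0 \<le> u x" using pos[of x] by (simp add: u_def indicator_def)
        then have "u x * 2 \<le> u x * ?C x" by (intro mult_left_mono chord_length_inside[OF ctx True x])
        then show ?thesis by (simp add: mult.commute)
      next
        case False
        then have "u x \<le> 0" using pos[of x] by (simp add: u_def indicator_def)
        then have "u x * 2 \<le> u x * ?C x" by (intro mult_left_mono_neg chord_length_outside[OF ctx False x])
        then show ?thesis by (simp add: mult.commute)
      qed
    qed
  qed
  also have "\<dots> = (LINT x|lborel. v x * ?C x) + b * (LINT x|lborel. indicator (cball 0 r) x * ?C x)"
  proof -
    have "v x * ?C x = u x * ?C x - b * (indicator (cball 0 r) x * ?C x)" for x
      by (simp add: v_def left_diff_distrib mult.assoc)
    then have "(LINT x|lborel. v x * ?C x) = (LINT x|lborel. u x * ?C x) - (LINT x|lborel. b * (indicator (cball 0 r) x * ?C x))"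
      using Bochner_Integration.integral_diff[OF iu integrable_mult_right[OF iB, of b]] by (simp only:)
    then show ?thesis by (simp only: integral_mult_right_zero)
  qed
  also have "\<dots> \<le> 0 + b * (2 * (real n / (real n - 1)) * V)"
  proof -
    have "(LINT x|lborel. indicator (cball 0 r) x * ?C x) \<le> (LINT x|lborel. indicator K x * ?C x)"
      using vol by (intro ball_chord_integral_le[OF ctx n2 r]) (simp add: V_def)
    also have "\<dots> \<le> 2 * (real n / (real n - 1)) * V"
      unfolding n_def V_def by (rule body_chord_integral[OF ctx n2])
    finally show ?thesis using neg b by (intro add_mono mult_left_mono) auto
  qed
  also have "\<dots> = 2 * (real n / (real n - 1) * (b * V))" by (simp only: add_0_left mult_ac)
  finally have main: "body_measure f K - body_measure f L \<le> real n / (real n - 1) * (b * V)"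
    by (simp only: mult_le_cancel_left_pos zero_less_numeral)
  have bV: "b * V = \<epsilon> * (\<kappa> n * r / \<kappa> (n - 1))"
  proof -
    have "V = \<kappa> n * (r * r ^ (n - 1))"
      using rn \<kappa>[of n] n by (simp add: field_simps power_eq_if)
    then show ?thesis using r \<kappa>[of "n - 1"] by (simp add: b_def field_simps)
  qed
  have "(\<kappa> n * r / \<kappa> (n - 1)) ^ n \<le> V"
  proof -
    have "\<kappa> n ^ n = \<kappa> n * \<kappa> n ^ (n - 1)" using n by (simp add: power_eq_if)
    also have "\<dots> \<le> \<kappa> n * \<kappa> (n - 1) ^ n"
      unfolding \<kappa>_def using unit_ball_vol_power_le[OF n(1,2)] by (intro mult_left_mono) auto
    finally have "\<kappa> n ^ n / \<kappa> (n - 1) ^ n \<le> \<kappa> n" using \<kappa>[of "n - 1"] by (simp add: divide_le_eq)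
    then have "\<kappa> n ^ n / \<kappa> (n - 1) ^ n * r ^ n \<le> \<kappa> n * r ^ n" using r by (intro mult_right_mono) auto
    also have "\<dots> = V" using rn \<kappa>[of n] by simp
    finally show ?thesis by (simp add: power_mult_distrib power_divide)
  qed
  then have "\<kappa> n * r / \<kappa> (n - 1) \<le> V powr (1 / real n)"
    using \<kappa>[of n] \<kappa>[of "n - 1"] r n by (intro le_powr_of_power_le) auto
  then have "b * V \<le> \<epsilon> * V powr (1 / real n)" unfolding bV using \<epsilon> by (intro mult_left_mono) auto
  then have "real n / (real n - 1) * (b * V) \<le> real n / (real n - 1) * (\<epsilon> * V powr (1 / real n))"
    using n by (intro mult_left_mono) auto
  with main show ?thesis unfolding n_def V_def by (simp add: mult.assoc)
qed

theorem theorem2: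
  fixes f :: "real ^ 'n \<Rightarrow> real"
    and K L :: "(real ^ 'n) set"
    and \<epsilon> :: real
  assumes "2 \<le> CARD('n)" and "CARD('n) \<le> 4"
    and "continuous_on UNIV f"
    and "\<And>x. f x > 0"
    and "\<And>x. f (- x) = f x"
    and "convex_body K" and "origin_symmetric K"
    and "convex_body L" and "origin_symmetric L"
    and "\<epsilon> > 0"
    and "\<And>\<xi>. \<xi> \<in> sphere 0 1 \<Longrightarrow>
           section_measure f \<xi> (K \<inter> perp \<xi>) \<le> section_measure f \<xi> (L \<inter> perp \<xi>) + \<epsilon>"
  shows "body_measure f K \<le> body_measure f L
           + real CARD('n) * \<epsilon> / (real CARD('n) - 1) * measure lborel K powr (1 / real CARD('n))"
proof -
  have d: "DIM(real ^ 'n) = CARD('n)" by simp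
  show ?thesis
    using measure_stability[of f K L \<epsilon>] assms unfolding d by blast
qed

end
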